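(* Let $1<p<2<q<\infty$. Then the following four sets are pairwise distinct proper closed ideals of $L(\ell_p,\ell_q)$ (proper meaning different from $L(\ell_p,\ell_q)$): the ideal $\mathcal K$ of all compact operators; the closed ideal $\mathcal J^{I_{p,q}}$ generated by the formal identity operator $I_{p,q}\colon\ell_p\to\ell_q$; the ideal $\mathcal J^{\mathrm{FSS}}$ of all finitely strictly singular operators; and the closure $\mathcal J^{\ell_2}$ of the ideal of all operators that factor through $\ell_2$.
   Context: $L(X,Y)$ is the space of bounded linear operators from $X$ to $Y$, and $L(X)=L(X,X)$. An ideal in $L(\ell_p,\ell_q)$ is a linear subspace $\mathcal J\subseteq L(\ell_p,\ell_q)$ such that $ATB\in\mathcal J$ whenever $A\in L(\ell_q)$, $T\in\mathcal J$, $B\in L(\ell_p)$; it is closed if it is closed in the operator norm. All ideals below are in $L(\ell_p,\ell_q)$. For $S\in L(\ell_p,\ell_q)$, $\mathcal J^S$ is the smallest closed ideal containing $S$. $I_{p,q}\colon\ell_p\to\ell_q$ is the formal identity $x\mapsto x$. $\mathcal J^{\ell_2}$ is the operator-norm closure of the set of operators $S\in L(\ell_p,\ell_q)$ that can be written $S=AB$ with $B\in L(\ell_p,\ell_2)$, $A\in L(\ell_2,\ell_q)$. An operator $S\colon X\to Y$ is finitely strictly singular (FSS) if for every $\varepsilon>0$ there is $n\in\mathbb N$ such that $\inf_{x\in E,\|x\|=1}\|Sx\|<\varepsilon$ for every $n$-dimensional subspace $E$ of $X$; $\mathcal J^{\mathrm{FSS}}$ is the set of all FSS operators in $L(\ell_p,\ell_q)$.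 *)

theory Defs
  imports "HOL-Analysis.Analysis" "HOL-Library.Function_Algebras"
begin

text \<open>
  The scalars are an arbitrary type \<open>'k\<close> of sort \<open>{real_normed_field, euclidean_space}\<close>.
  By the Frobenius theorem such a type is isometrically isomorphic to the reals or to the
  complex numbers, and both are instances, so the real and the complex case are covered at once.
  Addition, subtraction and zero of sequences and of operators are the pointwise ones of
  \<open>Function_Algebras\<close>.
\<close>

type_synonym 'k sequence = "nat \<Rightarrow> 'k"
type_synonym 'k operator = "'k sequence \<Rightarrow> 'k sequence"

definition seq_scale :: "'k::real_normed_field \<Rightarrow> 'k sequence \<Rightarrow> 'k sequence" where
  "seq_scale c x = (\<lambda>i. c * x i)"

definition op_scale :: "'k::real_normed_field \<Rightarrow> 'k operator \<Rightarrow> 'k operator" where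
  "op_scale c T = (\<lambda>x. seq_scale c (T x))"

interpretation seq: vector_space seq_scale
  by unfold_locales (auto simp: seq_scale_def fun_eq_iff algebra_simps)

interpretation opr: vector_space op_scale
  by unfold_locales (auto simp: op_scale_def seq_scale_def fun_eq_iff algebra_simps)

definition lp :: "real \<Rightarrow> 'k::real_normed_field sequence set" where
  "lp p = {x. summable (\<lambda>i. norm (x i) powr p)}"

definition lp_norm :: "real \<Rightarrow> 'k::real_normed_field sequence \<Rightarrow> real" where
  "lp_norm p x = (\<Sum>i. norm (x i) powr p) powr (1 / p)"

definition lp_topology :: "real \<Rightarrow> 'k::real_normed_field sequence topology" where
  "lp_topology p = Metric_space.mtopology (lp p) (\<lambda>x y. lp_norm p (x - y))"

text \<open>
  An operator on \<open>lp p\<close> is represented by a total function vanishing outside \<open>lp p\<close>. This makes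
  the representation unique and stable under pointwise operations and composition.
\<close>

definition bounded_ops :: "real \<Rightarrow> real \<Rightarrow> 'k::real_normed_field operator set" where
  "bounded_ops p q = {T.
     (\<forall>x\<in>lp p. T x \<in> lp q) \<and> (\<forall>x. x \<notin> lp p \<longrightarrow> T x = 0) \<and>
     (\<forall>x\<in>lp p. \<forall>y\<in>lp p. T (x + y) = T x + T y) \<and>
     (\<forall>c. \<forall>x\<in>lp p. T (seq_scale c x) = seq_scale c (T x)) \<and>
     (\<exists>C. \<forall>x\<in>lp p. lp_norm q (T x) \<le> C * lp_norm p x)}"

text \<open>
  The operator norm is set to \<open>0\<close> on unbounded maps, where \<open>SUP\<close> is unspecified, so that
  the distance below is nonnegative everywhere, as the locale \<open>Metric_space\<close> requires.
\<close>

definition op_norm :: "real \<Rightarrow> real \<Rightarrow> 'k::real_normed_field operator \<Rightarrow> real" where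
  "op_norm p q T = (if T \<in> bounded_ops p q
     then (SUP x\<in>{x \<in> lp p. lp_norm p x \<le> 1}. lp_norm q (T x)) else 0)"

definition op_topology :: "real \<Rightarrow> real \<Rightarrow> 'k::real_normed_field operator topology" where
  "op_topology p q = Metric_space.mtopology (bounded_ops p q) (\<lambda>S T. op_norm p q (S - T))"

definition op_ideal :: "real \<Rightarrow> real \<Rightarrow> 'k::real_normed_field operator set \<Rightarrow> bool" where
  "op_ideal p q J \<longleftrightarrow> J \<subseteq> bounded_ops p q \<and> opr.subspace J \<and>
     (\<forall>A\<in>bounded_ops q q. \<forall>T\<in>J. \<forall>B\<in>bounded_ops p p. A \<circ> T \<circ> B \<in> J)"

definition closed_op_ideal :: "real \<Rightarrow> real \<Rightarrow> 'k::real_normed_field operator set \<Rightarrow> bool" where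
  "closed_op_ideal p q J \<longleftrightarrow> op_ideal p q J \<and> closedin (op_topology p q) J"

definition generated_ideal ::
    "real \<Rightarrow> real \<Rightarrow> 'k::real_normed_field operator \<Rightarrow> 'k operator set" where
  "generated_ideal p q S = \<Inter>{J. closed_op_ideal p q J \<and> S \<in> J}"

definition formal_identity :: "real \<Rightarrow> 'k::real_normed_field operator" where
  "formal_identity p = (\<lambda>x. if x \<in> lp p then x else 0)"

definition compact_ops :: "real \<Rightarrow> real \<Rightarrow> 'k::real_normed_field operator set" where
  "compact_ops p q = {T \<in> bounded_ops p q.
     compactin (lp_topology q)
       (lp_topology q closure_of (T ` {x \<in> lp p. lp_norm p x \<le> 1}))}"

text \<open>
  In the next definition \<open>n > 0\<close> excludes the infimum over the empty unit sphere of the zero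
  space; it also forces \<open>E\<close> to be finite-dimensional, since \<open>dim\<close> is \<open>0\<close> on infinite-dimensional
  subspaces.
\<close>

definition fss_ops :: "real \<Rightarrow> real \<Rightarrow> 'k::real_normed_field operator set" where
  "fss_ops p q = {S \<in> bounded_ops p q. \<forall>\<epsilon>>0. \<exists>n>0. \<forall>E.
     seq.subspace E \<and> E \<subseteq> lp p \<and> seq.dim E = n \<longrightarrow>
       (INF x\<in>{x \<in> E. lp_norm p x = 1}. lp_norm q (S x)) < \<epsilon>}"

definition factor_l2_closure :: "real \<Rightarrow> real \<Rightarrow> 'k::real_normed_field operator set" where
  "factor_l2_closure p q = op_topology p q closure_of
     {A \<circ> B | A B. B \<in> bounded_ops p 2 \<and> A \<in> bounded_ops 2 q}"

end

theory Submission
  imports Defs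
begin

text \<open>
  Four operators tell the ideals apart and show that they are proper.

  The formal identity \<open>I\<close> from \<open>\<ell>\<^sub>p\<close> to \<open>\<ell>\<^sub>q\<close> maps unit vectors to unit vectors, so it is not compact.

  Reserve a block of \<open>2\<^sup>n\<close> coordinates for every \<open>n\<close>. By Khintchine's inequality the \<open>n\<close> Rademacher functions
  on the \<open>n\<close>-th block of \<open>\<ell>\<^sub>p\<close> span a copy of \<open>\<ell>\<^sub>2\<^sup>n\<close> that is complemented with a uniform constant. So there are
  an operator \<open>P\<close> from
  \<open>\<ell>\<^sub>p\<close> to \<open>\<ell>\<^sub>2\<close> that reads off the Rademacher coefficients (\<open>rad_coeff\<close>) and an operator \<open>E\<close> from \<open>\<ell>\<^sub>2\<close> to
  \<open>\<ell>\<^sub>q\<close> that builds the Rademacher sums (\<open>rad_embed\<close>). The composition \<open>V = E P\<close> factors through \<open>\<ell>\<^sub>2\<close> and is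
  bounded below, with a uniform constant, on spaces of every finite dimension, so it is not finitely strictly singular
  (\<open>rad_projection_not_fss\<close>).

  If \<open>E\<close> is replaced by the formal identity from \<open>\<ell>\<^sub>2\<close> to \<open>\<ell>\<^sub>q\<close>, the result \<open>T\<close> still factors through \<open>\<ell>\<^sub>2\<close>, but
  it is finitely strictly singular: random signed sums of an orthonormal system of \<open>n\<close> vectors have
  \<open>\<ell>\<^sub>q\<close>-norm of smaller order than their \<open>\<ell>\<^sub>2\<close>-norm (\<open>formal_identity_two_fss\<close>). It is not compact, and it does
  not lie in the closed ideal generated by \<open>I\<close>. The reason is that for \<open>p < 2\<close> an operator of norm at
  most \<open>C\<close> from \<open>\<ell>\<^sub>2\<^sup>n\<close> to \<open>\<ell>\<^sub>p\<close> maps all but boundedly many basis vectors, independently of \<open>n\<close>, to vectors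
  with small coordinates, because disjoint large coordinates add up faster in \<open>\<ell>\<^sub>p\<close> than in \<open>\<ell>\<^sub>2\<close>
  (\<open>l2_bounded_sup_large_card\<close>); and \<open>I\<close> makes vectors with small coordinates small. To be small
  on all but boundedly many members of such families defines a closed ideal (\<open>closed_op_ideal_l2_null\<close>),
  which contains \<open>I\<close> and does not contain \<open>T\<close>, since \<open>T\<close> maps the Rademacher functions to unit vectors.

  Finally there is an operator \<open>U\<close> that is not a limit of operators factoring through \<open>\<ell>\<^sub>2\<close>
  (\<open>exists_not_factor_l2\<close>). Pair a matrix of size \<open>N = 2\<^sup>n\<close> with the Walsh matrix. Factorisation through \<open>\<ell>\<^sub>2\<close>
  bounds the pairing by a multiple of \<open>N\<^bsup>3/2\<^esup>\<close> (\<open>walsh_pairing_factor_l2_le\<close>). As an operator from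
  \<open>\<ell>\<^sub>p\<close> to \<open>\<ell>\<^sub>q\<close> the Walsh matrix has norm of smaller order than \<open>N\<^bsup>1/2\<^esup>\<close>, so the pairing attains values of larger
  order than \<open>N\<^bsup>3/2\<^esup>\<close> on the unit ball. The blocks of \<open>U\<close> are matrices that nearly attain the maximum.

  Most of the work for the ideal properties is routine. Two points are not: the sum of finitely
  strictly singular operators has this property because such an operator is small on whole subspaces of large
  subspaces (\<open>fss_small_subspace\<close>), and the sum of two factorisations passes through
  \<open>\<ell>\<^sub>2 \<oplus> \<ell>\<^sub>2 \<cong> \<ell>\<^sub>2\<close> (\<open>factor_l2_add\<close>).
\<close>

section \<open>The spaces \<open>\<ell>\<^sub>p\<close>\<close>

lemma powr_convex_combination:
  fixes a b t p :: real
  assumes "1 \<le> p" "0 \<le> a" "0 \<le> b" "0 \<le> t" "t \<le> 1"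
  shows "(t * a + (1 - t) * b) powr p \<le> t * a powr p + (1 - t) * b powr p"
proof -
  have shrink: "(s * c) powr p \<le> s * c powr p" if "0 \<le> s" "s \<le> 1" "0 \<le> c" for s c :: real
  proof -
    have "s powr p \<le> s"
      using powr_mono'[of 1 p s] that assms(1) by (cases "s = 0") auto
    thus ?thesis using that by (simp add: powr_mult mult_right_mono)
  qed
  consider "a = 0" | "b = 0" | "a > 0" "b > 0" using assms by linarith
  thus ?thesis
  proof cases
    case 1 thus ?thesis using shrink[of "1 - t" b] assms by simp
  next
    case 2 thus ?thesis using shrink[of t a] assms by simp
  next
    case 3 thus ?thesis
      using convex_onD[OF powr_convex[OF assms(1)], of "1 - t" a b] assms by simp
  qed
qed

lemma Holder_sum:
  fixes a b :: "'i \<Rightarrow> real"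
  assumes "1 < p" "1 < q" "1 / p + 1 / q = 1" "\<And>i. i \<in> F \<Longrightarrow> 0 \<le> a i" "\<And>i. i \<in> F \<Longrightarrow> 0 \<le> b i"
  shows "(\<Sum>i\<in>F. a i * b i) \<le> (\<Sum>i\<in>F. a i powr p) powr (1/p) * (\<Sum>i\<in>F. b i powr q) powr (1/q)"
proof (cases "finite F")
  case True
  define A where "A = (\<Sum>i\<in>F. a i powr p)"
  define B where "B = (\<Sum>i\<in>F. b i powr q)"
  have A0: "A \<ge> 0" "B \<ge> 0" unfolding A_def B_def by (auto intro: sum_nonneg)
  consider "A = 0" | "B = 0" | "A > 0" "B > 0" using A0 by linarith
  thus ?thesis
  proof cases
    case 1
    hence "a i = 0" if "i \<in> F" for i
      using that True sum_nonneg_eq_0_iff[of F "\<lambda>i. a i powr p"] unfolding A_def by auto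
    thus ?thesis by simp
  next
    case 2
    hence "b i = 0" if "i \<in> F" for i
      using that True sum_nonneg_eq_0_iff[of F "\<lambda>i. b i powr q"] unfolding B_def by auto
    thus ?thesis by simp
  next
    case 3
    define \<alpha> where "\<alpha> = A powr (1/p)"
    define \<beta> where "\<beta> = B powr (1/q)"
    have pos: "\<alpha> > 0" "\<beta> > 0" using 3 unfolding \<alpha>_def \<beta>_def by auto
    have pw: "\<alpha> powr p = A" "\<beta> powr q = B" using 3 assms by (auto simp: \<alpha>_def \<beta>_def powr_powr)
    have "(\<Sum>i\<in>F. (a i / \<alpha>) * (b i / \<beta>)) \<le> (\<Sum>i\<in>F. (a i / \<alpha>) powr p / p + (b i / \<beta>) powr q / q)"
      using pos assms by (intro sum_mono Youngs_inequality) auto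
    also have "\<dots> = (\<Sum>i\<in>F. a i powr p / A / p + b i powr q / B / q)"
      using pos assms pw by (intro sum.cong refl) (simp add: powr_divide)
    also have "\<dots> = A / A / p + B / B / q"
      unfolding sum.distrib sum_divide_distrib[symmetric] A_def[symmetric] B_def[symmetric] ..
    also have "\<dots> = 1" using 3 assms by simp
    finally have "(\<Sum>i\<in>F. a i * b i) / (\<alpha> * \<beta>) \<le> 1"
      by (simp add: sum_divide_distrib)
    thus ?thesis using pos by (simp add: field_simps A_def B_def \<alpha>_def \<beta>_def)
  qed
qed simp

lemma lp_norm_nonneg [simp]: "0 \<le> lp_norm p x"
  by (simp add: lp_norm_def)

lemma lp_norm_powr:
  assumes "x \<in> lp p" "0 < p"
  shows "lp_norm p x powr p = (\<Sum>i. norm (x i) powr p)"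
proof -
  have "0 \<le> (\<Sum>i. norm (x i) powr p)"
    using assms by (intro suminf_nonneg) (auto simp: lp_def)
  thus ?thesis using assms by (simp add: lp_norm_def powr_powr)
qed

lemma lp_sum_le:
  assumes "x \<in> lp p" "0 < p" "finite F"
  shows "(\<Sum>i\<in>F. norm (x i) powr p) \<le> lp_norm p x powr p"
  using assms by (auto simp: lp_norm_powr lp_def intro!: sum_le_suminf)

text \<open>
  Finite partial sums characterise both membership in \<open>\<ell>\<^sub>p\<close> and norm bounds, so that no summability
  question arises when operators are defined coordinatewise.
\<close>

lemma lp_boundI:
  fixes x :: "'k::real_normed_field sequence"
  assumes "0 < p" "0 \<le> C" "\<And>F. finite F \<Longrightarrow> (\<Sum>i\<in>F. norm (x i) powr p) \<le> C powr p"
  shows "x \<in> lp p" "lp_norm p x \<le> C"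
proof -
  show 1: "x \<in> lp p"
    unfolding lp_def using assms(3)[OF finite_lessThan]
    by (auto intro!: summableI_nonneg_bounded[where x = "C powr p"])
  have "lp_norm p x powr p \<le> C powr p"
    unfolding lp_norm_powr[OF 1 assms(1)] using 1 assms(3)[OF finite_lessThan]
    by (intro suminf_le_const) (auto simp: lp_def)
  thus "lp_norm p x \<le> C"
    using assms powr_less_mono2[of p C "lp_norm p x"] by force
qed

lemma lp_coord_le:
  assumes "x \<in> lp p" "0 < p"
  shows "norm (x i) \<le> lp_norm p x"
proof -
  have "norm (x i) powr p \<le> lp_norm p x powr p"
    using lp_sum_le[OF assms, of "{i}"] by simp
  thus ?thesis
    using assms(2) powr_less_mono2[of p "lp_norm p x" "norm (x i)"] by force
qed

lemma lp_norm_eq_0: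
  assumes "x \<in> lp p" "0 < p"
  shows "lp_norm p x = 0 \<longleftrightarrow> x = 0"
proof
  assume "lp_norm p x = 0"
  thus "x = 0" using lp_coord_le[OF assms] by (auto simp: fun_eq_iff)
qed (simp add: lp_norm_def)

lemma zero_lp [simp]: "0 \<in> lp p" "lp_norm p 0 = 0"
  by (auto simp: lp_def lp_norm_def)

lemma lp_add:
  assumes "x \<in> lp p" "y \<in> lp p" "1 \<le> p"
  shows "x + y \<in> lp p" "lp_norm p (x + y) \<le> lp_norm p x + lp_norm p y"
proof -
  let ?a = "lp_norm p x" and ?b = "lp_norm p y"
  have "x + y \<in> lp p \<and> lp_norm p (x + y) \<le> ?a + ?b"
  proof (cases "?a = 0 \<or> ?b = 0")
    case True
    thus ?thesis using lp_norm_eq_0[of x p] lp_norm_eq_0[of y p] assms by auto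
  next
    case False
    hence pos: "?a > 0" "?b > 0" using lp_norm_nonneg[of p x] lp_norm_nonneg[of p y] by linarith+
    define t where "t = ?a / (?a + ?b)"
    have t: "0 \<le> t" "t \<le> 1" "1 - t = ?b / (?a + ?b)"
      using pos by (auto simp: t_def field_simps)
    have "(\<Sum>i\<in>F. norm ((x + y) i) powr p) \<le> (?a + ?b) powr p" if F: "finite F" for F
    proof -
      have "norm ((x + y) i) powr p \<le>
          (?a + ?b) powr p * (t * (norm (x i) / ?a) powr p + (1 - t) * (norm (y i) / ?b) powr p)" for i
      proof -
        have "norm ((x + y) i) \<le> norm (x i) + norm (y i)"
          by (simp add: norm_triangle_ineq)
        also have "\<dots> = (?a + ?b) * (t * (norm (x i) / ?a) + (1 - t) * (norm (y i) / ?b))"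
        proof -
          have "(?a + ?b) * t = ?a" "(?a + ?b) * (1 - t) = ?b"
            unfolding t(3) using pos by (auto simp: t_def)
          thus ?thesis
            using pos unfolding distrib_left mult.assoc[symmetric] by simp
        qed
        finally have "norm ((x + y) i) powr p \<le> \<dots> powr p"
          using assms(3) by (intro powr_mono2) auto
        also have "\<dots> = (?a + ?b) powr p * (t * (norm (x i) / ?a) + (1 - t) * (norm (y i) / ?b)) powr p"
          using pos t by (simp add: powr_mult)
        also have "\<dots> \<le> (?a + ?b) powr p * (t * (norm (x i) / ?a) powr p + (1 - t) * (norm (y i) / ?b) powr p)"
          using pos t assms(3) by (intro mult_left_mono powr_convex_combination) auto
        finally show ?thesis .
      qed
      hence "(\<Sum>i\<in>F. norm ((x + y) i) powr p) \<le> (\<Sum>i\<in>F. (?a + ?b) powr p *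
          (t * (norm (x i) / ?a) powr p + (1 - t) * (norm (y i) / ?b) powr p))"
        by (rule sum_mono)
      also have "\<dots> = (?a + ?b) powr p * (t * ((\<Sum>i\<in>F. norm (x i) powr p) / ?a powr p) +
          (1 - t) * ((\<Sum>i\<in>F. norm (y i) powr p) / ?b powr p))"
        using pos by (simp add: powr_divide sum.distrib flip: sum_distrib_left sum_divide_distrib)
      also have "\<dots> \<le> (?a + ?b) powr p * (t * 1 + (1 - t) * 1)"
        using lp_sum_le[OF assms(1) _ F] lp_sum_le[OF assms(2) _ F] assms(3) pos t
        by (intro mult_left_mono add_mono) (auto simp: divide_simps)
      finally show ?thesis by simp
    qed
    thus ?thesis using lp_boundI[of p "?a + ?b" "x + y"] assms pos by auto
  qed
  thus "x + y \<in> lp p" "lp_norm p (x + y) \<le> ?a + ?b" by auto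
qed

lemma lp_scale:
  fixes x :: "'k::real_normed_field sequence"
  assumes "x \<in> lp p" "0 < p"
  shows "seq_scale c x \<in> lp p" "lp_norm p (seq_scale c x) = norm c * lp_norm p x"
proof -
  have s: "summable (\<lambda>i. norm (x i) powr p)" using assms by (simp add: lp_def)
  have eq: "(\<lambda>i. norm (seq_scale c x i) powr p) = (\<lambda>i. norm c powr p * norm (x i) powr p)"
    by (auto simp: seq_scale_def norm_mult powr_mult)
  show "seq_scale c x \<in> lp p" using s eq by (simp add: lp_def summable_mult)
  have "0 \<le> (\<Sum>i. norm (x i) powr p)" using s by (intro suminf_nonneg) auto
  thus "lp_norm p (seq_scale c x) = norm c * lp_norm p x"
    unfolding lp_norm_def eq using s assms(2) by (simp add: suminf_mult powr_mult powr_powr)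
qed

lemma uminus_seq_scale: "- x = seq_scale (-1) x" for x :: "'k::real_normed_field sequence"
  by (auto simp: seq_scale_def)

lemma lp_uminus:
  fixes x :: "'k::real_normed_field sequence"
  assumes "x \<in> lp p" "0 < p"
  shows "- x \<in> lp p" "lp_norm p (- x) = lp_norm p x"
  using lp_scale[OF assms, of "-1"] unfolding uminus_seq_scale[of x] by simp_all

lemma lp_diff:
  assumes "x \<in> lp p" "y \<in> lp p" "1 \<le> p"
  shows "x - y \<in> lp p" "lp_norm p (x - y) \<le> lp_norm p x + lp_norm p y"
  using lp_add[OF assms(1) lp_uminus(1)[OF assms(2)]] lp_uminus(2)[OF assms(2)] assms by auto

lemma lp_norm_le_diff:
  assumes "x \<in> lp p" "y \<in> lp p" "1 \<le> p"
  shows "lp_norm p x \<le> lp_norm p (x - y) + lp_norm p y"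
  using lp_add(2)[OF lp_diff(1)[OF assms] assms(2,3)] by simp

lemma lp_norm_minus_commute: "lp_norm p (x - y) = lp_norm p (y - x)"
  by (simp add: lp_norm_def norm_minus_commute)

lemma seq_sum_apply: "(\<Sum>i\<in>A. f i) k = (\<Sum>i\<in>A. f i k)" for f :: "'i \<Rightarrow> 'j \<Rightarrow> 'a::comm_monoid_add"
  by (induction A rule: infinite_finite_induct) auto

lemma lp_sum_closed:
  assumes "\<And>i. i \<in> A \<Longrightarrow> x i \<in> lp p" "1 \<le> p"
  shows "(\<Sum>i\<in>A. x i) \<in> lp p"
  using assms(1) by (induction A rule: infinite_finite_induct) (auto intro: lp_add(1) assms(2))

lemma lp_mono:
  fixes x :: "'k::real_normed_field sequence"
  assumes "x \<in> lp p" "0 < p" "p \<le> q"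
  shows "x \<in> lp q" "lp_norm q x \<le> lp_norm p x"
proof -
  let ?C = "lp_norm p x"
  have "(\<Sum>i\<in>F. norm (x i) powr q) \<le> ?C powr q" if F: "finite F" for F
  proof -
    have "(\<Sum>i\<in>F. norm (x i) powr q) \<le> (\<Sum>i\<in>F. ?C powr (q - p) * norm (x i) powr p)"
    proof (intro sum_mono)
      fix i
      have "norm (x i) powr q = norm (x i) powr (q - p) * norm (x i) powr p"
        by (simp flip: powr_add)
      also have "\<dots> \<le> ?C powr (q - p) * norm (x i) powr p"
        using assms lp_coord_le[OF assms(1,2)] by (intro mult_right_mono powr_mono2) auto
      finally show "norm (x i) powr q \<le> ?C powr (q - p) * norm (x i) powr p" .
    qed
    also have "\<dots> = ?C powr (q - p) * (\<Sum>i\<in>F. norm (x i) powr p)" by (simp add: sum_distrib_left)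
    also have "\<dots> \<le> ?C powr (q - p) * ?C powr p"
      using lp_sum_le[OF assms(1,2) F] by (intro mult_left_mono) auto
    finally show ?thesis by (simp flip: powr_add)
  qed
  thus "x \<in> lp q" "lp_norm q x \<le> lp_norm p x"
    using lp_boundI[of q ?C x] assms by auto
qed

definition unit_seq :: "nat \<Rightarrow> 'k::real_normed_field sequence" where
  "unit_seq k = (\<lambda>i. if i = k then 1 else 0)"

lemma unit_seq_apply: "unit_seq k i = (if i = k then 1 else 0)" by (simp add: unit_seq_def)

lemma unit_seq_lp:
  assumes "0 < p"
  shows "(unit_seq k :: 'k sequence) \<in> lp p" "lp_norm p (unit_seq k :: 'k::real_normed_field sequence) = 1"
proof -
  have "(\<lambda>i. norm (unit_seq k i :: 'k) powr p) sums 1"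
    using sums_single[of k "\<lambda>_. 1::real"] by (rule sums_cong[THEN iffD1, rotated]) (auto simp: unit_seq_def)
  thus "(unit_seq k :: 'k sequence) \<in> lp p" "lp_norm p (unit_seq k :: 'k sequence) = 1"
    by (auto simp: lp_def lp_norm_def sums_iff)
qed

lemma lp_complete:
  fixes x :: "nat \<Rightarrow> 'k::{real_normed_field, euclidean_space} sequence"
  assumes "1 \<le> p" "\<And>n. x n \<in> lp p"
    and cauchy: "\<And>e. 0 < e \<Longrightarrow> \<exists>N. \<forall>m\<ge>N. \<forall>n\<ge>N. lp_norm p (x m - x n) \<le> e"
  obtains y where "y \<in> lp p" "\<And>e. 0 < e \<Longrightarrow> \<exists>N. \<forall>n\<ge>N. lp_norm p (x n - y) \<le> e"
proof -
  have p0: "0 < p" using assms(1) by simp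
  have coord: "norm (x m i - x n i) \<le> lp_norm p (x m - x n)" for m n i
    using lp_coord_le[OF lp_diff(1)[OF assms(2) assms(2) assms(1)] p0] by simp
  have "convergent (\<lambda>n. x n i)" for i
  proof (rule Cauchy_convergent, rule metric_CauchyI)
    fix e :: real assume "0 < e"
    then obtain N where "\<forall>m\<ge>N. \<forall>n\<ge>N. lp_norm p (x m - x n) \<le> e / 2"
      using cauchy[of "e / 2"] by auto
    hence "dist (x m i) (x n i) < e" if "m \<ge> N" "n \<ge> N" for m n
      using coord[of m i n] that \<open>0 < e\<close> by (fastforce simp: dist_norm)
    thus "\<exists>N. \<forall>m\<ge>N. \<forall>n\<ge>N. dist (x m i) (x n i) < e" by blast
  qed
  then obtain y where y: "(\<lambda>n. x n i) \<longlonglongrightarrow> y i" for i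
    unfolding convergent_def by metis
  have close: "\<exists>N. \<forall>n\<ge>N. x n - y \<in> lp p \<and> lp_norm p (x n - y) \<le> e" if "0 < e" for e
  proof -
    obtain N where N: "\<And>m n. m \<ge> N \<Longrightarrow> n \<ge> N \<Longrightarrow> lp_norm p (x m - x n) \<le> e"
      using cauchy \<open>0 < e\<close> by meson
    have "(\<Sum>i\<in>F. norm ((x n - y) i) powr p) \<le> e powr p" if "n \<ge> N" "finite F" for n F
    proof (rule tendsto_upperbound)
      show "(\<lambda>m. \<Sum>i\<in>F. norm ((x n - x m) i) powr p) \<longlonglongrightarrow> (\<Sum>i\<in>F. norm ((x n - y) i) powr p)"
        using p0 by (auto intro!: tendsto_intros y)
      show "\<forall>\<^sub>F m in sequentially. (\<Sum>i\<in>F. norm ((x n - x m) i) powr p) \<le> e powr p"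
      proof (rule eventually_sequentiallyI[of N])
        fix m assume "N \<le> m"
        have "(\<Sum>i\<in>F. norm ((x n - x m) i) powr p) \<le> lp_norm p (x n - x m) powr p"
          using lp_diff(1)[OF assms(2) assms(2) assms(1)] p0 that(2) by (intro lp_sum_le)
        also have "\<dots> \<le> e powr p"
          using N[OF that(1) \<open>N \<le> m\<close>] p0 by (intro powr_mono2) auto
        finally show "(\<Sum>i\<in>F. norm ((x n - x m) i) powr p) \<le> e powr p" .
      qed
    qed simp
    hence "x n - y \<in> lp p \<and> lp_norm p (x n - y) \<le> e" if "n \<ge> N" for n
      using lp_boundI[of p e "x n - y"] p0 \<open>0 < e\<close> that by simp
    thus ?thesis by blast
  qed
  obtain N where "x N - y \<in> lp p" using close[of 1] by auto
  hence "x N - (x N - y) \<in> lp p" using lp_diff assms by blast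
  hence "y \<in> lp p" by simp
  thus ?thesis using that close by blast
qed

section \<open>Bounded operators and closed ideals\<close>

lemma bounded_opsI:
  assumes "\<And>x. x \<in> lp p \<Longrightarrow> T x \<in> lp q" "\<And>x. x \<notin> lp p \<Longrightarrow> T x = 0"
    "\<And>x y. x \<in> lp p \<Longrightarrow> y \<in> lp p \<Longrightarrow> T (x + y) = T x + T y"
    "\<And>c x. x \<in> lp p \<Longrightarrow> T (seq_scale c x) = seq_scale c (T x)"
    "\<And>x. x \<in> lp p \<Longrightarrow> lp_norm q (T x) \<le> C * lp_norm p x"
  shows "T \<in> bounded_ops p q"
  using assms unfolding bounded_ops_def by blast

lemma bounded_opsD:
  assumes "T \<in> bounded_ops p q"
  shows "x \<in> lp p \<Longrightarrow> T x \<in> lp q" "x \<notin> lp p \<Longrightarrow> T x = 0"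
    "x \<in> lp p \<Longrightarrow> y \<in> lp p \<Longrightarrow> T (x + y) = T x + T y"
    "x \<in> lp p \<Longrightarrow> T (seq_scale c x) = seq_scale c (T x)"
  using assms by (auto simp: bounded_ops_def)

lemma bounded_ops_in_lp: "T \<in> bounded_ops p q \<Longrightarrow> T x \<in> lp q"
  using bounded_opsD(1)[of T p q x] bounded_opsD(2)[of T p q x] by (cases "x \<in> lp p") auto

lemma bounded_ops_zero: "T \<in> bounded_ops p q \<Longrightarrow> T 0 = 0"
  using bounded_opsD(4)[of T p q 0 0] by simp

lemma bounded_ops_diff:
  assumes "T \<in> bounded_ops p q" "x \<in> lp p" "y \<in> lp p" "1 \<le> p"
  shows "T (x - y) = T x - T y"
proof -
  have "T (x - y + y) = T (x - y) + T y"
    by (rule bounded_opsD(3)[OF assms(1) lp_diff(1)[OF assms(2-4)] assms(3)])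
  thus ?thesis by simp
qed

lemma bounded_ops_sum:
  assumes T: "T \<in> bounded_ops p q" and x: "\<And>i. i \<in> A \<Longrightarrow> x i \<in> lp p" and p: "1 \<le> p"
  shows "T (\<Sum>i\<in>A. seq_scale (c i) (x i)) = (\<Sum>i\<in>A. seq_scale (c i) (T (x i)))"
  using x
proof (induction A rule: infinite_finite_induct)
  case (insert a A)
  have "(\<Sum>i\<in>A. seq_scale (c i) (x i)) \<in> lp p"
    using insert p by (intro lp_sum_closed) (auto intro: lp_scale)
  moreover have xa: "x a \<in> lp p" "seq_scale (c a) (x a) \<in> lp p" using insert p by (auto intro: lp_scale)
  ultimately have "T (seq_scale (c a) (x a) + (\<Sum>i\<in>A. seq_scale (c i) (x i))) =
      seq_scale (c a) (T (x a)) + T (\<Sum>i\<in>A. seq_scale (c i) (x i))"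
    unfolding bounded_opsD(4)[OF T xa(1), symmetric] by (intro bounded_opsD(3)[OF T])
  moreover have "T (\<Sum>i\<in>A. seq_scale (c i) (x i)) = (\<Sum>i\<in>A. seq_scale (c i) (T (x i)))"
    using insert by blast
  ultimately show ?case unfolding sum.insert[OF insert(1,2)] by (simp only:)
qed (auto simp: bounded_ops_zero[OF T])

lemma bounded_ops_boundE:
  fixes T :: "'k::real_normed_field operator"
  assumes "T \<in> bounded_ops p q"
  obtains C where "0 < C" "\<And>x. x \<in> lp p \<Longrightarrow> lp_norm q (T x) \<le> C * lp_norm p x"
proof -
  obtain C where C: "\<And>x. x \<in> lp p \<Longrightarrow> lp_norm q (T x) \<le> C * lp_norm p x"
    using assms unfolding bounded_ops_def by blast
  have "lp_norm q (T x) \<le> max C 1 * lp_norm p x" if "x \<in> lp p" for x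
    using C[OF that] mult_right_mono[of C "max C 1" "lp_norm p x"] by simp
  thus ?thesis by (intro that[of "max C 1"]) auto
qed

lemma op_norm_bound:
  fixes T :: "'k::real_normed_field operator"
  assumes T: "T \<in> bounded_ops p q" and x: "x \<in> lp p" and pq: "0 < p" "0 < q"
  shows "lp_norm q (T x) \<le> op_norm p q T * lp_norm p x"
proof -
  obtain C where C: "0 < C" "\<And>x. x \<in> lp p \<Longrightarrow> lp_norm q (T x) \<le> C * lp_norm p x"
    using bounded_ops_boundE[OF T] by blast
  have bdd: "bdd_above ((\<lambda>x. lp_norm q (T x)) ` {x \<in> lp p. lp_norm p x \<le> 1})"
  proof (rule bdd_aboveI2[of _ _ C])
    fix x :: "'k sequence" assume "x \<in> {x \<in> lp p. lp_norm p x \<le> 1}"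
    hence x: "x \<in> lp p" "lp_norm p x \<le> 1" by auto
    have "C * lp_norm p x \<le> C * 1" using x(2) C(1) by (intro mult_left_mono) auto
    thus "lp_norm q (T x) \<le> C" using C(2)[OF x(1)] by linarith
  qed
  show ?thesis
  proof (cases "lp_norm p x = 0")
    case True
    hence "x = 0" using lp_norm_eq_0 x pq by blast
    thus ?thesis using bounded_ops_zero[OF T] by simp
  next
    case False
    define n where "n = lp_norm p x"
    have n: "n > 0" using False lp_norm_nonneg[of p x] unfolding n_def by linarith
    define y where "y = seq_scale (of_real (inverse n)) x"
    have y: "y \<in> lp p" "lp_norm p y = 1"
      using lp_scale[OF x pq(1), of "of_real (inverse n)"] n by (auto simp: y_def n_def norm_inverse)
    have "lp_norm q (T y) \<le> op_norm p q T"
      using T y bdd unfolding op_norm_def by (auto intro!: cSUP_upper)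
    moreover have "lp_norm q (T y) = inverse n * lp_norm q (T x)"
      unfolding y_def using bounded_opsD[OF T] x lp_scale(2)[OF bounded_opsD(1)[OF T x] pq(2)] n by (simp add: norm_inverse)
    ultimately show ?thesis using n by (simp add: field_simps n_def)
  qed
qed

lemma op_norm_le:
  fixes T :: "'k::real_normed_field operator"
  assumes "0 \<le> C" "\<And>x. x \<in> lp p \<Longrightarrow> lp_norm p x \<le> 1 \<Longrightarrow> lp_norm q (T x) \<le> C"
  shows "op_norm p q T \<le> C"
proof -
  have "{x::'k sequence. x \<in> lp p \<and> lp_norm p x \<le> 1} \<noteq> {}"
    using zero_lp zero_le_one by (metis (mono_tags, lifting) empty_iff mem_Collect_eq)
  thus ?thesis using assms unfolding op_norm_def by (auto intro!: cSUP_least simp del: Collect_empty_eq)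
qed

lemma op_norm_nonneg:
  assumes "0 < p" "0 < q" shows "0 \<le> op_norm p q (T :: 'k::real_normed_field operator)"
proof (cases "T \<in> bounded_ops p q")
  case True
  have "0 \<le> lp_norm q (T (unit_seq 0))" by simp
  also have "\<dots> \<le> op_norm p q T"
    using op_norm_bound[OF True unit_seq_lp(1) assms, of 0] unit_seq_lp(2)[of p 0, where 'k = 'k] assms by simp
  finally show ?thesis .
qed (simp add: op_norm_def)

lemma bounded_ops_add:
  fixes S T :: "'k::real_normed_field operator"
  assumes "S \<in> bounded_ops p q" "T \<in> bounded_ops p q" "1 \<le> p" "1 \<le> q"
  shows "S + T \<in> bounded_ops p q"
proof (rule bounded_opsI[where C = "op_norm p q S + op_norm p q T"])
  fix x :: "'k sequence" assume x: "x \<in> lp p"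
  show "lp_norm q ((S + T) x) \<le> (op_norm p q S + op_norm p q T) * lp_norm p x"
    using lp_add(2)[OF bounded_opsD(1)[OF assms(1) x] bounded_opsD(1)[OF assms(2) x] assms(4)]
      op_norm_bound[OF assms(1) x] op_norm_bound[OF assms(2) x] assms(3,4)
    by (simp add: algebra_simps)
qed (use assms in \<open>auto simp: bounded_opsD[OF assms(1)] bounded_opsD[OF assms(2)] lp_add seq.scale_right_distrib add_ac\<close>)

lemma bounded_ops_scale:
  fixes T :: "'k::real_normed_field operator"
  assumes "T \<in> bounded_ops p q" "1 \<le> p" "1 \<le> q"
  shows "op_scale c T \<in> bounded_ops p q"
proof (rule bounded_opsI[where C = "norm c * op_norm p q T"])
  fix x :: "'k sequence" assume x: "x \<in> lp p"
  show "lp_norm q (op_scale c T x) \<le> norm c * op_norm p q T * lp_norm p x"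
    using lp_scale(2)[OF bounded_opsD(1)[OF assms(1) x], of c]
      op_norm_bound[OF assms(1) x] assms(2,3) mult_left_mono[of _ _ "norm c"]
    by (simp add: op_scale_def mult.assoc)
qed (use assms in \<open>auto simp: bounded_opsD[OF assms(1)] lp_scale op_scale_def seq.scale_right_distrib mult_ac\<close>)

lemma bounded_ops_zero_op: "0 \<in> bounded_ops p q"
  by (rule bounded_opsI[where C = 0]) (auto simp: seq_scale_def fun_eq_iff)

lemma bounded_ops_minus:
  assumes "S \<in> bounded_ops p q" "T \<in> bounded_ops p q" "1 \<le> p" "1 \<le> q"
  shows "S - T \<in> bounded_ops p q"
proof -
  have "S - T = S + op_scale (-1) T" by (auto simp: op_scale_def seq_scale_def fun_eq_iff)
  thus ?thesis using bounded_ops_add bounded_ops_scale assms by metis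
qed

lemma bounded_ops_comp:
  fixes S T :: "'k::real_normed_field operator"
  assumes S: "S \<in> bounded_ops p q" and T: "T \<in> bounded_ops q r" and pqr: "0 < p" "0 < q" "0 < r"
  shows "T \<circ> S \<in> bounded_ops p r"
proof (rule bounded_opsI[where C = "op_norm q r T * op_norm p q S"])
  fix x :: "'k sequence" assume x: "x \<in> lp p"
  have "lp_norm r (T (S x)) \<le> op_norm q r T * lp_norm q (S x)"
    by (rule op_norm_bound[OF T bounded_opsD(1)[OF S x] pqr(2,3)])
  also have "\<dots> \<le> op_norm q r T * (op_norm p q S * lp_norm p x)"
    by (rule mult_left_mono[OF op_norm_bound[OF S x pqr(1,2)] op_norm_nonneg[OF pqr(2,3)]])
  finally show "lp_norm r ((T \<circ> S) x) \<le> op_norm q r T * op_norm p q S * lp_norm p x" by simp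
qed (auto simp: bounded_opsD[OF S] bounded_opsD[OF T] bounded_ops_zero[OF T])

lemma op_norm_minus_commute:
  assumes "1 \<le> p" "1 \<le> q"
  shows "op_norm p q (S - T) = op_norm p q (T - S)"
proof -
  have *: "A - B = op_scale (-1) (B - A)" for A B :: "'a operator"
    by (auto simp: op_scale_def seq_scale_def fun_eq_iff)
  have "S - T \<in> bounded_ops p q \<longleftrightarrow> T - S \<in> bounded_ops p q"
    using bounded_ops_scale[OF _ assms, of _ "-1"] *[of S T] *[of T S] by metis
  thus ?thesis by (simp add: op_norm_def lp_norm_minus_commute)
qed

lemma Metric_space_lp:
  assumes "1 \<le> p" shows "Metric_space (lp p) (\<lambda>x y. lp_norm p (x - y))"
proof
  fix x y z :: "'a sequence" assume xyz: "x \<in> lp p" "y \<in> lp p" "z \<in> lp p"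
  show "lp_norm p (x - y) = 0 \<longleftrightarrow> x = y"
    using lp_norm_eq_0[OF lp_diff(1)[OF xyz(1,2) assms]] assms by auto
  show "lp_norm p (x - z) \<le> lp_norm p (x - y) + lp_norm p (y - z)"
    using lp_add(2)[OF lp_diff(1)[OF xyz(1,2) assms] lp_diff(1)[OF xyz(2,3) assms] assms] by simp
qed (auto simp: lp_norm_minus_commute)

lemma Metric_space_ops:
  assumes "1 \<le> p" "1 \<le> q"
  shows "Metric_space (bounded_ops p q) (\<lambda>S T. op_norm p q (S - T))"
proof
  fix S T U :: "'a operator"
  assume STU: "S \<in> bounded_ops p q" "T \<in> bounded_ops p q" "U \<in> bounded_ops p q"
  have m: "S - T \<in> bounded_ops p q" "T - U \<in> bounded_ops p q"
    using STU bounded_ops_minus assms by blast+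
  show "op_norm p q (S - T) = 0 \<longleftrightarrow> S = T"
  proof
    assume 0: "op_norm p q (S - T) = 0"
    show "S = T"
    proof
      fix x show "S x = T x"
      proof (cases "x \<in> lp p")
        case True
        hence "lp_norm q ((S - T) x) \<le> 0"
          using op_norm_bound[OF m(1) True] 0 assms by simp
        hence "(S - T) x = 0"
          using lp_norm_eq_0[OF bounded_opsD(1)[OF m(1) True]] lp_norm_nonneg[of q "(S - T) x"] assms
          by (metis antisym less_le_trans zero_less_one)
        thus ?thesis by simp
      qed (simp add: bounded_opsD[OF STU(1)] bounded_opsD[OF STU(2)])
    qed
  next
    assume "S = T"
    hence "op_norm p q (S - T) \<le> 0" by (intro op_norm_le) (auto simp: lp_norm_def)
    thus "op_norm p q (S - T) = 0" using op_norm_nonneg[of p q "S - T"] assms by simp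
  qed
  show "op_norm p q (S - U) \<le> op_norm p q (S - T) + op_norm p q (T - U)"
  proof (rule op_norm_le)
    show "0 \<le> op_norm p q (S - T) + op_norm p q (T - U)"
      using assms by (intro add_nonneg_nonneg op_norm_nonneg) auto
    fix x :: "'a sequence" assume x: "x \<in> lp p" "lp_norm p x \<le> 1"
    have "lp_norm q ((S - U) x) = lp_norm q ((S - T) x + (T - U) x)" by simp
    also have "\<dots> \<le> lp_norm q ((S - T) x) + lp_norm q ((T - U) x)"
      using lp_add(2)[OF bounded_opsD(1)[OF m(1) x(1)] bounded_opsD(1)[OF m(2) x(1)] assms(2)] .
    also have "\<dots> \<le> op_norm p q (S - T) * lp_norm p x + op_norm p q (T - U) * lp_norm p x"
      using op_norm_bound[OF m(1) x(1)] op_norm_bound[OF m(2) x(1)] assms by simp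
    also have "\<dots> \<le> op_norm p q (S - T) * 1 + op_norm p q (T - U) * 1"
      using x assms by (intro add_mono mult_left_mono op_norm_nonneg) auto
    finally show "lp_norm q ((S - U) x) \<le> op_norm p q (S - T) + op_norm p q (T - U)" by simp
  qed
qed (use assms op_norm_minus_commute in \<open>auto intro: op_norm_nonneg\<close>)

lemma op_closure_iff:
  assumes "1 \<le> p" "1 \<le> q" "J \<subseteq> bounded_ops p q"
  shows "T \<in> op_topology p q closure_of J \<longleftrightarrow>
    T \<in> bounded_ops p q \<and> (\<forall>e>0. \<exists>S\<in>J. \<forall>x\<in>lp p. lp_norm q (T x - S x) \<le> e * lp_norm p x)"
proof -
  interpret Metric_space "bounded_ops p q" "\<lambda>S T. op_norm p q (S - T)"
    by (rule Metric_space_ops[OF assms(1,2)])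
  have "(\<forall>e>0. \<exists>S\<in>J. op_norm p q (T - S) < e) \<longleftrightarrow>
      (\<forall>e>0. \<exists>S\<in>J. \<forall>x\<in>lp p. lp_norm q (T x - S x) \<le> e * lp_norm p x)"
    (is "?L \<longleftrightarrow> ?R") if T: "T \<in> bounded_ops p q"
  proof (intro iffI allI impI)
    fix e :: real assume "?L" "0 < e"
    then obtain S where S: "S \<in> J" "op_norm p q (T - S) < e" by blast
    have "T - S \<in> bounded_ops p q" using T S assms by (intro bounded_ops_minus) auto
    hence "lp_norm q (T x - S x) \<le> op_norm p q (T - S) * lp_norm p x" if "x \<in> lp p" for x
      using op_norm_bound[of "T - S" p q x] that assms by simp
    moreover have "op_norm p q (T - S) * lp_norm p x \<le> e * lp_norm p x" for x
      using S by (intro mult_right_mono) auto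
    ultimately show "\<exists>S\<in>J. \<forall>x\<in>lp p. lp_norm q (T x - S x) \<le> e * lp_norm p x"
      using S(1) by (meson order_trans)
  next
    fix e :: real assume R: "?R" and e: "0 < e"
    then obtain S where S: "S \<in> J" "\<And>x. x \<in> lp p \<Longrightarrow> lp_norm q (T x - S x) \<le> e/2 * lp_norm p x"
      using half_gt_zero by blast
    have "op_norm p q (T - S) \<le> e / 2"
    proof (rule op_norm_le)
      fix x :: "'a sequence" assume x: "x \<in> lp p" "lp_norm p x \<le> 1"
      have "e/2 * lp_norm p x \<le> e/2 * 1" using x e by (intro mult_left_mono) auto
      thus "lp_norm q ((T - S) x) \<le> e / 2"
        using S(2)[OF x(1)] unfolding fun_diff_def by linarith
    qed (use e in simp)
    thus "\<exists>S\<in>J. op_norm p q (T - S) < e" using S(1) e by (intro bexI[of _ S]) auto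
  qed
  moreover have "T \<in> op_topology p q closure_of J \<longleftrightarrow>
      T \<in> bounded_ops p q \<and> (\<forall>e>0. \<exists>S\<in>J. op_norm p q (T - S) < e)"
    unfolding op_topology_def metric_closure_of using assms(3) by (auto simp: subset_iff)
  ultimately show ?thesis by blast
qed

lemma closedin_ops_iff:
  assumes "1 \<le> p" "1 \<le> q"
  shows "closedin (op_topology p q) J \<longleftrightarrow> J \<subseteq> bounded_ops p q \<and> op_topology p q closure_of J \<subseteq> J"
proof -
  interpret Metric_space "bounded_ops p q" "\<lambda>S T. op_norm p q (S - T)"
    by (rule Metric_space_ops[OF assms])
  show ?thesis using closure_of_subset_eq[of J mtopology] by (simp add: op_topology_def)
qed

lemma formal_identity_bounded:
  assumes "1 \<le> p" "p \<le> q"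
  shows "formal_identity p \<in> bounded_ops p q"
  by (rule bounded_opsI[where C = 1])
    (use assms in \<open>auto simp: formal_identity_def lp_scale lp_add lp_mono\<close>)

lemma op_scale_eq_comp:
  assumes "T \<in> bounded_ops p q"
  shows "op_scale c T = op_scale c (formal_identity q) \<circ> T \<circ> formal_identity p"
  using bounded_ops_in_lp[OF assms] bounded_opsD(2)[OF assms] bounded_ops_zero[OF assms]
  by (auto simp: fun_eq_iff op_scale_def formal_identity_def seq_scale_def)

text \<open>
  For the ideals below the closure step is the only one that involves the topology, so it is
  phrased through pointwise approximation with a uniform error.
\<close>

lemma closed_op_idealI:
  assumes pq: "1 \<le> p" "1 \<le> q" and J: "J \<subseteq> bounded_ops p q"
    and zero: "0 \<in> J" and add: "\<And>S T. S \<in> J \<Longrightarrow> T \<in> J \<Longrightarrow> S + T \<in> J"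
    and comp: "\<And>A T B. A \<in> bounded_ops q q \<Longrightarrow> T \<in> J \<Longrightarrow> B \<in> bounded_ops p p \<Longrightarrow> A \<circ> T \<circ> B \<in> J"
    and closed: "\<And>T. T \<in> bounded_ops p q \<Longrightarrow>
      (\<And>e. 0 < e \<Longrightarrow> \<exists>S\<in>J. \<forall>x\<in>lp p. lp_norm q (T x - S x) \<le> e * lp_norm p x) \<Longrightarrow> T \<in> J"
  shows "closed_op_ideal p q J"
proof -
  have "op_scale c T \<in> J" if T: "T \<in> J" for c T
  proof -
    have "op_scale c (formal_identity q) \<in> bounded_ops q q" "formal_identity p \<in> bounded_ops p p"
      using pq by (auto intro: bounded_ops_scale formal_identity_bounded)
    thus ?thesis
      unfolding op_scale_eq_comp[OF subsetD[OF J T]] by (rule comp[OF _ T])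
  qed
  thus ?thesis
    unfolding closed_op_ideal_def op_ideal_def closedin_ops_iff[OF pq]
    using assms op_closure_iff[OF pq J] by (auto simp: opr.subspace_def)
qed

lemma closed_op_idealD:
  assumes "closed_op_ideal p q J"
  shows "J \<subseteq> bounded_ops p q" "opr.subspace J" "closedin (op_topology p q) J"
    "A \<in> bounded_ops q q \<Longrightarrow> T \<in> J \<Longrightarrow> B \<in> bounded_ops p p \<Longrightarrow> A \<circ> T \<circ> B \<in> J"
  using assms by (auto simp: closed_op_ideal_def op_ideal_def)

lemma closed_op_ideal_bounded_ops:
  assumes "1 \<le> p" "1 \<le> q" shows "closed_op_ideal p q (bounded_ops p q)"
proof (rule closed_op_idealI[OF assms])
  fix A T B :: "'a operator"
  assume "A \<in> bounded_ops q q" "T \<in> bounded_ops p q" "B \<in> bounded_ops p p"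
  thus "A \<circ> T \<circ> B \<in> bounded_ops p q"
    using assms by (intro bounded_ops_comp[of B p p _ q] bounded_ops_comp[of T p q A q]) auto
qed (use assms bounded_ops_add bounded_ops_scale bounded_ops_zero_op in auto)

lemma closed_op_ideal_generated:
  assumes pq: "1 \<le> p" "1 \<le> q" and S: "S \<in> bounded_ops p q"
  shows "closed_op_ideal p q (generated_ideal p q S)"
proof -
  define \<J> where "\<J> = {J. closed_op_ideal p q J \<and> S \<in> J}"
  have ne: "bounded_ops p q \<in> \<J>" unfolding \<J>_def using closed_op_ideal_bounded_ops[OF pq] S by simp
  hence "closedin (op_topology p q) (\<Inter>\<J>)"
    by (intro closedin_Inter) (auto simp: \<J>_def dest: closed_op_idealD)
  moreover have "op_ideal p q (\<Inter>\<J>)"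
    unfolding op_ideal_def
  proof (intro conjI ballI)
    show "\<Inter>\<J> \<subseteq> bounded_ops p q" using ne by blast
    show "opr.subspace (\<Inter>\<J>)"
      by (rule opr.subspace_Inter) (auto simp: \<J>_def dest: closed_op_idealD)
    fix A T B :: "'a operator" assume "A \<in> bounded_ops q q" "T \<in> \<Inter>\<J>" "B \<in> bounded_ops p p"
    thus "A \<circ> T \<circ> B \<in> \<Inter>\<J>"
      by (auto simp: \<J>_def intro: closed_op_idealD(4))
  qed
  ultimately show ?thesis by (simp add: closed_op_ideal_def generated_ideal_def \<J>_def)
qed

section \<open>Compact operators\<close>

text \<open>
  Since \<open>\<ell>\<^sub>q\<close> is complete, the closure of the image of the unit ball is compact iff that image is totally
  bounded. The points of the net may lie anywhere in \<open>\<ell>\<^sub>q\<close>, which lets nets be added and mapped.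
\<close>

lemma compact_ops_iff_net:
  fixes T :: "'k::{real_normed_field, euclidean_space} operator"
  assumes pq: "1 \<le> p" "1 \<le> q"
  shows "T \<in> compact_ops p q \<longleftrightarrow> T \<in> bounded_ops p q \<and>
    (\<forall>e>0. \<exists>F. finite F \<and> F \<subseteq> lp q \<and> (\<forall>x\<in>lp p. lp_norm p x \<le> 1 \<longrightarrow> (\<exists>y\<in>F. lp_norm q (T x - y) \<le> e)))"
    (is "_ \<longleftrightarrow> _ \<and> ?net")
proof (cases "T \<in> bounded_ops p q")
  case T: True
  interpret Metric_space "lp q :: 'k sequence set" "\<lambda>x y. lp_norm q (x - y)"
    by (rule Metric_space_lp[OF pq(2)])
  define S where "S = T ` {x \<in> lp p. lp_norm p x \<le> 1}"
  have S: "S \<subseteq> lp q" using bounded_opsD(1)[OF T] by (auto simp: S_def)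
  have "mcomplete"
    unfolding mcomplete_def
  proof (intro allI impI)
    fix x assume "MCauchy x"
    hence x: "x n \<in> lp q" for n by (auto simp: MCauchy_def)
    have c: "\<exists>N. \<forall>m\<ge>N. \<forall>n\<ge>N. lp_norm q (x m - x n) \<le> e" if "0 < e" for e
      using \<open>MCauchy x\<close> that unfolding MCauchy_def by (meson less_imp_le)
    obtain y where y: "y \<in> lp q" "\<And>e. 0 < e \<Longrightarrow> \<exists>N. \<forall>n\<ge>N. lp_norm q (x n - y) \<le> e"
      using lp_complete[OF pq(2) x c] by metis
    have "\<exists>N. \<forall>n\<ge>N. x n \<in> lp q \<and> lp_norm q (x n - y) < e" if e: "0 < e" for e
    proof -
      obtain N where "\<forall>n\<ge>N. lp_norm q (x n - y) \<le> e/2" using y(2)[OF half_gt_zero[OF e]] by blast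
      thus ?thesis using e x by (intro exI[of _ N]) force
    qed
    hence "limitin mtopology x y sequentially"
      using y(1) by (simp add: limitin_metric eventually_sequentially)
    thus "\<exists>y. limitin mtopology x y sequentially" by blast
  qed
  hence "T \<in> compact_ops p q \<longleftrightarrow> mtotally_bounded S"
    using mtotally_bounded_eq_compact_closure_of[of S] S T
    by (simp add: compact_ops_def lp_topology_def S_def)
  also have "\<dots> \<longleftrightarrow> ?net"
  proof (intro iffI allI impI)
    fix e :: real assume "mtotally_bounded S" "0 < e"
    then obtain K where K: "finite K" "K \<subseteq> S" "S \<subseteq> (\<Union>x\<in>K. mball x e)"
      unfolding mtotally_bounded_def by meson
    have "\<exists>y\<in>K. lp_norm q (T x - y) \<le> e" if "x \<in> lp p" "lp_norm p x \<le> 1" for x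
    proof -
      have "T x \<in> S" using that by (auto simp: S_def)
      then obtain y where "y \<in> K" "T x \<in> mball y e" using K(3) by blast
      hence "lp_norm q (T x - y) < e" unfolding in_mball lp_norm_minus_commute[of q y "T x"] by blast
      thus ?thesis using \<open>y \<in> K\<close> by (intro bexI[of _ y]) simp_all
    qed
    thus "\<exists>F. finite F \<and> F \<subseteq> lp q \<and> (\<forall>x\<in>lp p. lp_norm p x \<le> 1 \<longrightarrow> (\<exists>y\<in>F. lp_norm q (T x - y) \<le> e))"
      using K S by blast
  next
    assume net: ?net
    show "mtotally_bounded S"
      unfolding mtotally_bounded_def
    proof (intro allI impI)
      fix e :: real assume "0 < e"
      then obtain F where F: "finite F" "F \<subseteq> lp q"
        "\<And>x. x \<in> lp p \<Longrightarrow> lp_norm p x \<le> 1 \<Longrightarrow> \<exists>y\<in>F. lp_norm q (T x - y) \<le> e/3"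
        using net[rule_format, of "e/3"] by auto
      define near where "near y s \<longleftrightarrow> s \<in> S \<and> lp_norm q (s - y) \<le> e/3" for y s
      define F' where "F' = {y \<in> F. \<exists>s. near y s}"
      define g where "g y = (SOME s. near y s)" for y
      have g: "near y (g y)" if "y \<in> F'" for y
        using that someI_ex[of "near y"] by (auto simp: F'_def g_def)
      have "S \<subseteq> (\<Union>s\<in>g ` F'. mball s e)"
      proof
        fix s assume s: "s \<in> S"
        then obtain x where "x \<in> lp p" "lp_norm p x \<le> 1" "s = T x" by (auto simp: S_def)
        then obtain y where y: "y \<in> F" "lp_norm q (s - y) \<le> e/3" using F(3) by blast
        hence yF: "y \<in> F'" using s by (auto simp: F'_def near_def)
        have gy: "g y \<in> S" "lp_norm q (g y - y) \<le> e/3" using g[OF yF] by (auto simp: near_def)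
        have "lp_norm q (g y - s) \<le> lp_norm q (g y - y) + lp_norm q (y - s)"
          using triangle[of "g y" y s] gy(1) s S y(1) F(2) by blast
        also have "\<dots> \<le> e/3 + e/3" using gy y by (simp add: lp_norm_minus_commute[of q y s])
        finally have "s \<in> mball (g y) e" using \<open>0 < e\<close> gy s S by auto
        thus "s \<in> (\<Union>s\<in>g ` F'. mball s e)" using yF by blast
      qed
      moreover have "g ` F' \<subseteq> S" using g by (auto simp: near_def)
      moreover have "finite (g ` F')" using F(1) by (simp add: F'_def)
      ultimately show "\<exists>K. finite K \<and> K \<subseteq> S \<and> S \<subseteq> (\<Union>x\<in>K. mball x e)" by blast
    qed
  qed
  finally show ?thesis using T by simp
qed (simp add: compact_ops_def)

lemma compact_ops_netE:
  fixes T :: "'k::{real_normed_field, euclidean_space} operator"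
  assumes "1 \<le> p" "1 \<le> q" "T \<in> compact_ops p q" "0 < e"
  obtains F where "finite F" "F \<subseteq> lp q"
    "\<And>x. x \<in> lp p \<Longrightarrow> lp_norm p x \<le> 1 \<Longrightarrow> \<exists>y\<in>F. lp_norm q (T x - y) \<le> e"
proof -
  note net = compact_ops_iff_net[OF assms(1,2), THEN iffD1, OF assms(3), THEN conjunct2]
  obtain F where F: "finite F \<and> F \<subseteq> lp q \<and>
      (\<forall>x\<in>lp p. lp_norm p x \<le> 1 \<longrightarrow> (\<exists>y\<in>F. lp_norm q (T x - y) \<le> e))"
    using net[THEN spec, THEN mp, OF assms(4)] by (rule exE)
  show ?thesis by (rule that[of F]) (use F in simp_all)
qed

lemma compact_opsI:
  fixes T :: "'k::{real_normed_field, euclidean_space} operator"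
  assumes "1 \<le> p" "1 \<le> q" "T \<in> bounded_ops p q"
    "\<And>e. 0 < e \<Longrightarrow> \<exists>F. finite F \<and> F \<subseteq> lp q \<and>
      (\<forall>x\<in>lp p. lp_norm p x \<le> 1 \<longrightarrow> (\<exists>y\<in>F. lp_norm q (T x - y) \<le> e))"
  shows "T \<in> compact_ops p q"
  unfolding compact_ops_iff_net[OF assms(1,2)] using assms(3,4) by (intro conjI allI impI)

lemma lp_normalize:
  fixes x :: "'k::real_normed_field sequence"
  assumes "x \<in> lp p" "0 < p" "0 \<le> c" "lp_norm p x \<le> c"
  shows "seq_scale (of_real (inverse c)) x \<in> lp p" "lp_norm p (seq_scale (of_real (inverse c)) x) \<le> 1"
proof -
  have "inverse c * lp_norm p x \<le> inverse c * c" using assms by (intro mult_left_mono) auto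
  also have "\<dots> \<le> 1" by (cases "c = 0") auto
  finally have "inverse c * lp_norm p x \<le> 1" .
  moreover have "norm (of_real (inverse c) :: 'k) = inverse c" using assms(3) by (simp add: norm_inverse)
  ultimately show "lp_norm p (seq_scale (of_real (inverse c)) x) \<le> 1"
    unfolding lp_scale(2)[OF assms(1,2)] by simp
qed (rule lp_scale(1)[OF assms(1,2)])

lemma closed_op_ideal_compact:
  assumes pq: "1 \<le> p" "1 \<le> q"
  shows "closed_op_ideal p q (compact_ops p q :: 'k::{real_normed_field, euclidean_space} operator set)"
proof (rule closed_op_idealI[OF pq])
  have pq0: "0 < p" "0 < q" using pq by auto
  show sub: "compact_ops p q \<subseteq> (bounded_ops p q :: 'k operator set)" by (auto simp: compact_ops_def)
  show "(0 :: 'k operator) \<in> compact_ops p q"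
    by (intro compact_opsI[OF pq bounded_ops_zero_op] exI[of _ "{0}"]) auto
  fix S T :: "'k operator" assume S: "S \<in> compact_ops p q" and T: "T \<in> compact_ops p q"
  show "S + T \<in> compact_ops p q"
  proof (rule compact_opsI[OF pq])
    show "S + T \<in> bounded_ops p q" using S T sub pq by (intro bounded_ops_add) auto
    fix e :: real assume e: "0 < e"
    obtain F where F: "finite F" "F \<subseteq> lp q"
      "\<And>x. x \<in> lp p \<Longrightarrow> lp_norm p x \<le> 1 \<Longrightarrow> \<exists>y\<in>F. lp_norm q (S x - y) \<le> e/2"
      by (rule compact_ops_netE[OF pq S, of "e/2"]) (use e in auto)
    obtain G where G: "finite G" "G \<subseteq> lp q"
      "\<And>x. x \<in> lp p \<Longrightarrow> lp_norm p x \<le> 1 \<Longrightarrow> \<exists>y\<in>G. lp_norm q (T x - y) \<le> e/2"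
      by (rule compact_ops_netE[OF pq T, of "e/2"]) (use e in auto)
    define H where "H = (\<lambda>(y, z). y + z) ` (F \<times> G)"
    have "finite H" "H \<subseteq> lp q" using F G pq unfolding H_def by (auto simp: subset_iff intro!: lp_add(1))
    moreover have "\<exists>y\<in>H. lp_norm q ((S + T) x - y) \<le> e" if x: "x \<in> lp p" "lp_norm p x \<le> 1" for x
    proof -
      obtain y z where yz: "y \<in> F" "lp_norm q (S x - y) \<le> e/2" "z \<in> G" "lp_norm q (T x - z) \<le> e/2"
        using F(3) G(3) x by meson
      have "S x - y \<in> lp q" "T x - z \<in> lp q"
        using yz F(2) G(2) S T sub bounded_ops_in_lp pq by (meson lp_diff(1) subsetD)+
      hence "lp_norm q ((S x - y) + (T x - z)) \<le> e" using lp_add(2) yz pq by fastforce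
      moreover have "(S x - y) + (T x - z) = (S + T) x - (y + z)" by (auto simp: fun_eq_iff)
      moreover have "y + z \<in> H" using yz by (auto simp: H_def)
      ultimately show ?thesis by metis
    qed
    ultimately show "\<exists>F. finite F \<and> F \<subseteq> lp q \<and>
      (\<forall>x\<in>lp p. lp_norm p x \<le> 1 \<longrightarrow> (\<exists>y\<in>F. lp_norm q ((S + T) x - y) \<le> e))" by blast
  qed
next
  fix A T B :: "'k operator"
  assume A: "A \<in> bounded_ops q q" and T: "T \<in> compact_ops p q" and B: "B \<in> bounded_ops p p"
  have pq0: "0 < p" "0 < q" using pq by auto
  have Tb: "T \<in> bounded_ops p q" using T by (simp add: compact_ops_def)
  show "A \<circ> T \<circ> B \<in> compact_ops p q"
  proof (rule compact_opsI[OF pq])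
    show "A \<circ> T \<circ> B \<in> bounded_ops p q"
      using A B Tb pq0 by (intro bounded_ops_comp[of B p p _ q] bounded_ops_comp[of T p q A q]) auto
    fix e :: real assume e: "0 < e"
    obtain a where a: "0 < a" "\<And>y. y \<in> lp q \<Longrightarrow> lp_norm q (A y) \<le> a * lp_norm q y"
      using bounded_ops_boundE[OF A] by blast
    obtain b where b: "0 < b" "\<And>x. x \<in> lp p \<Longrightarrow> lp_norm p (B x) \<le> b * lp_norm p x"
      using bounded_ops_boundE[OF B] by blast
    note ab = a(1) b(1) and Aa = a(2)
    have Bb: "lp_norm p (B x) \<le> b" if "x \<in> lp p" "lp_norm p x \<le> 1" for x
    proof -
      have "b * lp_norm p x \<le> b * 1" using that(2) b(1) by (intro mult_left_mono) auto
      thus ?thesis using b(2)[OF that(1)] by linarith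
    qed
    obtain F where F: "finite F" "F \<subseteq> lp q"
      "\<And>x. x \<in> lp p \<Longrightarrow> lp_norm p x \<le> 1 \<Longrightarrow> \<exists>y\<in>F. lp_norm q (T x - y) \<le> e / (a * b)"
      by (rule compact_ops_netE[OF pq T, of "e / (a * b)"]) (use e ab in auto)
    define h where "h y = A (seq_scale (of_real b) y)" for y
    have "\<exists>y\<in>h ` F. lp_norm q ((A \<circ> T \<circ> B) x - y) \<le> e" if x: "x \<in> lp p" "lp_norm p x \<le> 1" for x
    proof -
      define u where "u = seq_scale (of_real (inverse b)) (B x)"
      have u: "u \<in> lp p" "lp_norm p u \<le> 1"
        using lp_normalize[OF bounded_opsD(1)[OF B x(1)] pq0(1) _ Bb[OF x]] ab unfolding u_def by auto
      then obtain y where y: "y \<in> F" "lp_norm q (T u - y) \<le> e / (a * b)" using F(3) by blast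
      have Bx: "B x = seq_scale (of_real b) u" using ab by (simp add: u_def)
      have Tu: "T u \<in> lp q" "y \<in> lp q" using bounded_ops_in_lp[OF Tb] y F(2) by auto
      have d: "T u - y \<in> lp q" using Tu pq by (intro lp_diff)
      have "(A \<circ> T \<circ> B) x - h y = A (seq_scale (of_real b) (T u)) - A (seq_scale (of_real b) y)"
        using bounded_opsD(4)[OF Tb u(1)] by (simp add: h_def Bx)
      also have "\<dots> = A (seq_scale (of_real b) (T u - y))"
        using bounded_ops_diff[OF A lp_scale(1)[OF Tu(1) pq0(2)] lp_scale(1)[OF Tu(2) pq0(2)] pq(2)]
        by (simp add: seq.scale_right_diff_distrib)
      finally have "lp_norm q ((A \<circ> T \<circ> B) x - h y) \<le> a * lp_norm q (seq_scale (of_real b) (T u - y))"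
        using Aa[OF lp_scale(1)[OF d pq0(2)]] by simp
      also have "\<dots> = a * (b * lp_norm q (T u - y))" using lp_scale(2)[OF d pq0(2)] ab by simp
      also have "\<dots> \<le> a * (b * (e / (a * b)))" using y ab by (intro mult_left_mono) auto
      also have "\<dots> = e" using ab by simp
      finally show ?thesis using y(1) by blast
    qed
    moreover have "finite (h ` F)" "h ` F \<subseteq> lp q"
      using F(1) bounded_ops_in_lp[OF A] by (auto simp: h_def)
    ultimately show "\<exists>F. finite F \<and> F \<subseteq> lp q \<and>
      (\<forall>x\<in>lp p. lp_norm p x \<le> 1 \<longrightarrow> (\<exists>y\<in>F. lp_norm q ((A \<circ> T \<circ> B) x - y) \<le> e))" by blast
  qed
next
  fix T :: "'k operator" assume T: "T \<in> bounded_ops p q"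
    and approx: "\<And>e. 0 < e \<Longrightarrow> \<exists>S\<in>compact_ops p q. \<forall>x\<in>lp p. lp_norm q (T x - S x) \<le> e * lp_norm p x"
  show "T \<in> compact_ops p q"
  proof (rule compact_opsI[OF pq T])
    fix e :: real assume e: "0 < e"
    obtain S where S: "S \<in> compact_ops p q" "\<And>x. x \<in> lp p \<Longrightarrow> lp_norm q (T x - S x) \<le> e/2 * lp_norm p x"
      using approx[of "e/2"] e by auto
    obtain F where F: "finite F" "F \<subseteq> lp q"
      "\<And>x. x \<in> lp p \<Longrightarrow> lp_norm p x \<le> 1 \<Longrightarrow> \<exists>y\<in>F. lp_norm q (S x - y) \<le> e/2"
      by (rule compact_ops_netE[OF pq S(1), of "e/2"]) (use e in auto)
    have Sb: "S \<in> bounded_ops p q" using S by (simp add: compact_ops_def)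
    have "\<exists>y\<in>F. lp_norm q (T x - y) \<le> e" if x: "x \<in> lp p" "lp_norm p x \<le> 1" for x
    proof -
      obtain y where y: "y \<in> F" "lp_norm q (S x - y) \<le> e/2" using F(3) x by blast
      have m: "e/2 * lp_norm p x \<le> e/2 * 1" using x e by (intro mult_left_mono) auto
      have "lp_norm q (T x - y) = lp_norm q ((T x - S x) + (S x - y))" by simp
      also have "\<dots> \<le> lp_norm q (T x - S x) + lp_norm q (S x - y)"
        using y(1) F(2) bounded_ops_in_lp[OF T] bounded_ops_in_lp[OF Sb] pq
        by (intro lp_add(2) lp_diff(1)) auto
      also have "\<dots> \<le> e" using S(2)[OF x(1)] m y by linarith
      finally show ?thesis using y(1) by blast
    qed
    thus "\<exists>F. finite F \<and> F \<subseteq> lp q \<and> (\<forall>x\<in>lp p. lp_norm p x \<le> 1 \<longrightarrow> (\<exists>y\<in>F. lp_norm q (T x - y) \<le> e))"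
      using F by blast
  qed
qed

lemma not_compact_if_hits_unit_seqs:
  fixes T :: "'k::{real_normed_field, euclidean_space} operator" and x :: "nat \<Rightarrow> 'k sequence"
  assumes pq: "1 \<le> p" "1 \<le> q"
    and x: "\<And>n. x n \<in> lp p" "\<And>n. lp_norm p (x n) \<le> 1"
    and T: "\<And>n. T (x n) = unit_seq (g n)" and g: "inj g"
  shows "T \<notin> compact_ops p q"
proof
  assume "T \<in> compact_ops p q"
  then obtain F where F: "finite F" "F \<subseteq> lp q"
    "\<And>x. x \<in> lp p \<Longrightarrow> lp_norm p x \<le> 1 \<Longrightarrow> \<exists>y\<in>F. lp_norm q (T x - y) \<le> 1/3"
    by (rule compact_ops_netE[OF pq, of _ "1/3"]) auto
  have "\<forall>n. \<exists>y\<in>F. lp_norm q (unit_seq (g n) - y) \<le> 1/3" using F(3)[OF x] T by simp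
  then obtain y where y: "\<And>n. y n \<in> F" "\<And>n. lp_norm q (unit_seq (g n) - y n) \<le> 1/3" by metis
  have "finite (range y)" using y(1) F(1) by (meson finite_subset image_subsetI)
  hence "\<not> inj y" using finite_imageD infinite_UNIV_nat by blast
  then obtain m n where mn: "m \<noteq> n" "y m = y n" by (auto simp: inj_def)
  let ?u = "unit_seq (g m) :: 'k sequence" and ?v = "unit_seq (g n) :: 'k sequence"
  have lp: "?u \<in> lp q" "?v \<in> lp q" "y m \<in> lp q" using y(1) F(2) pq by (auto simp: unit_seq_lp(1))
  have "1 = norm ((?u - ?v) (g m))" using mn g by (auto simp: unit_seq_apply inj_def)
  also have "\<dots> \<le> lp_norm q (?u - ?v)" using lp pq by (intro lp_coord_le lp_diff) auto
  also have "\<dots> = lp_norm q ((?u - y m) - (?v - y n))" using mn by simp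
  also have "\<dots> \<le> lp_norm q (?u - y m) + lp_norm q (?v - y n)"
    using lp mn pq by (intro lp_diff) auto
  also have "\<dots> \<le> 1/3 + 1/3" using y(2) by (intro add_mono)
  finally show False by simp
qed

section \<open>Norming functionals\<close>

text \<open>
  For the complex numbers \<open>\<bar>a\<bar>\<^sup>p / a\<close> is \<open>\<bar>a\<bar>\<close> to the power \<open>p - 2\<close> times the conjugate of \<open>a\<close>, so this is the
  usual functional that attains its norm at a unit vector \<open>x\<close>. The quotient makes sense without a
  conjugation and is \<open>0\<close> for \<open>a = 0\<close>.
\<close>

definition norming :: "real \<Rightarrow> 'k::{real_normed_field, euclidean_space} sequence \<Rightarrow> 'k sequence \<Rightarrow> 'k" where
  "norming p x y = (\<Sum>i. of_real (norm (x i) powr p) * inverse (x i) * y i)"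

lemma norming_term_le:
  fixes a b :: "'k::real_normed_field"
  assumes "1 < p"
  shows "norm (of_real (norm a powr p) * inverse a * b) \<le> (1 - 1/p) * norm a powr p + (1/p) * norm b powr p"
proof (cases "a = 0 \<or> b = 0")
  case True thus ?thesis using assms by auto
next
  case False
  define s where "s = p / (p - 1)"
  have s: "s > 1" "1 / s + 1 / p = 1" using assms by (auto simp: s_def field_simps)
  have "norm (of_real (norm a powr p) * inverse a * b) = norm a powr (p - 1) * norm b"
    using False by (simp add: norm_mult norm_inverse powr_diff divide_inverse)
  also have "\<dots> \<le> (norm a powr (p - 1)) powr s / s + norm b powr p / p"
    using s assms by (intro Youngs_inequality) auto
  also have "(norm a powr (p - 1)) powr s = norm a powr p"
    using assms by (simp add: powr_powr s_def)
  also have "1 / s = 1 - 1 / p" using s by simp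
  hence "norm a powr p / s = (1 - 1/p) * norm a powr p" by (metis divide_inverse mult.commute mult_1 inverse_eq_divide)
  finally show ?thesis by simp
qed

lemma norming_summable:
  fixes x :: "'k::{real_normed_field, euclidean_space} sequence"
  assumes "1 < p" "x \<in> lp p" "y \<in> lp p"
  shows "summable (\<lambda>i. norm (of_real (norm (x i) powr p) * inverse (x i) * y i))"
    "summable (\<lambda>i. of_real (norm (x i) powr p) * inverse (x i) * y i)"
proof -
  show "summable (\<lambda>i. norm (of_real (norm (x i) powr p) * inverse (x i) * y i))"
  proof (rule summable_comparison_test')
    show "summable (\<lambda>i. (1 - 1/p) * norm (x i) powr p + (1/p) * norm (y i) powr p)"
      using assms by (intro summable_add summable_mult) (auto simp: lp_def)
    show "norm (norm (of_real (norm (x i) powr p) * inverse (x i) * y i)) \<le>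
        (1 - 1/p) * norm (x i) powr p + (1/p) * norm (y i) powr p" for i
      using norming_term_le[OF assms(1), of "x i" "y i"] by simp
  qed
  thus "summable (\<lambda>i. of_real (norm (x i) powr p) * inverse (x i) * y i)"
    by (rule summable_norm_cancel)
qed

lemma norming_add:
  assumes "1 < p" "x \<in> lp p" "y \<in> lp p" "z \<in> lp p"
  shows "norming p x (y + z) = norming p x y + norming p x z"
  unfolding norming_def using norming_summable(2)[OF assms(1,2)] assms(3,4)
  by (simp add: suminf_add distrib_left)

lemma norming_scale:
  assumes "1 < p" "x \<in> lp p" "y \<in> lp p"
  shows "norming p x (seq_scale c y) = c * norming p x y"
proof -
  have "norming p x (seq_scale c y) = (\<Sum>i. c * (of_real (norm (x i) powr p) * inverse (x i) * y i))"
    by (simp add: norming_def seq_scale_def mult_ac)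
  thus ?thesis using suminf_mult[OF norming_summable(2)[OF assms]] by (simp add: norming_def)
qed

lemma norming_self:
  assumes "1 < p" "x \<in> lp p" "lp_norm p x = 1"
  shows "norming p x x = 1"
proof -
  have s: "summable (\<lambda>i. norm (x i) powr p)" using assms by (simp add: lp_def)
  have "of_real (norm (x i) powr p) * inverse (x i) * x i = of_real (norm (x i) powr p)" for i
    by (cases "x i = 0") auto
  hence "norming p x x = of_real (\<Sum>i. norm (x i) powr p)"
    unfolding norming_def by (simp only: suminf_of_real[OF s])
  also have "(\<Sum>i. norm (x i) powr p) = 1"
    using lp_norm_powr[OF assms(2)] assms by simp
  finally show ?thesis by simp
qed

lemma norming_le:
  fixes x :: "'k::{real_normed_field, euclidean_space} sequence"
  assumes p: "1 < p" and x: "x \<in> lp p" "lp_norm p x = 1" and y: "y \<in> lp p"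
  shows "norm (norming p x y) \<le> lp_norm p y"
proof -
  have unit: "norm (norming p x z) \<le> 1" if z: "z \<in> lp p" "lp_norm p z = 1" for z
  proof -
    have sx: "(\<Sum>i. norm (x i) powr p) = 1" "(\<Sum>i. norm (z i) powr p) = 1"
      using lp_norm_powr[OF x(1)] lp_norm_powr[OF z(1)] x z p by auto
    have s: "summable (\<lambda>i. norm (x i) powr p)" "summable (\<lambda>i. norm (z i) powr p)"
      using x z by (auto simp: lp_def)
    have "norm (norming p x z) \<le> (\<Sum>i. norm (of_real (norm (x i) powr p) * inverse (x i) * z i))"
      unfolding norming_def by (rule summable_norm[OF norming_summable(1)[OF p x(1) z(1)]])
    also have "\<dots> \<le> (\<Sum>i. (1 - 1/p) * norm (x i) powr p + (1/p) * norm (z i) powr p)"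
      using s by (intro suminf_le norming_term_le[OF p] norming_summable(1)[OF p x(1) z(1)] summable_add summable_mult)
    also have "\<dots> = (\<Sum>i. (1 - 1/p) * norm (x i) powr p) + (\<Sum>i. (1/p) * norm (z i) powr p)"
      by (rule suminf_add[symmetric]) (intro summable_mult s)+
    also have "\<dots> = (1 - 1/p) * 1 + (1/p) * 1"
      unfolding suminf_mult[OF s(1)] suminf_mult[OF s(2)] sx ..
    finally show ?thesis by simp
  qed
  show ?thesis
  proof (cases "y = 0")
    case True
    thus ?thesis by (simp add: norming_def)
  next
    case False
    define n where "n = lp_norm p y"
    have n: "n > 0" using lp_norm_eq_0[OF y] False p lp_norm_nonneg[of p y] unfolding n_def by linarith
    define z where "z = seq_scale (of_real (inverse n)) y"
    have z: "z \<in> lp p" "lp_norm p z = 1"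
      using lp_scale[OF y, of "of_real (inverse n)"] p n by (auto simp: z_def n_def norm_inverse)
    have "y = seq_scale (of_real n) z" using n by (simp add: z_def)
    hence "norming p x y = of_real n * norming p x z" using norming_scale[OF p x(1) z(1)] by simp
    thus ?thesis using unit[OF z] n by (simp add: norm_mult n_def[symmetric] mult_left_le)
  qed
qed

section \<open>Finitely strictly singular operators\<close>

text \<open>
  The dimension is bounded from below by exhibiting independent vectors: this is monotone in the space and
  also covers infinite-dimensional ones, for which the function \<open>seq.dim\<close> returns \<open>0\<close>.
\<close>

definition dim_ge :: "nat \<Rightarrow> 'k::real_normed_field sequence set \<Rightarrow> bool" where
  "dim_ge n E \<longleftrightarrow> seq.subspace E \<and> (\<exists>B\<subseteq>E. finite B \<and> seq.independent B \<and> card B = n)"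

lemma dim_ge_subspace: "dim_ge n E \<Longrightarrow> seq.subspace E" by (simp add: dim_ge_def)

lemma dim_ge_mono:
  assumes "dim_ge n E" "m \<le> n" shows "dim_ge m E"
proof -
  obtain B where B: "B \<subseteq> E" "finite B" "seq.independent B" "card B = n"
    using assms by (auto simp: dim_ge_def)
  obtain C where "C \<subseteq> B" "card C = m" using obtain_subset_with_card_n[of m B] B assms by metis
  thus ?thesis using B dim_ge_subspace[OF assms(1)] seq.independent_mono[of B C] finite_subset[of C B]
    unfolding dim_ge_def by blast
qed

lemma dim_geI_dim:
  assumes "seq.subspace E" "seq.dim E = n" "0 < n" shows "dim_ge n E"
proof -
  obtain B where "B \<subseteq> E" "seq.independent B" "card B = n"
    using seq.basis_exists[of E] assms(2) by metis
  thus ?thesis using assms card_gt_0_iff unfolding dim_ge_def by blast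
qed

lemma dim_ge_subspace_dim:
  assumes "dim_ge n E" obtains F where "F \<subseteq> E" "seq.subspace F" "seq.dim F = n"
proof -
  obtain B where B: "B \<subseteq> E" "seq.independent B" "card B = n"
    using assms by (auto simp: dim_ge_def)
  show ?thesis
  proof (rule that[of "seq.span B"])
    show "seq.span B \<subseteq> E" using seq.span_minimal[OF B(1) dim_ge_subspace[OF assms]] .
    show "seq.dim (seq.span B) = n" using seq.dim_eq_card_independent[OF B(2)] B(3) by simp
  qed (rule seq.subspace_span)
qed

text \<open>
  If the kernel had fewer than \<open>n\<close> independent vectors, then these and one vector outside the kernel would
  span all of \<open>E\<close>.
\<close>

lemma dim_ge_kernel:
  fixes f :: "'k::real_normed_field sequence \<Rightarrow> 'k"
  assumes E: "dim_ge (Suc n) E"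
    and add: "\<And>x y. x \<in> E \<Longrightarrow> y \<in> E \<Longrightarrow> f (x + y) = f x + f y"
    and scale: "\<And>c x. x \<in> E \<Longrightarrow> f (seq_scale c x) = c * f x"
  shows "dim_ge n {x \<in> E. f x = 0}"
proof -
  define F where "F = {x \<in> E. f x = 0}"
  have subE: "seq.subspace E" using E by (rule dim_ge_subspace)
  have f0: "f 0 = 0" using scale[of 0 0] seq.subspace_0[OF subE] by simp
  have subF: "seq.subspace F"
    unfolding seq.subspace_def F_def using subE f0 add scale
    by (auto simp: seq.subspace_add seq.subspace_scale seq.subspace_0)
  obtain B where B: "B \<subseteq> E" "finite B" "seq.independent B" "card B = Suc n"
    using E by (auto simp: dim_ge_def)
  obtain C where C: "C \<subseteq> F" "seq.independent C" "F \<subseteq> seq.span C"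
    using seq.maximal_independent_subset[of F] by metis
  have "infinite C \<or> n \<le> card C"
  proof (rule disjCI)
    assume "\<not> n \<le> card C"
    hence small: "card C < n" by simp
    show "infinite C"
    proof
      assume fin: "finite C"
      obtain v where v: "E \<subseteq> seq.span (insert v F)"
      proof (cases "E \<subseteq> F")
        case True
        thus ?thesis using that[of 0] seq.span_superset by blast
      next
        case False
        then obtain v where v: "v \<in> E" "f v \<noteq> 0" by (auto simp: F_def)
        have "x \<in> seq.span (insert v F)" if x: "x \<in> E" for x
        proof -
          have m: "seq_scale (- (f x / f v)) v \<in> E" using seq.subspace_scale[OF subE v(1)] .
          have "f (x + seq_scale (- (f x / f v)) v) = f x + - (f x / f v) * f v"
            unfolding add[OF x m] scale[OF v(1)] ..
          hence "x + seq_scale (- (f x / f v)) v \<in> F"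
            using v(2) seq.subspace_add[OF subE x m] by (simp add: F_def)
          hence "x - seq_scale (f x / f v) v \<in> seq.span F"
            using seq.span_base by simp
          thus ?thesis using seq.span_breakdown_eq by blast
        qed
        thus ?thesis using that by blast
      qed
      have "seq.span (insert v F) \<subseteq> seq.span (insert v C)"
      proof (rule seq.span_minimal[OF _ seq.subspace_span])
        have "seq.span C \<subseteq> seq.span (insert v C)" by (rule seq.span_mono) blast
        thus "insert v F \<subseteq> seq.span (insert v C)" using C(3) seq.span_base[of v "insert v C"] by blast
      qed
      hence "B \<subseteq> seq.span (insert v C)" using B(1) v by blast
      hence "card B \<le> card (insert v C)"
        using seq.independent_span_bound[of "insert v C" B] B(3) fin by simp
      also have "\<dots> \<le> Suc (card C)" by (rule card_insert_le_m1) auto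
      finally show False using small B(4) by simp
    qed
  qed
  then obtain D where D: "D \<subseteq> C" "finite D" "card D = n"
  proof
    assume "infinite C"
    thus ?thesis using infinite_arbitrarily_large[of C n] that by blast
  next
    assume "n \<le> card C"
    thus ?thesis using obtain_subset_with_card_n[of n C] that by metis
  qed
  hence "seq.independent D" using C(2) seq.independent_mono by blast
  thus ?thesis using subF D C(1) unfolding dim_ge_def F_def by blast
qed

lemma dim_ge_insert:
  assumes F: "dim_ge n F" and x: "x \<notin> F"
  shows "dim_ge (Suc n) (seq.span (insert x F))"
proof -
  obtain B where B: "B \<subseteq> F" "finite B" "seq.independent B" "card B = n"
    using F by (auto simp: dim_ge_def)
  have "seq.span B \<subseteq> F" using seq.span_minimal[OF B(1) dim_ge_subspace[OF F]] .
  hence nx: "x \<notin> seq.span B" using x by blast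
  hence "seq.independent (insert x B)" using B(3) seq.independent_insertI by blast
  moreover have "x \<notin> B" using nx seq.span_base by blast
  hence "card (insert x B) = Suc n" using B by simp
  moreover have "insert x B \<subseteq> seq.span (insert x F)" using B(1) seq.span_superset[of "insert x F"] by blast
  ultimately show ?thesis using B(2) unfolding dim_ge_def by blast
qed

lemma unit_vector_in_subspace:
  fixes E :: "'k::real_normed_field sequence set"
  assumes "seq.subspace E" "E \<subseteq> lp p" "0 < p" "x \<in> E" "x \<noteq> 0"
  obtains c where "seq_scale c x \<in> E" "lp_norm p (seq_scale c x) = 1"
proof -
  have "lp_norm p x \<noteq> 0" using assms lp_norm_eq_0 by blast
  moreover have "lp_norm p (seq_scale (of_real (inverse (lp_norm p x))) x) = inverse (lp_norm p x) * lp_norm p x"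
    using lp_scale(2)[of x p] assms by (auto simp: norm_inverse)
  ultimately show ?thesis using that[of "of_real (inverse (lp_norm p x))"] seq.subspace_scale[OF assms(1,4)] by simp
qed

lemma dim_ge_nonzero:
  assumes "dim_ge n E" "0 < n" obtains x where "x \<in> E" "x \<noteq> 0"
proof -
  obtain B where B: "B \<subseteq> E" "finite B" "seq.independent B" "card B = n"
    using assms by (auto simp: dim_ge_def)
  then obtain b where b: "b \<in> B" using assms(2) by (metis card.empty equals0I less_irrefl)
  moreover have "0 \<notin> B" using seq.dependent_zero B(3) by blast
  ultimately show ?thesis using that[of b] B(1) by blast
qed

lemma fss_ops_iff:
  fixes S :: "'k::real_normed_field operator"
  assumes "0 < p"
  shows "S \<in> fss_ops p q \<longleftrightarrow> S \<in> bounded_ops p q \<and>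
    (\<forall>e>0. \<exists>n>0. \<forall>E. dim_ge n E \<and> E \<subseteq> lp p \<longrightarrow> (\<exists>x\<in>E. lp_norm p x = 1 \<and> lp_norm q (S x) < e))"
proof -
  have *: "(INF x\<in>{x \<in> E. lp_norm p x = 1}. lp_norm q (S x)) < e \<longleftrightarrow>
      (\<exists>x\<in>E. lp_norm p x = 1 \<and> lp_norm q (S x) < e)" if E: "dim_ge n E" "E \<subseteq> lp p" "0 < n" for n e and E :: "'k sequence set"
  proof -
    obtain x where x: "x \<in> E" "x \<noteq> 0" using dim_ge_nonzero[OF E(1,3)] .
    obtain c where "seq_scale c x \<in> E" "lp_norm p (seq_scale c x) = 1"
      using unit_vector_in_subspace[OF dim_ge_subspace[OF E(1)] E(2) assms x] .
    hence ne: "{x \<in> E. lp_norm p x = 1} \<noteq> {}" by blast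
    have "bdd_below ((\<lambda>x. lp_norm q (S x)) ` {x \<in> E. lp_norm p x = 1})"
      by (rule bdd_belowI2[where m = 0]) simp
    from cINF_less_iff[OF ne this] show ?thesis by blast
  qed
  have "(\<forall>E. seq.subspace E \<and> E \<subseteq> lp p \<and> seq.dim E = n \<longrightarrow>
         (INF x\<in>{x \<in> E. lp_norm p x = 1}. lp_norm q (S x)) < e) \<longleftrightarrow>
      (\<forall>E. dim_ge n E \<and> E \<subseteq> lp p \<longrightarrow> (\<exists>x\<in>E. lp_norm p x = 1 \<and> lp_norm q (S x) < e))" (is "?L \<longleftrightarrow> ?R")
    if n: "0 < n" for n e
  proof (intro iffI allI impI)
    fix E :: "'k sequence set" assume L: ?L and E: "dim_ge n E \<and> E \<subseteq> lp p"
    obtain F where F: "F \<subseteq> E" "seq.subspace F" "seq.dim F = n"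
      using dim_ge_subspace_dim E by blast
    have "dim_ge n F" using dim_geI_dim F n by blast
    hence "\<exists>x\<in>F. lp_norm p x = 1 \<and> lp_norm q (S x) < e"
      using *[of n F e] L F E n by blast
    thus "\<exists>x\<in>E. lp_norm p x = 1 \<and> lp_norm q (S x) < e" using F(1) by blast
  next
    fix E :: "'k sequence set" assume R: ?R and E: "seq.subspace E \<and> E \<subseteq> lp p \<and> seq.dim E = n"
    have "dim_ge n E" using dim_geI_dim E n by blast
    thus "(INF x\<in>{x \<in> E. lp_norm p x = 1}. lp_norm q (S x)) < e" using * R E n by blast
  qed
  thus ?thesis unfolding fss_ops_def by (simp cong: conj_cong)
qed

lemma fss_opsE:
  assumes "0 < p" "S \<in> fss_ops p q" "0 < e"
  obtains n where "0 < n"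
    "\<And>E. dim_ge n E \<Longrightarrow> E \<subseteq> lp p \<Longrightarrow> \<exists>x\<in>E. lp_norm p x = 1 \<and> lp_norm q (S x) < e"
proof -
  note * = fss_ops_iff[OF assms(1), THEN iffD1, OF assms(2), THEN conjunct2, THEN spec, THEN mp, OF assms(3)]
  obtain n where "n > 0 \<and> (\<forall>E. dim_ge n E \<and> E \<subseteq> lp p \<longrightarrow> (\<exists>x\<in>E. lp_norm p x = 1 \<and> lp_norm q (S x) < e))"
    using * by (rule exE)
  thus ?thesis by (intro that[of n]) simp_all
qed

lemma fss_opsI:
  assumes "0 < p" "S \<in> bounded_ops p q"
    "\<And>e. 0 < e \<Longrightarrow> \<exists>n>0. \<forall>E. dim_ge n E \<and> E \<subseteq> lp p \<longrightarrow> (\<exists>x\<in>E. lp_norm p x = 1 \<and> lp_norm q (S x) < e)"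
  shows "S \<in> fss_ops p q"
  unfolding fss_ops_iff[OF assms(1)] using assms(2,3) by (intro conjI allI impI)

text \<open>
  This is what makes the class closed under addition: a single small vector in every large subspace
  already yields a whole subspace on which the operator is small. A small unit vector \<open>x\<close> is
  split off and the construction continues in the kernel of a functional norming \<open>x\<close>, so that the
  decomposition of a vector into its two parts is controlled.
\<close>

lemma fss_small_subspace:
  fixes S :: "'k::{real_normed_field, euclidean_space} operator"
  assumes p: "1 < p" and q: "1 \<le> q" and S: "S \<in> fss_ops p q" and "0 < e"
  shows "\<exists>N. \<forall>E. dim_ge N E \<and> E \<subseteq> lp p \<longrightarrow>
    (\<exists>F\<subseteq>E. dim_ge m F \<and> (\<forall>y\<in>F. lp_norm q (S y) \<le> e * lp_norm p y))"
  using \<open>0 < e\<close>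
proof (induction m arbitrary: e)
  case 0
  have "dim_ge 0 {0 :: 'k sequence}"
    unfolding dim_ge_def by (auto simp: seq.subspace_def intro!: exI[of _ "{}"] seq.independent_empty)
  moreover have "S 0 = 0" using S bounded_ops_zero unfolding fss_ops_def by blast
  ultimately have small: "dim_ge 0 {0 :: 'k sequence} \<and> (\<forall>y\<in>{0}. lp_norm q (S y) \<le> e * lp_norm p y)"
    by (metis mult_zero_right order_refl singletonD zero_lp(2))
  have "{0} \<subseteq> E" if "dim_ge 0 E" for E :: "'k sequence set"
    using seq.subspace_0[OF dim_ge_subspace[OF that]] by blast
  thus ?case using small by blast
next
  case (Suc m)
  have Sb: "S \<in> bounded_ops p q" using S by (simp add: fss_ops_def)
  have p0: "0 < p" "1 \<le> p" using p by auto
  have e4: "0 < e / 4" using Suc.prems by simp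
  obtain N where N: "\<And>E. dim_ge N E \<Longrightarrow> E \<subseteq> lp p \<Longrightarrow>
      \<exists>F\<subseteq>E. dim_ge m F \<and> (\<forall>y\<in>F. lp_norm q (S y) \<le> e/4 * lp_norm p y)"
    using Suc.IH[OF e4] by blast
  obtain n where n: "0 < n" "\<And>E. dim_ge n E \<Longrightarrow> E \<subseteq> lp p \<Longrightarrow> \<exists>x\<in>E. lp_norm p x = 1 \<and> lp_norm q (S x) < e/4"
    using fss_opsE[OF p0(1) S e4] by blast
  have "\<exists>F\<subseteq>E. dim_ge (Suc m) F \<and> (\<forall>y\<in>F. lp_norm q (S y) \<le> e * lp_norm p y)"
    if E: "dim_ge (max n (Suc N)) E" "E \<subseteq> lp p" for E
  proof -
    have En: "dim_ge n E" "dim_ge (Suc N) E" using dim_ge_mono[OF E(1)] by auto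
    have subE: "seq.subspace E" using En dim_ge_subspace by blast
    obtain x where x: "x \<in> E" "lp_norm p x = 1" "lp_norm q (S x) < e/4" using n(2)[OF En(1) E(2)] by blast
    have xp: "x \<in> lp p" using x E(2) by blast
    define K where "K = {y \<in> E. norming p x y = 0}"
    have "dim_ge N K" unfolding K_def
      using En(2) norming_add[OF p xp] norming_scale[OF p xp] E(2) by (intro dim_ge_kernel) (auto simp: subset_iff)
    moreover have KE: "K \<subseteq> E" by (auto simp: K_def)
    ultimately obtain F where F: "F \<subseteq> K" "dim_ge m F" "\<And>y. y \<in> F \<Longrightarrow> lp_norm q (S y) \<le> e/4 * lp_norm p y"
      using N[of K] E(2) by blast
    have subF: "seq.subspace F" using F(2) dim_ge_subspace by blast
    have xF: "x \<notin> F" using F(1) norming_self[OF p xp x(2)] by (auto simp: K_def)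
    let ?G = "seq.span (insert x F)"
    have "?G \<subseteq> E" using x(1) F(1) KE subE by (intro seq.span_minimal) auto
    moreover have "lp_norm q (S z) \<le> e * lp_norm p z" if z: "z \<in> ?G" for z
    proof -
      have zp: "z \<in> lp p" using z \<open>?G \<subseteq> E\<close> E(2) by blast
      obtain c where "z - seq_scale c x \<in> seq.span F" using z seq.span_breakdown_eq by blast
      hence y: "z - seq_scale c x \<in> F" using seq.span_minimal[OF order_refl subF] by blast
      define y where "y = z - seq_scale c x"
      have yF: "y \<in> F" using y by (simp add: y_def)
      have yp: "y \<in> lp p" using yF F(1) KE E(2) by blast
      have cx: "seq_scale c x \<in> lp p" using lp_scale(1)[OF xp p0(1)] .
      have zy: "z = seq_scale c x + y" by (simp add: y_def)
      have "norming p x z = c"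
        using norming_add[OF p xp cx yp] norming_scale[OF p xp xp] norming_self[OF p xp x(2)] yF F(1)
        by (auto simp: zy K_def)
      hence c: "norm c \<le> lp_norm p z" using norming_le[OF p xp x(2) zp] by simp
      have "lp_norm p y \<le> lp_norm p z + lp_norm p (seq_scale c x)"
        unfolding y_def by (rule lp_diff(2)[OF zp cx p0(2)])
      also have "\<dots> \<le> 2 * lp_norm p z" using lp_scale(2)[OF xp p0(1), of c] x(2) c by simp
      finally have yn: "lp_norm p y \<le> 2 * lp_norm p z" .
      have "lp_norm q (S z) = lp_norm q (seq_scale c (S x) + S y)"
        unfolding zy using bounded_opsD(3)[OF Sb cx yp] bounded_opsD(4)[OF Sb xp] by simp
      also have "\<dots> \<le> lp_norm q (seq_scale c (S x)) + lp_norm q (S y)"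
        using bounded_ops_in_lp[OF Sb] q by (intro lp_add(2) lp_scale(1)) auto
      also have "lp_norm q (seq_scale c (S x)) = norm c * lp_norm q (S x)"
        using bounded_ops_in_lp[OF Sb] q by (intro lp_scale(2)) auto
      also have "norm c * lp_norm q (S x) \<le> lp_norm p z * (e/4)" using c x(3) by (intro mult_mono) auto
      also have "lp_norm q (S y) \<le> e/4 * lp_norm p y" by (rule F(3)[OF yF])
      also have "\<dots> \<le> e/4 * (2 * lp_norm p z)" using yn e4 by (intro mult_left_mono) auto
      also have "lp_norm p z * (e/4) + e/4 * (2 * lp_norm p z) \<le> e * lp_norm p z"
        using Suc.prems by (simp add: field_simps)
      finally show ?thesis by simp
    qed
    ultimately show ?thesis using dim_ge_insert[OF F(2) xF] by blast
  qed
  thus ?case by blast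
qed

lemma dim_ge_image:
  fixes B :: "'k::real_normed_field operator"
  assumes B: "B \<in> bounded_ops p r" and p: "1 \<le> p" and E: "dim_ge n E" "E \<subseteq> lp p"
    and inj: "\<And>x. x \<in> E \<Longrightarrow> B x = 0 \<Longrightarrow> x = 0"
  shows "dim_ge n (B ` E)"
proof -
  have subE: "seq.subspace E" using E dim_ge_subspace by blast
  obtain C where C: "C \<subseteq> E" "finite C" "seq.independent C" "card C = n"
    using E by (auto simp: dim_ge_def)
  have injE: "inj_on B E"
  proof (rule inj_onI)
    fix x y assume xy: "x \<in> E" "y \<in> E" "B x = B y"
    hence "B (x - y) = 0" using bounded_ops_diff[OF B _ _ p] E(2) by (simp add: subset_iff)
    thus "x = y" using inj[OF seq.subspace_diff[OF subE xy(1,2)]] by simp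
  qed
  hence injC: "inj_on B C" using C(1) inj_on_subset by blast
  have "seq.independent (B ` C)"
  proof
    assume "seq.dependent (B ` C)"
    then obtain u where u: "(\<Sum>v\<in>B ` C. seq_scale (u v) v) = 0" "\<exists>v\<in>B ` C. u v \<noteq> 0"
      using seq.dependent_finite[of "B ` C"] C(2) by auto
    have mem: "(\<Sum>v\<in>C. seq_scale (u (B v)) v) \<in> E"
      using C(1) subE by (intro seq.subspace_sum seq.subspace_scale) auto
    have "B (\<Sum>v\<in>C. seq_scale (u (B v)) v) = (\<Sum>v\<in>C. seq_scale (u (B v)) (B v))"
      using C(1) E(2) by (intro bounded_ops_sum[OF B _ p]) auto
    also have "\<dots> = 0" using u(1) by (simp add: sum.reindex[OF injC])
    finally have "(\<Sum>v\<in>C. seq_scale (u (B v)) v) = 0" by (rule inj[OF mem])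
    moreover have "\<exists>v\<in>C. u (B v) \<noteq> 0" using u(2) by blast
    ultimately have "seq.dependent C"
      using seq.dependent_finite[OF C(2)] by (intro iffD2[OF seq.dependent_finite[OF C(2)]] exI[of _ "\<lambda>v. u (B v)"]) auto
    thus False using C(3) by blast
  qed
  moreover have "seq.subspace (B ` E)"
    unfolding seq.subspace_def
  proof (intro conjI ballI allI)
    show "0 \<in> B ` E" using bounded_ops_zero[OF B] seq.subspace_0[OF subE] by (metis imageI)
  next
    fix x y assume "x \<in> B ` E" "y \<in> B ` E"
    then obtain u v where "u \<in> E" "v \<in> E" "x = B u" "y = B v" by blast
    thus "x + y \<in> B ` E"
      using bounded_opsD(3)[OF B, of u v] E(2) seq.subspace_add[OF subE, of u v] by (metis imageI subsetD)
  next
    fix c x assume "x \<in> B ` E"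
    then obtain u where "u \<in> E" "x = B u" by blast
    thus "seq_scale c x \<in> B ` E"
      using bounded_opsD(4)[OF B, of u c] E(2) seq.subspace_scale[OF subE, of u c] by (metis imageI subsetD)
  qed
  ultimately show ?thesis using C(1,2,4) card_image[OF injC] unfolding dim_ge_def
    by (intro conjI exI[of _ "B ` C"]) auto
qed

text \<open>
  If \<open>B\<close> kills a vector of \<open>E\<close>, that vector is a witness; otherwise \<open>B\<close> maps \<open>E\<close> to a subspace of the same
  dimension, and a vector that \<open>S\<close> makes small there can be pulled back.
\<close>

lemma fss_ops_comp:
  fixes S :: "'k::real_normed_field operator"
  assumes ge: "1 \<le> p" "1 \<le> r" "1 \<le> q" "1 \<le> s"
    and B: "B \<in> bounded_ops p r" and S: "S \<in> fss_ops r q" and A: "A \<in> bounded_ops q s"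
  shows "A \<circ> S \<circ> B \<in> fss_ops p s"
proof (rule fss_opsI)
  have ge0: "0 < p" "0 < r" "0 < q" "0 < s" using ge by auto
  show "0 < p" by fact
  have Sb: "S \<in> bounded_ops r q" using S by (simp add: fss_ops_def)
  show "A \<circ> S \<circ> B \<in> bounded_ops p s"
    using A B Sb ge0 by (intro bounded_ops_comp[of B p r _ s] bounded_ops_comp[of S r q A s]) auto
  fix e :: real assume e: "0 < e"
  obtain a where a: "0 < a" "\<And>y. y \<in> lp q \<Longrightarrow> lp_norm s (A y) \<le> a * lp_norm q y"
    using bounded_ops_boundE[OF A] by blast
  obtain b where b: "0 < b" "\<And>x. x \<in> lp p \<Longrightarrow> lp_norm r (B x) \<le> b * lp_norm p x"
    using bounded_ops_boundE[OF B] by blast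
  note ab = a(1) b(1) and Aa = a(2) and Bb = b(2)
  have "0 < e / (a * b)" using e ab by simp
  from fss_opsE[OF ge0(2) S this] obtain n where n: "0 < n"
    "\<And>E. dim_ge n E \<Longrightarrow> E \<subseteq> lp r \<Longrightarrow> \<exists>x\<in>E. lp_norm r x = 1 \<and> lp_norm q (S x) < e / (a * b)" by metis
  have "\<exists>x\<in>E. lp_norm p x = 1 \<and> lp_norm s ((A \<circ> S \<circ> B) x) < e" if E: "dim_ge n E" "E \<subseteq> lp p" for E
  proof (cases "\<exists>x\<in>E. B x = 0 \<and> x \<noteq> 0")
    case True
    then obtain x where x: "x \<in> E" "B x = 0" "x \<noteq> 0" by blast
    obtain c where c: "seq_scale c x \<in> E" "lp_norm p (seq_scale c x) = 1"
      using unit_vector_in_subspace[OF dim_ge_subspace[OF E(1)] E(2) ge0(1) x(1,3)] .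
    have "B (seq_scale c x) = 0" using bounded_opsD(4)[OF B, of x c] x E(2) by auto
    hence "(A \<circ> S \<circ> B) (seq_scale c x) = 0" using bounded_ops_zero[OF Sb] bounded_ops_zero[OF A] by simp
    thus ?thesis using c e by (metis zero_lp(2))
  next
    case False
    hence "dim_ge n (B ` E)" using dim_ge_image[OF B ge(1) E] by blast
    moreover have "B ` E \<subseteq> lp r" using bounded_ops_in_lp[OF B] by blast
    ultimately obtain x where x: "x \<in> E" "lp_norm r (B x) = 1" "lp_norm q (S (B x)) < e / (a * b)"
      using n(2) by blast
    have xp: "x \<in> lp p" using x E(2) by blast
    define m where "m = lp_norm p x"
    have m1: "1 \<le> b * m" using Bb[OF xp] x(2) by (simp add: m_def)
    hence m: "m > 0" using ab by (metis lp_norm_nonneg m_def mult_zero_right not_one_le_zero order_le_imp_less_or_eq)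
    have im: "inverse m \<le> b" using m1 m by (simp add: field_simps)
    define y where "y = seq_scale (of_real (inverse m)) x"
    have y: "y \<in> E" "lp_norm p y = 1"
      using seq.subspace_scale[OF dim_ge_subspace[OF E(1)] x(1)] lp_scale(2)[OF xp ge0(1)] m
      by (auto simp: y_def m_def norm_inverse)
    have SBx: "S (B x) \<in> lp q" using bounded_ops_in_lp[OF Sb] .
    have "S (B y) = seq_scale (of_real (inverse m)) (S (B x))"
      unfolding y_def bounded_opsD(4)[OF B xp] bounded_opsD(4)[OF Sb bounded_ops_in_lp[OF B]] ..
    hence SBy: "lp_norm q (S (B y)) = inverse m * lp_norm q (S (B x))"
      using lp_scale(2)[OF SBx ge0(3)] m by (simp add: norm_inverse)
    have "lp_norm s ((A \<circ> S \<circ> B) y) \<le> a * lp_norm q (S (B y))" using Aa bounded_ops_in_lp[OF Sb] by simp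
    also have "\<dots> \<le> a * (b * lp_norm q (S (B x)))"
      unfolding SBy using im ab by (intro mult_left_mono mult_right_mono) auto
    also have "\<dots> < a * (b * (e / (a * b)))" using x(3) ab by (intro mult_strict_left_mono) auto
    also have "\<dots> = e" using ab by simp
    finally show ?thesis using y by blast
  qed
  thus "\<exists>n>0. \<forall>E. dim_ge n E \<and> E \<subseteq> lp p \<longrightarrow> (\<exists>x\<in>E. lp_norm p x = 1 \<and> lp_norm s ((A \<circ> S \<circ> B) x) < e)"
    using n(1) by blast
qed

lemma closed_op_ideal_fss:
  assumes p: "1 < p" and q: "1 \<le> q"
  shows "closed_op_ideal p q (fss_ops p q :: 'k::{real_normed_field, euclidean_space} operator set)"
proof (rule closed_op_idealI)
  have pq0: "0 < p" "0 < q" using p q by auto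
  show pq: "1 \<le> p" "1 \<le> q" using p q by auto
  show sub: "fss_ops p q \<subseteq> (bounded_ops p q :: 'k operator set)" by (auto simp: fss_ops_def)
  show "(0 :: 'k operator) \<in> fss_ops p q"
  proof (rule fss_opsI[OF pq0(1) bounded_ops_zero_op], intro exI[of _ 1] conjI allI impI)
    fix e :: real and E :: "'k sequence set" assume e: "0 < e" and E: "dim_ge 1 E \<and> E \<subseteq> lp p"
    obtain x where x: "x \<in> E" "x \<noteq> 0" using dim_ge_nonzero[of 1 E] E by auto
    obtain c where "seq_scale c x \<in> E" "lp_norm p (seq_scale c x) = 1"
      using unit_vector_in_subspace[OF dim_ge_subspace _ pq0(1) x] E by metis
    thus "\<exists>x\<in>E. lp_norm p x = 1 \<and> lp_norm q ((0 :: 'k operator) x) < e" using e by auto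
  qed simp
  fix S T :: "'k operator" assume S: "S \<in> fss_ops p q" and T: "T \<in> fss_ops p q"
  show "S + T \<in> fss_ops p q"
  proof (rule fss_opsI[OF pq0(1)])
    show "S + T \<in> bounded_ops p q" using S T sub pq by (intro bounded_ops_add) auto
    fix e :: real assume e: "0 < e"
    have e2: "0 < e/2" using e by simp
    obtain n where n: "0 < n"
      "\<And>E. dim_ge n E \<Longrightarrow> E \<subseteq> lp p \<Longrightarrow> \<exists>x\<in>E. lp_norm p x = 1 \<and> lp_norm q (T x) < e/2"
      using fss_opsE[OF pq0(1) T e2] by metis
    obtain N where N: "\<And>E. dim_ge N E \<Longrightarrow> E \<subseteq> lp p \<Longrightarrow>
        \<exists>F\<subseteq>E. dim_ge n F \<and> (\<forall>y\<in>F. lp_norm q (S y) \<le> e/2 * lp_norm p y)"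
      using fss_small_subspace[OF p q S e2, of n] by blast
    have "\<exists>x\<in>E. lp_norm p x = 1 \<and> lp_norm q ((S + T) x) < e" if E: "dim_ge (Suc N) E" "E \<subseteq> lp p" for E
    proof -
      obtain F where F: "F \<subseteq> E" "dim_ge n F" "\<And>y. y \<in> F \<Longrightarrow> lp_norm q (S y) \<le> e/2 * lp_norm p y"
        using N[of E] dim_ge_mono[OF E(1), of N] E(2) by auto
      obtain x where x: "x \<in> F" "lp_norm p x = 1" "lp_norm q (T x) < e/2" using n(2)[OF F(2)] F(1) E(2) by blast
      have "lp_norm q ((S + T) x) \<le> lp_norm q (S x) + lp_norm q (T x)"
        using lp_add(2)[OF bounded_ops_in_lp[OF subsetD[OF sub S]] bounded_ops_in_lp[OF subsetD[OF sub T]] pq(2), of x x]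
        by simp
      also have "\<dots> < e" using F(3)[OF x(1)] x by simp
      finally show ?thesis using x F(1) by blast
    qed
    thus "\<exists>n>0. \<forall>E. dim_ge n E \<and> E \<subseteq> lp p \<longrightarrow> (\<exists>x\<in>E. lp_norm p x = 1 \<and> lp_norm q ((S + T) x) < e)"
      by blast
  qed
next
  fix A T B :: "'k operator"
  assume "A \<in> bounded_ops q q" "T \<in> fss_ops p q" "B \<in> bounded_ops p p"
  thus "A \<circ> T \<circ> B \<in> fss_ops p q" using fss_ops_comp[of p p q q B T A] p q by simp
next
  fix T :: "'k operator" assume T: "T \<in> bounded_ops p q"
    and approx: "\<And>e. 0 < e \<Longrightarrow> \<exists>S\<in>fss_ops p q. \<forall>x\<in>lp p. lp_norm q (T x - S x) \<le> e * lp_norm p x"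
  have pq0: "0 < p" "0 < q" using p q by auto
  show "T \<in> fss_ops p q"
  proof (rule fss_opsI[OF pq0(1) T])
    fix e :: real assume e: "0 < e"
    have e2: "0 < e/2" using e by simp
    obtain S where S: "S \<in> fss_ops p q" "\<And>x. x \<in> lp p \<Longrightarrow> lp_norm q (T x - S x) \<le> e/2 * lp_norm p x"
      using approx[OF e2] by blast
    have Sb: "S \<in> bounded_ops p q" using S by (simp add: fss_ops_def)
    obtain n where n: "0 < n"
      "\<And>E. dim_ge n E \<Longrightarrow> E \<subseteq> lp p \<Longrightarrow> \<exists>x\<in>E. lp_norm p x = 1 \<and> lp_norm q (S x) < e/2"
      using fss_opsE[OF pq0(1) S(1) e2] by metis
    have "\<exists>x\<in>E. lp_norm p x = 1 \<and> lp_norm q (T x) < e" if E: "dim_ge n E" "E \<subseteq> lp p" for E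
    proof -
      obtain x where x: "x \<in> E" "lp_norm p x = 1" "lp_norm q (S x) < e/2" using n(2)[OF E] by blast
      have "lp_norm q (T x) \<le> lp_norm q (T x - S x) + lp_norm q (S x)"
        by (rule lp_norm_le_diff[OF bounded_ops_in_lp[OF T] bounded_ops_in_lp[OF Sb] q])
      also have "\<dots> < e" using S(2)[of x] x E(2) by (auto simp: subset_iff)
      finally show ?thesis using x by blast
    qed
    thus "\<exists>n>0. \<forall>E. dim_ge n E \<and> E \<subseteq> lp p \<longrightarrow> (\<exists>x\<in>E. lp_norm p x = 1 \<and> lp_norm q (T x) < e)"
      using n(1) by blast
  qed
qed

section \<open>Random signs\<close>

text \<open>The \<open>i\<close>-th Rademacher function; the binary digits of \<open>w < 2\<^sup>n\<close> serve as \<open>n\<close> independent fair coins.\<close>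

definition rad :: "nat \<Rightarrow> nat \<Rightarrow> real" where
  "rad i w = (if odd (w div 2 ^ i) then - 1 else 1)"

lemma rad_double [simp]:
  "rad 0 (2 * w) = 1" "rad 0 (Suc (2 * w)) = - 1"
  "rad (Suc i) (2 * w) = rad i w" "rad (Suc i) (Suc (2 * w)) = rad i w"
  by (auto simp: rad_def div_mult2_eq)

lemma rad_square [simp]: "rad i w * rad i w = 1" "(rad i w)\<^sup>2 = 1" "\<bar>rad i w\<bar> = 1"
  by (auto simp: rad_def)

lemma sum_pairs: "(\<Sum>w<2 * m. f w) = (\<Sum>w<m. f (2 * w) + f (Suc (2 * w)))"
  for f :: "nat \<Rightarrow> 'a::comm_monoid_add"
  by (induction m) (auto simp: add_ac)

lemma rad_orthogonal:
  assumes "i < n" "j < n"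
  shows "(\<Sum>w<2 ^ n. rad i w * rad j w) = (if i = j then 2 ^ n else 0)"
  using assms
proof (induction n arbitrary: i j)
  case (Suc n)
  show ?case
  proof (cases i; cases j)
    fix i' j' assume "i = Suc i'" "j = Suc j'"
    thus ?thesis using Suc.IH[of i' j'] Suc.prems by (simp add: sum_pairs flip: sum_distrib_left)
  qed (auto simp: sum_pairs)
qed simp

lemma exp_moment:
  "(\<Sum>w<2 ^ n. exp (\<Sum>i<n. rad i w * a i)) = 2 ^ n * (\<Prod>i<n. cosh (a i))"
proof (induction n arbitrary: a)
  case (Suc n)
  have "(\<Sum>w<2 ^ Suc n. exp (\<Sum>i<Suc n. rad i w * a i)) =
      (\<Sum>w<2 ^ n. (exp (a 0) + exp (- a 0)) * exp (\<Sum>i<n. rad i w * a (Suc i)))"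
    by (simp add: sum_pairs sum.lessThan_Suc_shift exp_add distrib_right del: sum.lessThan_Suc)
  also have "\<dots> = 2 * cosh (a 0) * (2 ^ n * (\<Prod>i<n. cosh (a (Suc i))))"
    unfolding sum_distrib_left[symmetric] Suc.IH[of "\<lambda>i. a (Suc i)"] by (simp add: cosh_def)
  also have "\<dots> = 2 ^ Suc n * (\<Prod>i<Suc n. cosh (a i))"
    by (simp add: prod.lessThan_Suc_shift del: prod.lessThan_Suc)
  finally show ?case .
qed simp

lemma cosh_le_exp_square:
  fixes t :: real assumes "\<bar>t\<bar> \<le> 1" shows "cosh t \<le> exp (t\<^sup>2)"
proof -
  have "cosh s \<le> exp (s\<^sup>2)" if s: "0 \<le> s" "s \<le> 1" for s :: real
  proof -
    have "exp (- s) = 1 / exp s" by (simp add: exp_minus inverse_eq_divide)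
    also have "\<dots> \<le> 1 / (1 + s)" using s by (intro divide_left_mono exp_ge_add_one_self) auto
    also have "\<dots> \<le> 1 - s + s\<^sup>2"
    proof -
      have "(1 + s) * (1 - s + s\<^sup>2) = 1 + s ^ 3" by (simp add: algebra_simps power2_eq_square power3_eq_cube)
      hence "1 \<le> (1 - s + s\<^sup>2) * (1 + s)" using s by (simp add: mult.commute)
      thus ?thesis using s by (simp add: pos_divide_le_eq)
    qed
    finally have "cosh s \<le> 1 + s\<^sup>2" using exp_bound[OF s] by (simp add: cosh_def)
    also have "\<dots> \<le> exp (s\<^sup>2)" by (rule exp_ge_add_one_self)
    finally show ?thesis .
  qed
  from this[of "\<bar>t\<bar>"] assms show ?thesis by simp
qed

text \<open>
  The easy half of Khintchine's inequality, with a constant that depends on \<open>s\<close> only: the exponential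
  moment factorises over the signs, and the exponential dominates every power.
\<close>

lemma Khintchine_unit:
  fixes a :: "nat \<Rightarrow> real"
  assumes s: "0 < s" and a: "(\<Sum>i<n. (a i)\<^sup>2) \<le> 1"
  shows "(\<Sum>w<2 ^ n. \<bar>\<Sum>i<n. rad i w * a i\<bar> powr s) \<le> 2 * s powr s * exp 1 * 2 ^ n"
proof -
  have moment: "(\<Sum>w<2 ^ n. exp (\<Sum>i<n. rad i w * b i)) \<le> exp 1 * 2 ^ n" if b: "(\<Sum>i<n. (b i)\<^sup>2) \<le> 1" for b
  proof -
    have "\<bar>b i\<bar> \<le> 1" if "i < n" for i
    proof -
      have "(b i)\<^sup>2 \<le> (\<Sum>i<n. (b i)\<^sup>2)" using that by (intro member_le_sum) auto
      thus ?thesis using b abs_square_le_1[of "b i"] by linarith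
    qed
    hence "(\<Prod>i<n. cosh (b i)) \<le> (\<Prod>i<n. exp ((b i)\<^sup>2))"
      by (intro prod_mono) (auto intro: cosh_le_exp_square)
    also have "\<dots> = exp (\<Sum>i<n. (b i)\<^sup>2)" by (simp add: exp_sum)
    also have "\<dots> \<le> exp 1" using b by simp
    finally show ?thesis unfolding exp_moment by (simp add: mult.commute)
  qed
  have power: "y powr s \<le> s powr s * exp y" if "0 \<le> y" for y :: real
  proof -
    have "y / s \<le> exp (y / s)" using exp_ge_add_one_self[of "y / s"] by linarith
    hence "y \<le> s * exp (y / s)" using s by (simp add: field_simps)
    hence "y powr s \<le> (s * exp (y / s)) powr s" using that s by (intro powr_mono2) auto
    also have "\<dots> = s powr s * exp y" using s by (simp add: powr_mult exp_powr_real)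
    finally show ?thesis .
  qed
  have "\<bar>y\<bar> powr s \<le> s powr s * (exp y + exp (- y))" for y :: real
  proof -
    have "exp \<bar>y\<bar> \<le> exp y + exp (- y)" by (cases "0 \<le> y") auto
    hence "s powr s * exp \<bar>y\<bar> \<le> s powr s * (exp y + exp (- y))" by (intro mult_left_mono) auto
    thus ?thesis using power[of "\<bar>y\<bar>"] by simp
  qed
  hence "(\<Sum>w<2 ^ n. \<bar>\<Sum>i<n. rad i w * a i\<bar> powr s) \<le>
      (\<Sum>w<2 ^ n. s powr s * (exp (\<Sum>i<n. rad i w * a i) + exp (- (\<Sum>i<n. rad i w * a i))))"
    by (intro sum_mono)
  also have "\<dots> = s powr s * ((\<Sum>w<2 ^ n. exp (\<Sum>i<n. rad i w * a i)) + (\<Sum>w<2 ^ n. exp (\<Sum>i<n. rad i w * - a i)))"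
    by (simp add: sum.distrib sum_negf flip: sum_distrib_left)
  also have "\<dots> \<le> s powr s * (exp 1 * 2 ^ n + exp 1 * 2 ^ n)"
    using moment[of a] moment[of "\<lambda>i. - a i"] a by (intro mult_left_mono add_mono) auto
  finally show ?thesis by (simp add: algebra_simps)
qed

lemma Khintchine_real:
  fixes a :: "nat \<Rightarrow> real"
  assumes s: "0 < s"
  shows "(\<Sum>w<2 ^ n. \<bar>\<Sum>i<n. rad i w * a i\<bar> powr s) \<le>
    2 * s powr s * exp 1 * 2 ^ n * (\<Sum>i<n. (a i)\<^sup>2) powr (s / 2)"
proof -
  define t where "t = sqrt (\<Sum>i<n. (a i)\<^sup>2)"
  have t2: "t\<^sup>2 = (\<Sum>i<n. (a i)\<^sup>2)" "t \<ge> 0" unfolding t_def by (auto intro: sum_nonneg)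
  show ?thesis
  proof (cases "t = 0")
    case True
    hence "(\<Sum>i<n. (a i)\<^sup>2) = 0" using t2 by simp
    hence "a i = 0" if "i < n" for i using that by (simp add: sum_nonneg_eq_0_iff)
    hence "(\<Sum>i<n. rad i w * a i) = 0" for w by simp
    thus ?thesis by simp
  next
    case False
    hence t: "t > 0" using t2 by simp
    have "(\<Sum>i<n. (a i / t)\<^sup>2) \<le> 1"
      using t t2 by (simp add: power_divide flip: sum_divide_distrib)
    from Khintchine_unit[OF s this]
    have "(\<Sum>w<2 ^ n. \<bar>\<Sum>i<n. rad i w * (a i / t)\<bar> powr s) \<le> 2 * s powr s * exp 1 * 2 ^ n" .
    moreover have "\<bar>\<Sum>i<n. rad i w * (a i / t)\<bar> powr s = \<bar>\<Sum>i<n. rad i w * a i\<bar> powr s / t powr s" for w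
      using t by (simp add: powr_divide flip: sum_divide_distrib)
    moreover have "t powr s = (\<Sum>i<n. (a i)\<^sup>2) powr (s / 2)"
      using t by (simp add: t2(1)[symmetric] powr_powr flip: powr_numeral)
    ultimately have "(\<Sum>w<2 ^ n. \<bar>\<Sum>i<n. rad i w * a i\<bar> powr s) / t powr s \<le> 2 * s powr s * exp 1 * 2 ^ n"
      by (simp only: sum_divide_distrib)
    hence "(\<Sum>w<2 ^ n. \<bar>\<Sum>i<n. rad i w * a i\<bar> powr s) \<le> 2 * s powr s * exp 1 * 2 ^ n * t powr s"
      using t by (simp add: pos_divide_le_eq)
    thus ?thesis unfolding \<open>t powr s = _\<close> .
  qed
qed

text \<open>Coordinates with respect to a real basis transfer the inequality to the scalar type.\<close>

lemma Khintchine: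
  fixes dummy :: "'k::{real_normed_field, euclidean_space}"
  assumes s: "0 < s"
  obtains C where "0 < C" "\<And>n (a :: nat \<Rightarrow> 'k). (\<Sum>w<2 ^ n. norm (\<Sum>i<n. of_real (rad i w) * a i) powr s) \<le>
    C * 2 ^ n * (\<Sum>i<n. (norm (a i))\<^sup>2) powr (s / 2)"
proof -
  define c where "c = 2 * s powr s * exp 1"
  define D where "D = real DIM('k)"
  have cD: "c > 0" "D > 0" using s by (auto simp: c_def D_def)
  have coord: "norm y powr s \<le> D powr s * (\<Sum>b\<in>Basis. \<bar>y \<bullet> b\<bar> powr s)" for y :: 'k
  proof -
    define m where "m = Max ((\<lambda>b. \<bar>y \<bullet> b\<bar>) ` Basis)"
    have "m \<in> (\<lambda>b. \<bar>y \<bullet> b\<bar>) ` Basis" unfolding m_def by (intro Max_in) auto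
    then obtain b where b: "b \<in> Basis" "m = \<bar>y \<bullet> b\<bar>" by blast
    have "norm y \<le> (\<Sum>b\<in>Basis. \<bar>y \<bullet> b\<bar>)" by (rule norm_le_l1)
    also have "\<dots> \<le> (\<Sum>b\<in>(Basis :: 'k set). m)" unfolding m_def by (intro sum_mono Max_ge) auto
    also have "\<dots> = D * m" by (simp add: D_def)
    finally have "norm y powr s \<le> (D * m) powr s" using s by (intro powr_mono2) auto
    also have "\<dots> = D powr s * \<bar>y \<bullet> b\<bar> powr s" using b cD by (simp add: powr_mult)
    also have "\<bar>y \<bullet> b\<bar> powr s \<le> (\<Sum>b\<in>Basis. \<bar>y \<bullet> b\<bar> powr s)" using b by (intro member_le_sum) auto
    finally show ?thesis using cD by simp
  qed
  show ?thesis
  proof (rule that[of "D powr s * D * c"])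
    fix n and a :: "nat \<Rightarrow> 'k"
    have "(\<Sum>w<2 ^ n. norm (\<Sum>i<n. of_real (rad i w) * a i) powr s) \<le>
        (\<Sum>w<2 ^ n. D powr s * (\<Sum>b\<in>Basis. \<bar>(\<Sum>i<n. of_real (rad i w) * a i) \<bullet> b\<bar> powr s))"
      by (intro sum_mono coord)
    also have "\<dots> = D powr s * (\<Sum>b\<in>Basis. \<Sum>w<2 ^ n. \<bar>\<Sum>i<n. rad i w * (a i \<bullet> b)\<bar> powr s)"
      by (subst sum.swap) (simp add: sum_distrib_left inner_sum_left scaleR_conv_of_real[symmetric])
    also have "\<dots> \<le> D powr s * (\<Sum>b\<in>(Basis :: 'k set). c * 2 ^ n * (\<Sum>i<n. (norm (a i))\<^sup>2) powr (s / 2))"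
    proof (intro mult_left_mono sum_mono)
      fix b :: 'k assume b: "b \<in> Basis"
      have "(\<Sum>w<2 ^ n. \<bar>\<Sum>i<n. rad i w * (a i \<bullet> b)\<bar> powr s) \<le> c * 2 ^ n * (\<Sum>i<n. (a i \<bullet> b)\<^sup>2) powr (s / 2)"
        unfolding c_def by (rule Khintchine_real[OF s])
      also have "\<dots> \<le> c * 2 ^ n * (\<Sum>i<n. (norm (a i))\<^sup>2) powr (s / 2)"
      proof (intro mult_left_mono powr_mono2 sum_mono)
        show "(a i \<bullet> b)\<^sup>2 \<le> (norm (a i))\<^sup>2" for i
          using Basis_le_norm[OF b, of "a i"] by (simp add: abs_le_square_iff[symmetric])
      qed (use s cD in \<open>auto intro: sum_nonneg\<close>)
      finally show "(\<Sum>w<2 ^ n. \<bar>\<Sum>i<n. rad i w * (a i \<bullet> b)\<bar> powr s) \<le> \<dots>" .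
    qed simp
    also have "\<dots> = D powr s * D * c * 2 ^ n * (\<Sum>i<n. (norm (a i))\<^sup>2) powr (s / 2)"
      by (simp add: D_def)
    finally show "(\<Sum>w<2 ^ n. norm (\<Sum>i<n. of_real (rad i w) * a i) powr s) \<le> \<dots>" .
  qed (use cD in simp)
qed

section \<open>The formal identity from \<open>\<ell>\<^sub>2\<close> to \<open>\<ell>\<^sub>q\<close> is finitely strictly singular\<close>

lemma inner_mult_left:
  fixes a z w :: "'k::{real_normed_field, euclidean_space}"
  shows "(a * z) \<bullet> (a * w) = (norm a)\<^sup>2 * (z \<bullet> w)"
proof -
  have "a * z + a * w = a * (z + w)" by (simp add: distrib_left)
  hence "(norm (a * z + a * w))\<^sup>2 = (norm a)\<^sup>2 * (norm (z + w))\<^sup>2"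
    by (simp only: norm_mult power_mult_distrib)
  thus ?thesis by (simp only: dot_norm norm_mult power_mult_distrib) (simp add: right_diff_distrib)
qed

text \<open>
  Because the norm is multiplicative, the real inner product of two scalars is the real part (the
  component along \<open>1\<close>) of the summand in \<^const>\<open>norming\<close>. Hence a vector in the kernel of the functional that norms \<open>x\<close> in \<open>\<ell>\<^sub>2\<close> is
  orthogonal to \<open>x\<close> in the real Hilbert space underlying \<open>\<ell>\<^sub>2\<close>.
\<close>

lemma norming_two_term:
  fixes a b :: "'k::{real_normed_field, euclidean_space}"
  shows "(of_real (norm a powr 2) * inverse a * b) \<bullet> 1 = a \<bullet> b"
proof (cases "a = 0")
  case False
  have "a \<bullet> b = (a * 1) \<bullet> (a * (inverse a * b))" using False by (simp add: field_simps)
  also have "\<dots> = (norm a)\<^sup>2 * (1 \<bullet> (inverse a * b))" by (rule inner_mult_left)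
  also have "\<dots> = (((norm a)\<^sup>2) *\<^sub>R (inverse a * b)) \<bullet> 1" by (simp add: inner_commute)
  also have "((norm a)\<^sup>2) *\<^sub>R (inverse a * b) = of_real (norm a powr 2) * inverse a * b"
    by (simp add: scaleR_conv_of_real mult.assoc)
  finally show ?thesis ..
qed simp

lemma lp_norm_two_square: "x \<in> lp 2 \<Longrightarrow> (lp_norm 2 x)\<^sup>2 = (\<Sum>i. (norm (x i))\<^sup>2)"
  using lp_norm_powr[of x 2] by simp

lemma lp_two_summable: "x \<in> lp 2 \<Longrightarrow> summable (\<lambda>i. (norm (x i))\<^sup>2)"
  by (simp add: lp_def)

lemma Pythagoras:
  fixes x y :: "'k::{real_normed_field, euclidean_space} sequence"
  assumes x: "x \<in> lp 2" "lp_norm 2 x = 1" and y: "y \<in> lp 2" and orth: "norming 2 x y = 0"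
  shows "(lp_norm 2 (seq_scale (of_real c) x + y))\<^sup>2 = c\<^sup>2 + (lp_norm 2 y)\<^sup>2"
proof -
  have "(\<lambda>i. of_real (norm (x i) powr 2) * inverse (x i) * y i) sums 0"
    using norming_summable(2)[OF _ x(1) y] orth by (simp add: norming_def sums_iff)
  from bounded_linear.sums[OF bounded_linear_inner_left[of 1] this]
  have inner: "(\<lambda>i. x i \<bullet> y i) sums 0" by (simp only: norming_two_term inner_zero_left)
  have "(\<lambda>i. (norm (x i))\<^sup>2) sums 1" "(\<lambda>i. (norm (y i))\<^sup>2) sums (lp_norm 2 y)\<^sup>2"
    using lp_two_summable x y lp_norm_two_square[OF x(1)] lp_norm_two_square[OF y] by (auto simp: sums_iff)
  hence "(\<lambda>i. c\<^sup>2 * (norm (x i))\<^sup>2 + 2 * c * (x i \<bullet> y i) + (norm (y i))\<^sup>2) sums (c\<^sup>2 * 1 + 2 * c * 0 + (lp_norm 2 y)\<^sup>2)"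
    using inner by (intro sums_add sums_mult)
  moreover have "c\<^sup>2 * (norm (x i))\<^sup>2 + 2 * c * (x i \<bullet> y i) + (norm (y i))\<^sup>2 =
      (norm ((seq_scale (of_real c) x + y) i))\<^sup>2" for i
    unfolding power2_norm_eq_inner
    by (simp add: seq_scale_def scaleR_conv_of_real[symmetric] inner_add_left
        inner_add_right inner_commute power2_eq_square algebra_simps)
  moreover have "seq_scale (of_real c) x + y \<in> lp 2" using x y by (intro lp_add lp_scale) auto
  ultimately show ?thesis by (simp add: lp_norm_two_square sums_iff)
qed

lemma orthonormal_system:
  fixes E :: "'k::{real_normed_field, euclidean_space} sequence set"
  assumes "dim_ge m E" "E \<subseteq> lp 2"
  obtains u where "\<And>i. i < m \<Longrightarrow> u i \<in> E"
    "\<And>c. (lp_norm 2 (\<Sum>i<m. seq_scale (of_real (c i)) (u i)))\<^sup>2 = (\<Sum>i<m. (c i)\<^sup>2)"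
proof -
  have "\<exists>u. (\<forall>i<m. u i \<in> E) \<and> (\<forall>c. (lp_norm 2 (\<Sum>i<m. seq_scale (of_real (c i)) (u i)))\<^sup>2 = (\<Sum>i<m. (c i)\<^sup>2))"
    using assms
  proof (induction m arbitrary: E)
    case (Suc m)
    have subE: "seq.subspace E" using Suc.prems dim_ge_subspace by blast
    obtain z where "z \<in> E" "z \<noteq> 0" using dim_ge_nonzero[OF Suc.prems(1)] by blast
    then obtain c where "seq_scale c z \<in> E" "lp_norm 2 (seq_scale c z) = 1"
      using unit_vector_in_subspace[OF subE Suc.prems(2)] by (metis zero_less_numeral)
    then obtain x where x: "x \<in> E" "lp_norm 2 x = 1" by blast
    have xp: "x \<in> lp 2" using x Suc.prems(2) by blast
    define K where "K = {y \<in> E. norming 2 x y = 0}"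
    have "dim_ge m K" unfolding K_def
      using Suc.prems norming_add[OF _ xp] norming_scale[OF _ xp] by (intro dim_ge_kernel) (auto simp: subset_iff)
    moreover have KE: "K \<subseteq> E" by (auto simp: K_def)
    ultimately obtain u where u: "\<And>i. i < m \<Longrightarrow> u i \<in> K"
      "\<And>c. (lp_norm 2 (\<Sum>i<m. seq_scale (of_real (c i)) (u i)))\<^sup>2 = (\<Sum>i<m. (c i)\<^sup>2)"
      using Suc.IH[of K] Suc.prems(2) by blast
    have subK: "seq.subspace K" using \<open>dim_ge m K\<close> dim_ge_subspace by blast
    define v where "v i = (case i of 0 \<Rightarrow> x | Suc j \<Rightarrow> u j)" for i
    have "(lp_norm 2 (\<Sum>i<Suc m. seq_scale (of_real (c i)) (v i)))\<^sup>2 = (\<Sum>i<Suc m. (c i)\<^sup>2)" for c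
    proof -
      define y where "y = (\<Sum>i<m. seq_scale (of_real (c (Suc i))) (u i))"
      have yK: "y \<in> K" unfolding y_def using u(1) subK by (intro seq.subspace_sum seq.subspace_scale) auto
      have "(lp_norm 2 (\<Sum>i<Suc m. seq_scale (of_real (c i)) (v i)))\<^sup>2 = (lp_norm 2 (seq_scale (of_real (c 0)) x + y))\<^sup>2"
        unfolding sum.lessThan_Suc_shift by (simp add: v_def y_def)
      also have "\<dots> = (c 0)\<^sup>2 + (lp_norm 2 y)\<^sup>2"
        using yK KE Suc.prems(2) by (intro Pythagoras xp x(2)) (auto simp: K_def)
      also have "\<dots> = (\<Sum>i<Suc m. (c i)\<^sup>2)"
        unfolding sum.lessThan_Suc_shift y_def u(2) by simp
      finally show ?thesis .
    qed
    moreover have "v i \<in> E" if "i < Suc m" for i using that x(1) u(1) KE by (cases i) (auto simp: v_def)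
    ultimately show ?case by blast
  qed auto
  thus ?thesis using that by blast
qed

text \<open>
  Bessel's inequality for the coordinate functionals: each real component of the \<open>k\<close>-th coordinate
  contributes at most \<open>1\<close>.
\<close>

lemma orthonormal_coord_sum_le:
  fixes u :: "nat \<Rightarrow> 'k::{real_normed_field, euclidean_space} sequence"
  assumes lp: "\<And>i. i < m \<Longrightarrow> u i \<in> lp 2"
    and on: "\<And>c. (lp_norm 2 (\<Sum>i<m. seq_scale (of_real (c i)) (u i)))\<^sup>2 = (\<Sum>i<m. (c i)\<^sup>2)"
  shows "(\<Sum>i<m. (norm (u i k))\<^sup>2) \<le> real DIM('k)"
proof -
  have "(\<Sum>i<m. (u i k \<bullet> b)\<^sup>2) \<le> 1" if b: "b \<in> Basis" for b
  proof -
    define t where "t = (\<Sum>i<m. (u i k \<bullet> b)\<^sup>2)"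
    define x where "x = (\<Sum>i<m. seq_scale (of_real (u i k \<bullet> b)) (u i))"
    have xp: "x \<in> lp 2" unfolding x_def using lp by (intro lp_sum_closed lp_scale) auto
    have "x k \<bullet> b = t"
      unfolding x_def t_def seq_sum_apply by (simp add: seq_scale_def inner_sum_left power2_eq_square scaleR_conv_of_real[symmetric])
    hence "t \<le> norm (x k)" using Basis_le_norm[OF b, of "x k"] by simp
    also have "\<dots> \<le> lp_norm 2 x" using lp_coord_le[OF xp] by simp
    finally have "t\<^sup>2 \<le> (lp_norm 2 x)\<^sup>2" by (intro power_mono) (auto simp: t_def intro: sum_nonneg)
    also have "\<dots> = t" using on[of "\<lambda>i. u i k \<bullet> b"] by (simp add: x_def t_def)
    finally have "t * t \<le> 1 * t" by (simp add: power2_eq_square)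
    thus ?thesis unfolding t_def[symmetric] using mult_right_le_imp_le[of t t 1] by (cases "t > 0") auto
  qed
  hence "(\<Sum>b\<in>(Basis::'k set). \<Sum>i<m. (u i k \<bullet> b)\<^sup>2) \<le> (\<Sum>b\<in>(Basis::'k set). 1)" by (intro sum_mono)
  also have "(\<Sum>b\<in>(Basis::'k set). \<Sum>i<m. (u i k \<bullet> b)\<^sup>2) = (\<Sum>i<m. (norm (u i k))\<^sup>2)"
    unfolding power2_norm_eq_inner euclidean_inner[of "u _ k" "u _ k"]
    by (subst sum.swap) (simp add: power2_eq_square)
  finally show ?thesis by simp
qed

text \<open>
  In a subspace of dimension \<open>n\<close>, a random sum \<open>\<plusminus>u\<^sub>0 \<plusminus> \<dots> \<plusminus> u\<^bsub>n-1\<^esub>\<close> of an orthonormal system has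
  \<open>\<ell>\<^sub>2\<close>-norm \<open>n\<^bsup>1/2\<^esup>\<close>, while by Khintchine its \<open>\<ell>\<^sub>q\<close>-norm is of order at most \<open>n\<^bsup>1/q\<^esup>\<close> on average:
  coordinate \<open>k\<close> contributes \<open>(\<Sum>\<^sub>i \<bar>u\<^sub>i(k)\<bar>\<^sup>2)\<^bsup>q/2\<^esup>\<close>, which Bessel's inequality bounds by a multiple of
  \<open>\<Sum>\<^sub>i \<bar>u\<^sub>i(k)\<bar>\<^sup>2\<close>, and these sum to \<open>n\<close>.
\<close>

lemma formal_identity_two_fss:
  assumes q: "2 < q"
  shows "(formal_identity 2 :: 'k::{real_normed_field, euclidean_space} operator) \<in> fss_ops 2 q"
proof (rule fss_opsI)
  show "(formal_identity 2 :: 'k operator) \<in> bounded_ops 2 q" using q by (intro formal_identity_bounded) auto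
  fix e :: real assume e: "0 < e"
  define D where "D = real DIM('k)"
  have D: "D \<ge> 1" using DIM_positive[where 'a='k] by (simp add: D_def)
  have q0: "0 < q" using q by simp
  obtain C where C: "0 < C" "\<And>n (a :: nat \<Rightarrow> 'k). (\<Sum>w<2 ^ n. norm (\<Sum>i<n. of_real (rad i w) * a i) powr q) \<le>
      C * 2 ^ n * (\<Sum>i<n. (norm (a i))\<^sup>2) powr (q / 2)"
    using Khintchine[OF q0] by blast
  define c where "c = C * D powr (q / 2 - 1)"
  have c: "c > 0" using C D by (simp add: c_def)
  have "((\<lambda>n. c powr (1/q) * real n powr (1/q - 1/2)) \<longlongrightarrow> c powr (1/q) * 0) sequentially"
    using q by (intro tendsto_mult tendsto_const tendsto_neg_powr filterlim_real_sequentially) (auto simp: field_simps)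
  hence "\<forall>\<^sub>F n in sequentially. c powr (1/q) * real n powr (1/q - 1/2) < e"
    using e by (intro order_tendstoD(2)[where y = 0]) auto
  then obtain N where N: "\<And>n. n \<ge> N \<Longrightarrow> c powr (1/q) * real n powr (1/q - 1/2) < e"
    by (auto simp: eventually_sequentially)
  define n where "n = Suc N"
  have n: "n > 0" "c powr (1/q) * real n powr (1/q - 1/2) < e" using N[of n] by (auto simp: n_def)
  have "\<exists>x\<in>E. lp_norm 2 x = 1 \<and> lp_norm q (formal_identity 2 x) < e"
    if E: "dim_ge n E" "E \<subseteq> lp 2" for E :: "'k sequence set"
  proof -
    obtain u where u: "\<And>i. i < n \<Longrightarrow> u i \<in> E"
      "\<And>c. (lp_norm 2 (\<Sum>i<n. seq_scale (of_real (c i)) (u i)))\<^sup>2 = (\<Sum>i<n. (c i)\<^sup>2)"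
      using orthonormal_system[OF E] by metis
    have up: "\<And>i. i < n \<Longrightarrow> u i \<in> lp 2" using u(1) E(2) by blast
    have subE: "seq.subspace E" using E dim_ge_subspace by blast
    have u1: "(lp_norm 2 (u i))\<^sup>2 = 1" if "i < n" for i
    proof -
      have "(\<Sum>j<n. seq_scale (of_real (if j = i then 1 else 0)) (u j)) = (\<Sum>j<n. if j = i then u j else 0)"
        by (intro sum.cong) auto
      also have "\<dots> = u i" using that by simp
      finally show ?thesis using u(2)[of "\<lambda>j. if j = i then 1 else 0"] that by (simp add: if_distrib[of "\<lambda>x. x\<^sup>2"] cong: if_cong)
    qed
    define s where "s w = (\<Sum>i<n. seq_scale (of_real (rad i w)) (u i))" for w
    have sE: "s w \<in> E" for w unfolding s_def using u(1) subE by (intro seq.subspace_sum seq.subspace_scale) auto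
    have s2: "s w \<in> lp 2" for w using sE E(2) by blast
    have sq: "s w \<in> lp q" for w using lp_mono(1)[OF s2] q by simp
    have sn: "(lp_norm 2 (s w))\<^sup>2 = real n" for w unfolding s_def u(2) by simp
    have coord: "(\<Sum>w<2 ^ n. norm (s w k) powr q) \<le> c * 2 ^ n * (\<Sum>i<n. (norm (u i k))\<^sup>2)" for k
    proof -
      define t where "t = (\<Sum>i<n. (norm (u i k))\<^sup>2)"
      have t: "0 \<le> t" "t \<le> D" using orthonormal_coord_sum_le[OF up u(2)] by (auto simp: t_def D_def intro: sum_nonneg)
      have "(\<Sum>w<2 ^ n. norm (s w k) powr q) \<le> C * 2 ^ n * t powr (q / 2)"
        using C(2)[of "\<lambda>i. u i k" n] by (simp add: s_def seq_sum_apply seq_scale_def t_def)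
      also have "t powr (q / 2) = t powr (q / 2 - 1) * t"
        using t by (cases "t = 0") (auto simp: powr_diff)
      also have "\<dots> \<le> D powr (q / 2 - 1) * t"
        using t q by (intro mult_right_mono powr_mono2) auto
      finally show ?thesis using C(1) by (simp add: c_def t_def mult_ac)
    qed
    have summ: "summable (\<lambda>k. norm (s w k) powr q)" for w using sq by (simp add: lp_def)
    have "(\<Sum>w<2 ^ n. lp_norm q (s w) powr q) = (\<Sum>w<2 ^ n. \<Sum>k. norm (s w k) powr q)"
      using lp_norm_powr[OF sq q0] by simp
    also have "\<dots> = (\<Sum>k. \<Sum>w<2 ^ n. norm (s w k) powr q)"
      by (rule suminf_sum[symmetric, OF summ])
    also have "\<dots> \<le> (\<Sum>k. c * 2 ^ n * (\<Sum>i<n. (norm (u i k))\<^sup>2))"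
      using coord summ up by (intro suminf_le summable_sum summable_mult lp_two_summable) auto
    also have "\<dots> = c * 2 ^ n * (\<Sum>i<n. \<Sum>k. (norm (u i k))\<^sup>2)"
    proof -
      have su: "summable (\<lambda>k. (norm (u i k))\<^sup>2)" if "i \<in> {..<n}" for i
        using up that by (intro lp_two_summable) auto
      have "(\<Sum>k. c * 2 ^ n * (\<Sum>i<n. (norm (u i k))\<^sup>2)) = c * 2 ^ n * (\<Sum>k. \<Sum>i<n. (norm (u i k))\<^sup>2)"
        by (rule suminf_mult, rule summable_sum, erule su)
      also have "(\<Sum>k. \<Sum>i<n. (norm (u i k))\<^sup>2) = (\<Sum>i<n. \<Sum>k. (norm (u i k))\<^sup>2)"
        by (rule suminf_sum, erule su)
      finally show ?thesis .
    qed
    also have "(\<Sum>i<n. \<Sum>k. (norm (u i k))\<^sup>2) = real n"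
      using u1 lp_norm_two_square[OF up] by simp
    finally have total: "(\<Sum>w<2 ^ n. lp_norm q (s w) powr q) \<le> c * 2 ^ n * real n" .
    have "\<exists>w. lp_norm q (s w) powr q \<le> c * real n"
    proof (rule ccontr)
      assume "\<not> ?thesis"
      hence "(\<Sum>w<(2::nat) ^ n. c * real n) < (\<Sum>w<2 ^ n. lp_norm q (s w) powr q)"
        by (intro sum_strict_mono) (auto simp: not_le lessThan_empty_iff)
      thus False using total by (simp add: mult_ac)
    qed
    then obtain w where w: "lp_norm q (s w) powr q \<le> c * real n" ..
    have "(lp_norm q (s w) powr q) powr (1/q) \<le> (c * real n) powr (1/q)"
      using w q by (intro powr_mono2) auto
    hence w': "lp_norm q (s w) \<le> c powr (1/q) * real n powr (1/q)"
      using q by (simp add: powr_powr powr_mult)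
    define h where "h = real n powr (- 1/2)"
    have "h\<^sup>2 = real n powr (- 1)" by (simp add: h_def power2_eq_square flip: powr_add)
    hence h: "h > 0" "h\<^sup>2 * real n = 1" using n(1) by (auto simp: h_def powr_minus)
    define x where "x = seq_scale (of_real h) (s w)"
    have "(lp_norm 2 x)\<^sup>2 = 1"
      using lp_scale(2)[OF s2[of w], of "of_real h"] sn[of w] h by (simp add: x_def power_mult_distrib)
    hence "lp_norm 2 x = 1" by (simp add: power2_eq_1_iff) (metis lp_norm_nonneg neg_0_le_iff_le not_one_le_zero)
    moreover have "lp_norm q (formal_identity 2 x) < e"
    proof -
      have "x \<in> lp 2" unfolding x_def using s2 by (intro lp_scale) auto
      hence "lp_norm q (formal_identity 2 x) = h * lp_norm q (s w)"
        using lp_scale(2)[OF sq[of w] q0, of "of_real h"] h by (simp add: formal_identity_def x_def)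
      also have "\<dots> \<le> h * (c powr (1/q) * real n powr (1/q))" using w' h by (intro mult_left_mono) auto
      also have "\<dots> = c powr (1/q) * real n powr (1/q - 1/2)"
        unfolding h_def diff_conv_add_uminus powr_add by simp
      finally show ?thesis using n(2) by simp
    qed
    moreover have "x \<in> E" unfolding x_def by (rule seq.subspace_scale[OF subE sE])
    ultimately show ?thesis by blast
  qed
  thus "\<exists>n>0. \<forall>E. dim_ge n E \<and> E \<subseteq> lp 2 \<longrightarrow> (\<exists>x\<in>E. lp_norm 2 x = 1 \<and> lp_norm q (formal_identity 2 (x :: 'k sequence)) < e)"
    using n(1) by blast
qed simp

section \<open>Block diagonal operators\<close>

text \<open>Coordinate \<open>prod_encode (n, i)\<close> is the \<open>i\<close>-th coordinate of the \<open>n\<close>-th block.\<close>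

definition fin_norm :: "real \<Rightarrow> nat \<Rightarrow> (nat \<Rightarrow> 'k::real_normed_field) \<Rightarrow> real" where
  "fin_norm p m a = (\<Sum>j<m. norm (a j) powr p) powr (1 / p)"

definition block :: "nat \<Rightarrow> nat \<Rightarrow> (nat \<Rightarrow> 'k::real_normed_field) \<Rightarrow> 'k sequence" where
  "block n m a = (\<lambda>k. case prod_decode k of (n', j) \<Rightarrow> if n' = n \<and> j < m then a j else 0)"

definition block_op :: "real \<Rightarrow> (nat \<Rightarrow> nat) \<Rightarrow> (nat \<Rightarrow> nat) \<Rightarrow> (nat \<Rightarrow> nat \<Rightarrow> nat \<Rightarrow> 'k::real_normed_field) \<Rightarrow> 'k operator" where
  "block_op p s t M x = (if x \<in> lp p then (\<lambda>k. case prod_decode k of (n, i) \<Rightarrow>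
      if i < t n then \<Sum>j<s n. M n i j * x (prod_encode (n, j)) else 0) else 0)"

lemma fin_norm_nonneg [simp]: "0 \<le> fin_norm p m a" by (simp add: fin_norm_def)

lemma fin_norm_powr: "0 < p \<Longrightarrow> fin_norm p m a powr p = (\<Sum>j<m. norm (a j) powr p)"
  by (simp add: fin_norm_def powr_powr sum_nonneg)

lemma fin_norm_two: "fin_norm 2 m a = sqrt (\<Sum>j<m. (norm (a j))\<^sup>2)"
  by (simp add: fin_norm_def powr_half_sqrt sum_nonneg)

lemma fin_norm_scale: "0 < p \<Longrightarrow> fin_norm p m (\<lambda>j. c * a j) = norm c * fin_norm p m a"
  by (simp add: fin_norm_def norm_mult powr_mult powr_powr sum_nonneg flip: sum_distrib_left)

lemma block_apply [simp]: "block n m a (prod_encode (n', j)) = (if n' = n \<and> j < m then a j else 0)"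
  by (simp add: block_def)

lemma seq_eq_blockI: "(\<And>n j. x (prod_encode (n, j)) = y (prod_encode (n, j))) \<Longrightarrow> x = y"
  by (rule ext) (metis prod_decode_inverse surj_pair)

lemma block_lp:
  assumes "0 < p"
  shows "block n m a \<in> lp p" "lp_norm p (block n m a) = fin_norm p m a"
proof -
  define A where "A = (\<lambda>j. prod_encode (n, j)) ` {..<m}"
  have inj: "inj_on (\<lambda>j. prod_encode (n, j)) {..<m}" by (rule inj_onI) (simp add: prod_encode_eq)
  have zero: "norm (block n m a k) powr p = 0" if k: "k \<notin> A" for k
  proof -
    obtain n' j where nj: "k = prod_encode (n', j)" by (metis prod_decode_inverse surj_pair)
    thus ?thesis using k by (auto simp: A_def)
  qed
  have fin: "finite A" by (simp add: A_def)
  show "block n m a \<in> lp p"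
    unfolding lp_def using summable_finite[OF fin zero] by simp
  have "(\<Sum>k. norm (block n m a k) powr p) = (\<Sum>k\<in>A. norm (block n m a k) powr p)"
    by (rule suminf_finite[OF fin zero])
  also have "\<dots> = (\<Sum>j<m. norm (a j) powr p)"
    unfolding A_def by (subst sum.reindex[OF inj]) auto
  finally show "lp_norm p (block n m a) = fin_norm p m a" by (simp add: lp_norm_def fin_norm_def)
qed

lemma block_op_block:
  assumes "0 < p"
  shows "block_op p s t M (block n (s n) a) = block n (t n) (\<lambda>i. \<Sum>j<s n. M n i j * a j)"
proof (rule seq_eq_blockI)
  fix n' i
  show "block_op p s t M (block n (s n) a) (prod_encode (n', i)) =
      block n (t n) (\<lambda>i. \<Sum>j<s n. M n i j * a j) (prod_encode (n', i))"
    using block_lp(1)[OF assms, of n "s n" a] by (cases "n' = n") (auto simp: block_op_def)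
qed

lemma sum_powr_le:
  fixes b :: "'i \<Rightarrow> real"
  assumes "finite A" "\<And>i. i \<in> A \<Longrightarrow> 0 \<le> b i" "1 \<le> r"
  shows "(\<Sum>i\<in>A. b i powr r) \<le> (\<Sum>i\<in>A. b i) powr r"
proof -
  define S where "S = (\<Sum>i\<in>A. b i)"
  have S: "0 \<le> S" unfolding S_def using assms by (intro sum_nonneg)
  have split: "c powr r = c powr (r - 1) * c" if "0 \<le> c" for c :: real
    using that by (cases "c = 0") (auto simp: powr_diff)
  have "(\<Sum>i\<in>A. b i powr r) \<le> (\<Sum>i\<in>A. S powr (r - 1) * b i)"
  proof (intro sum_mono)
    fix i assume i: "i \<in> A"
    have "b i \<le> S" unfolding S_def using assms i by (intro member_le_sum) auto
    hence "b i powr (r - 1) * b i \<le> S powr (r - 1) * b i"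
      using assms i by (intro mult_right_mono powr_mono2) auto
    thus "b i powr r \<le> S powr (r - 1) * b i" using split[of "b i"] assms(2)[OF i] by simp
  qed
  also have "\<dots> = S powr r" using split[OF S] by (simp add: S_def sum_distrib_left)
  finally show ?thesis by (simp add: S_def)
qed

text \<open>
  The block norms of a vector of \<open>\<ell>\<^sub>p\<close> form an \<open>\<ell>\<^sub>p\<close>-sequence and only have to be summed in \<open>\<ell>\<^sub>q\<close>, so uniform
  bounds for the blocks suffice when \<open>p \<le> q\<close>.
\<close>

lemma block_op_bounded:
  fixes M :: "nat \<Rightarrow> nat \<Rightarrow> nat \<Rightarrow> 'k::real_normed_field"
  assumes pq: "1 \<le> p" "p \<le> q" and C: "0 \<le> C"
    and M: "\<And>n a. fin_norm q (t n) (\<lambda>i. \<Sum>j<s n. M n i j * a j) \<le> C * fin_norm p (s n) a"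
  shows "block_op p s t M \<in> bounded_ops p q"
proof -
  have p0: "0 < p" "0 < q" using pq by auto
  have main: "block_op p s t M x \<in> lp q" "lp_norm q (block_op p s t M x) \<le> C * lp_norm p x"
    if x: "x \<in> lp p" for x
  proof -
    define y where "y = block_op p s t M x"
    have "(\<Sum>k\<in>F. norm (y k) powr q) \<le> (C * lp_norm p x) powr q" if F: "finite F" for F
    proof -
      define G where "G = prod_decode ` F"
      define g where "g ni = norm (y (prod_encode ni)) powr q" for ni
      have fG: "finite G" using F by (simp add: G_def)
      obtain L where L: "fst ` G \<subseteq> {..<L}" using finite_nat_bounded[of "fst ` G"] fG by auto
      define H where "H = Sigma {..<L} (\<lambda>n. {..<t n})"
      have fH: "finite H" by (simp add: H_def)
      define X where "X n = (\<lambda>j. x (prod_encode (n, j)))" for n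
      have "(\<Sum>k\<in>F. norm (y k) powr q) = (\<Sum>ni\<in>G. g ni)"
        unfolding G_def by (subst sum.reindex[OF inj_prod_decode]) (simp add: g_def)
      also have "\<dots> \<le> (\<Sum>ni\<in>H. g ni)"
      proof -
        have "g ni = 0" if "ni \<in> G - H" for ni
        proof -
          have "fst ni < L" using that L by blast
          hence "\<not> snd ni < t (fst ni)" using that by (cases ni) (auto simp: H_def)
          thus ?thesis using x by (cases ni) (simp add: g_def y_def block_op_def)
        qed
        hence "(\<Sum>ni\<in>G. g ni) = (\<Sum>ni\<in>G \<inter> H. g ni)" using fG by (intro sum.mono_neutral_right) auto
        also have "\<dots> \<le> (\<Sum>ni\<in>H. g ni)" using fH by (intro sum_mono2) (auto simp: g_def)
        finally show ?thesis .
      qed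
      also have "\<dots> = (\<Sum>n<L. \<Sum>i<t n. g (n, i))"
        unfolding H_def by (subst sum.Sigma) auto
      also have "\<dots> = (\<Sum>n<L. fin_norm q (t n) (\<lambda>i. \<Sum>j<s n. M n i j * X n j) powr q)"
        unfolding fin_norm_powr[OF p0(2)]
        by (intro sum.cong refl) (use x in \<open>simp add: g_def y_def block_op_def X_def\<close>)
      also have "\<dots> \<le> (\<Sum>n<L. (C * fin_norm p (s n) (X n)) powr q)"
        using M p0 by (intro sum_mono powr_mono2) auto
      also have "\<dots> = C powr q * (\<Sum>n<L. (fin_norm p (s n) (X n) powr p) powr (q / p))"
        using p0 C by (simp add: powr_mult sum_distrib_left powr_powr)
      also have "\<dots> \<le> C powr q * (\<Sum>n<L. fin_norm p (s n) (X n) powr p) powr (q / p)"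
        using pq by (intro mult_left_mono sum_powr_le) auto
      also have "(\<Sum>n<L. fin_norm p (s n) (X n) powr p) \<le> lp_norm p x powr p"
      proof -
        have "(\<Sum>n<L. fin_norm p (s n) (X n) powr p) = (\<Sum>n<L. \<Sum>j<s n. norm (x (prod_encode (n, j))) powr p)"
          by (simp add: fin_norm_powr[OF p0(1)] X_def)
        also have "\<dots> = (\<Sum>nj\<in>Sigma {..<L} (\<lambda>n. {..<s n}). norm (x (prod_encode nj)) powr p)"
          by (subst sum.Sigma) (auto intro!: sum.cong)
        also have "\<dots> = (\<Sum>k\<in>prod_encode ` Sigma {..<L} (\<lambda>n. {..<s n}). norm (x k) powr p)"
          by (subst sum.reindex[OF inj_prod_encode]) simp
        also have "\<dots> \<le> lp_norm p x powr p" by (intro lp_sum_le[OF x p0(1)]) auto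
        finally show ?thesis .
      qed
      hence "C powr q * (\<Sum>n<L. fin_norm p (s n) (X n) powr p) powr (q / p) \<le>
          C powr q * (lp_norm p x powr p) powr (q / p)"
        using p0 by (intro mult_left_mono powr_mono2) (auto intro: sum_nonneg)
      also have "\<dots> = (C * lp_norm p x) powr q"
        using p0 C by (simp add: powr_powr powr_mult)
      finally show ?thesis .
    qed
    from lp_boundI[OF p0(2) _ this] C
    show "block_op p s t M x \<in> lp q" "lp_norm q (block_op p s t M x) \<le> C * lp_norm p x"
      unfolding y_def by simp_all
  qed
  show ?thesis
  proof (rule bounded_opsI[where C = C])
    fix x y :: "'k sequence" and c assume x: "x \<in> lp p"
    show "block_op p s t M (seq_scale c x) = seq_scale c (block_op p s t M x)"
      by (rule seq_eq_blockI)
        (use x lp_scale(1)[OF x p0(1), of c] in \<open>simp add: block_op_def seq_scale_def sum_distrib_left mult_ac\<close>)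
    assume y: "y \<in> lp p"
    show "block_op p s t M (x + y) = block_op p s t M x + block_op p s t M y"
      by (rule seq_eq_blockI)
        (use x y lp_add(1)[OF x y pq(1)] in \<open>simp add: block_op_def sum.distrib distrib_left\<close>)
  qed (use main in \<open>auto simp: block_op_def\<close>)
qed

lemma unit_seq_block: "i < m \<Longrightarrow> unit_seq (prod_encode (n, i)) = block n m (\<lambda>j. if j = i then 1 else 0)"
  by (rule seq_eq_blockI) (auto simp: unit_seq_apply prod_encode_eq)

section \<open>Copies of \<open>\<ell>\<^sub>2\<close> spanned by signs\<close>

text \<open>
  \<open>rad_vec p n a\<close> is the function \<open>\<Sum>\<^sub>i a\<^sub>i r\<^sub>i\<close> on the \<open>2\<^sup>n\<close>-point probability space, read as a
  vector of \<open>\<ell>\<^sub>p\<close> that is supported on the \<open>n\<close>-th block and normalised so that its \<open>\<ell>\<^sub>p\<close>-norm is the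
  \<open>L\<^sub>p\<close>-norm of the function.
\<close>

definition rad_vec :: "real \<Rightarrow> nat \<Rightarrow> (nat \<Rightarrow> 'k::real_normed_field) \<Rightarrow> 'k sequence" where
  "rad_vec p n a = block n (2 ^ n) (\<lambda>w. of_real ((2 ^ n) powr (- 1 / p)) * (\<Sum>i<n. of_real (rad i w) * a i))"

lemma rad_vec_lp: "0 < p \<Longrightarrow> rad_vec p n a \<in> lp p"
  by (simp add: rad_vec_def block_lp)

lemma rad_vec_norm_powr:
  fixes a :: "nat \<Rightarrow> 'k::real_normed_field"
  assumes "0 < p"
  shows "lp_norm p (rad_vec p n a) powr p = (\<Sum>w<2 ^ n. norm (\<Sum>i<n. of_real (rad i w) * a i) powr p) / 2 ^ n"
proof -
  have "(norm (of_real ((2 ^ n) powr (- 1 / p)) :: 'k)) powr p = (2 ^ n) powr (- 1 / p * p)"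
    unfolding norm_of_real by (simp add: powr_powr)
  also have "\<dots> = 1 / 2 ^ n" using assms by (simp add: powr_minus divide_inverse)
  finally have "(norm (of_real ((2 ^ n) powr (- 1 / p)) :: 'k)) powr p = 1 / 2 ^ n" .
  thus ?thesis using assms
    by (simp add: rad_vec_def block_lp fin_norm_powr norm_mult powr_mult sum_divide_distrib)
qed

lemma rad_vec_sum:
  "rad_vec p n (\<lambda>i. \<Sum>l\<in>A. c l * a l i) = (\<Sum>l\<in>A. seq_scale (c l) (rad_vec p n (a l)))"
proof (rule seq_eq_blockI)
  fix n' w
  have "(\<Sum>i<n. of_real (rad i w) * (\<Sum>l\<in>A. c l * a l i)) =
      (\<Sum>i<n. \<Sum>l\<in>A. c l * (of_real (rad i w) * a l i))"
    by (simp add: sum_distrib_left mult.left_commute)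
  also have "\<dots> = (\<Sum>l\<in>A. \<Sum>i<n. c l * (of_real (rad i w) * a l i))" by (rule sum.swap)
  finally have "z * (\<Sum>i<n. of_real (rad i w) * (\<Sum>l\<in>A. c l * a l i)) =
      (\<Sum>l\<in>A. c l * (z * (\<Sum>i<n. of_real (rad i w) * a l i)))" for z
    by (simp add: sum_distrib_left mult.left_commute)
  thus "rad_vec p n (\<lambda>i. \<Sum>l\<in>A. c l * a l i) (prod_encode (n', w)) =
      (\<Sum>l\<in>A. seq_scale (c l) (rad_vec p n (a l))) (prod_encode (n', w))"
    unfolding rad_vec_def seq_sum_apply seq_scale_def block_apply
    by (cases "n' = n"; cases "w < 2 ^ n"; simp)
qed

lemma sum_of_real_factor:
  "(\<Sum>i\<in>A. of_real (c * r i) * a i) = of_real c * (\<Sum>i\<in>A. of_real (r i) * a i)"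
  for a :: "'i \<Rightarrow> 'k::real_normed_field"
  by (simp add: sum_distrib_left mult.assoc)

lemma rad_vec_norm_le:
  fixes dummy :: "'k::{real_normed_field, euclidean_space}"
  assumes p: "0 < p"
  obtains C where "0 < C"
    "\<And>n (a :: nat \<Rightarrow> 'k). lp_norm p (rad_vec p n a) \<le> C * sqrt (\<Sum>i<n. (norm (a i))\<^sup>2)"
proof -
  obtain C where C: "0 < C" "\<And>n (a :: nat \<Rightarrow> 'k). (\<Sum>w<2 ^ n. norm (\<Sum>i<n. of_real (rad i w) * a i) powr p) \<le>
      C * 2 ^ n * (\<Sum>i<n. (norm (a i))\<^sup>2) powr (p / 2)"
    using Khintchine[OF p] by blast
  show ?thesis
  proof (rule that[of "C powr (1 / p)"])
    fix n and a :: "nat \<Rightarrow> 'k"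
    define S where "S = (\<Sum>i<n. (norm (a i))\<^sup>2)"
    have "lp_norm p (rad_vec p n a) powr p \<le> C * S powr (p / 2)"
      unfolding rad_vec_norm_powr[OF p] S_def using C(2)[of a n] by (simp add: pos_divide_le_eq mult_ac)
    hence "(lp_norm p (rad_vec p n a) powr p) powr (1 / p) \<le> (C * S powr (p / 2)) powr (1 / p)"
      using p by (intro powr_mono2) auto
    moreover have "S \<ge> 0" by (simp add: S_def sum_nonneg)
    ultimately show "lp_norm p (rad_vec p n a) \<le> C powr (1 / p) * sqrt S"
      using p C(1) by (simp add: powr_powr powr_mult powr_half_sqrt)
  qed (use C in simp)
qed

lemma rad_vec_norm_unit:
  assumes "0 < p" "i < n"
  shows "lp_norm p (rad_vec p n (\<lambda>j. if j = i then 1 else 0) :: 'k::real_normed_field sequence) = 1"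
proof -
  have "(\<Sum>j<n. of_real (rad j w) * (if j = i then 1 else 0)) = (of_real (rad i w) :: 'k)" for w
    using assms(2) by (simp add: if_distrib cong: if_cong)
  hence "lp_norm p (rad_vec p n (\<lambda>j. if j = i then 1 else 0) :: 'k sequence) powr p = 1"
    unfolding rad_vec_norm_powr[OF assms(1)] by simp
  hence "(lp_norm p (rad_vec p n (\<lambda>j. if j = i then 1 else 0) :: 'k sequence) powr p) powr (1 / p) = 1" by simp
  thus ?thesis using assms(1) by (simp add: powr_powr)
qed

text \<open>
  This is the average of \<open>t\<^sup>p \<le> 1 + t\<^sup>q\<close> over the values \<open>t\<close> of a function of \<open>L\<^sub>q\<close>-norm \<open>1\<close>. Jensen's inequality
  would give the constant \<open>1\<close>, but any constant serves to bound an operator from below.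
\<close>

lemma rad_vec_norm_mono:
  fixes a :: "nat \<Rightarrow> 'k::real_normed_field"
  assumes p: "1 \<le> p" and pq: "p \<le> q"
  shows "lp_norm p (rad_vec p n a) \<le> 2 * lp_norm q (rad_vec q n a)"
proof -
  have p0: "0 < p" "0 < q" using assms by auto
  define b where "b w = norm (\<Sum>i<n. of_real (rad i w) * a i)" for w
  define M where "M = lp_norm q (rad_vec q n a)"
  have Mq: "M powr q = (\<Sum>w<2 ^ n. b w powr q) / 2 ^ n"
    unfolding M_def rad_vec_norm_powr[OF p0(2)] b_def ..
  have b_le: "b w powr p \<le> M powr p * (1 + b w powr q / M powr q)" if w: "w < 2 ^ n" for w
  proof (cases "M = 0")
    case True
    hence "(\<Sum>w<2 ^ n. b w powr q) = 0" using Mq by simp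
    hence "b w powr q = 0" using w by (simp add: sum_nonneg_eq_0_iff)
    thus ?thesis by simp
  next
    case False
    hence M: "M > 0" using lp_norm_nonneg[of q "rad_vec q n a"] unfolding M_def by linarith
    have "t powr p \<le> 1 + t powr q" if "0 \<le> t" for t :: real
    proof (cases "t \<le> 1")
      case True
      hence "t powr p \<le> 1 powr p" using that p0 by (intro powr_mono2) auto
      thus ?thesis by (simp add: add_increasing2)
    next
      case False
      hence "t powr p \<le> t powr q" using pq by (intro powr_mono) auto
      thus ?thesis by simp
    qed
    from this[of "b w / M"] have "b w powr p / M powr p \<le> 1 + b w powr q / M powr q"
      using M by (simp add: b_def powr_divide)
    thus ?thesis using M by (simp add: pos_divide_le_eq mult.commute)
  qed
  have "lp_norm p (rad_vec p n a) powr p = (\<Sum>w<2 ^ n. b w powr p) / 2 ^ n"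
    unfolding rad_vec_norm_powr[OF p0(1)] b_def ..
  also have "\<dots> \<le> (\<Sum>w<2 ^ n. M powr p * (1 + b w powr q / M powr q)) / 2 ^ n"
    using b_le by (intro divide_right_mono sum_mono) auto
  also have "\<dots> = M powr p * ((2 ^ n + (\<Sum>w<2 ^ n. b w powr q) / M powr q) / 2 ^ n)"
    by (simp add: sum.distrib flip: sum_distrib_left sum_divide_distrib)
  also have "(\<Sum>w<2 ^ n. b w powr q) = M powr q * 2 ^ n" using Mq by simp
  also have "M powr p * ((2 ^ n + M powr q * 2 ^ n / M powr q) / 2 ^ n) = M powr p * (1 + M powr q / M powr q)"
    by (simp add: add_divide_distrib)
  also have "\<dots> \<le> M powr p * 2" by (intro mult_left_mono) auto
  also have "\<dots> \<le> M powr p * 2 powr p" using p powr_mono[of 1 p 2] by (intro mult_left_mono) auto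
  also have "\<dots> = (2 * M) powr p" by (simp add: powr_mult M_def)
  finally show ?thesis using p0 powr_less_mono2[of p "2 * M" "lp_norm p (rad_vec p n a)"]
    unfolding M_def by (force simp: not_le)
qed

text \<open>
  On every block these are the synthesis and the analysis operator of the Rademacher system; the powers
  of \<open>2\<^sup>n\<close> are those that turn \<open>\<ell>\<close>-norms into \<open>L\<close>-norms on the probability space.
\<close>

definition rad_embed :: "real \<Rightarrow> 'k::real_normed_field operator" where
  "rad_embed q = block_op 2 (\<lambda>n. n) (\<lambda>n. 2 ^ n) (\<lambda>n w i. of_real ((2 ^ n) powr (- 1 / q) * rad i w))"

definition rad_coeff :: "real \<Rightarrow> 'k::real_normed_field operator" where
  "rad_coeff p = block_op p (\<lambda>n. 2 ^ n) (\<lambda>n. n) (\<lambda>n i w. of_real ((2 ^ n) powr (1 / p - 1) * rad i w))"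

lemma rad_embed_block: "rad_embed q (block n n a) = rad_vec q n a"
  unfolding rad_embed_def block_op_block[of 2 "\<lambda>n. n", simplified] rad_vec_def
  unfolding sum_of_real_factor ..

lemma rad_coeff_rad_vec:
  fixes a :: "nat \<Rightarrow> 'k::real_normed_field"
  assumes "0 < p"
  shows "rad_coeff p (rad_vec p n a) = block n n a"
proof -
  define c where "c = (2 ^ n) powr (1 / p - 1) * (2 ^ n) powr (- 1 / p :: real)"
  have "c = (2 ^ n) powr ((1 / p - 1) + - 1 / p)" unfolding c_def powr_add ..
  hence c: "c * 2 ^ n = 1" by (simp add: powr_minus)
  have "(\<Sum>w<2 ^ n. of_real ((2 ^ n) powr (1 / p - 1) * rad i w) *
      (of_real ((2 ^ n) powr (- 1 / p)) * (\<Sum>l<n. of_real (rad l w) * a l))) = a i" if i: "i < n" for i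
  proof -
    have "(\<Sum>w<2 ^ n. of_real ((2 ^ n) powr (1 / p - 1) * rad i w) *
        (of_real ((2 ^ n) powr (- 1 / p)) * (\<Sum>l<n. of_real (rad l w) * a l))) =
        (\<Sum>w<2 ^ n. \<Sum>l<n. of_real c * (of_real (rad i w * rad l w) * a l))"
    proof (intro sum.cong refl)
      fix w
      have "of_real ((2 ^ n) powr (1 / p - 1) * rad i w) * (of_real ((2 ^ n) powr (- 1 / p)) * z) =
          of_real c * (of_real (rad i w) * z)" for z :: 'k
        by (simp add: c_def mult_ac)
      thus "of_real ((2 ^ n) powr (1 / p - 1) * rad i w) *
          (of_real ((2 ^ n) powr (- 1 / p)) * (\<Sum>l<n. of_real (rad l w) * a l)) =
          (\<Sum>l<n. of_real c * (of_real (rad i w * rad l w) * a l))"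
        unfolding sum_distrib_left[symmetric] of_real_mult[of "rad i w"] mult.assoc by (simp only:)
    qed
    also have "\<dots> = (\<Sum>l<n. of_real c * (of_real (\<Sum>w<2 ^ n. rad i w * rad l w) * a l))"
      by (subst sum.swap) (simp add: sum_distrib_left sum_distrib_right)
    also have "\<dots> = (\<Sum>l<n. if l = i then of_real (c * 2 ^ n) * a l else 0)"
      using i by (intro sum.cong refl) (auto simp: rad_orthogonal)
    also have "\<dots> = a i" using i c by simp
    finally show ?thesis .
  qed
  thus ?thesis
    unfolding rad_coeff_def rad_vec_def block_op_block[OF assms, of "\<lambda>n. 2 ^ n"]
    by (intro seq_eq_blockI) auto
qed

lemma rad_embed_bounded:
  assumes q: "2 \<le> q"
  shows "(rad_embed q :: 'k::{real_normed_field, euclidean_space} operator) \<in> bounded_ops 2 q"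
proof -
  have q0: "0 < q" using q by simp
  obtain C where C: "0 < C" "\<And>n (a :: nat \<Rightarrow> 'k). lp_norm q (rad_vec q n a) \<le> C * sqrt (\<Sum>i<n. (norm (a i))\<^sup>2)"
    using rad_vec_norm_le[OF q0] by blast
  show ?thesis unfolding rad_embed_def
  proof (rule block_op_bounded[where C = C])
    fix n and a :: "nat \<Rightarrow> 'k"
    have "fin_norm q (2 ^ n) (\<lambda>w. \<Sum>i<n. of_real ((2 ^ n) powr (- 1 / q) * rad i w) * a i) = lp_norm q (rad_vec q n a)"
      unfolding sum_of_real_factor rad_vec_def using q0 by (simp only: block_lp)
    thus "fin_norm q (2 ^ n) (\<lambda>w. \<Sum>i<n. of_real ((2 ^ n) powr (- 1 / q) * rad i w) * a i) \<le> C * fin_norm 2 n a"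
      using C(2)[of n a] by (simp add: fin_norm_two)
  qed (use C q in auto)
qed

text \<open>Khintchine's inequality for the conjugate exponent, dualised by pairing the coefficients with themselves.\<close>

lemma rad_coeff_bounded:
  assumes p: "1 < p" "p \<le> 2"
  shows "(rad_coeff p :: 'k::{real_normed_field, euclidean_space} operator) \<in> bounded_ops p 2"
proof -
  define p' where "p' = p / (p - 1)"
  have p': "1 < p'" "1 / p + 1 / p' = 1" using p by (auto simp: p'_def field_simps)
  have p0: "0 < p'" "0 < p" using p p' by auto
  obtain C where C: "0 < C" "\<And>n (a :: nat \<Rightarrow> 'k). lp_norm p' (rad_vec p' n a) \<le> C * sqrt (\<Sum>i<n. (norm (a i))\<^sup>2)"
    using rad_vec_norm_le[OF p0(1)] by blast
  show ?thesis unfolding rad_coeff_def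
  proof (rule block_op_bounded[where C = C])
    fix n and x :: "nat \<Rightarrow> 'k"
    define c where "c = (2 ^ n) powr (1 / p - 1 :: real)"
    have c: "c = (2 ^ n) powr (- 1 / p')" "c \<ge> 0" 
    proof -
      have "1 / p - 1 = - 1 / p'" using p'(2) by simp
      thus "c = (2 ^ n) powr (- 1 / p')" "c \<ge> 0" unfolding c_def by simp_all
    qed
    define y where "y i = (\<Sum>w<2 ^ n. of_real (c * rad i w) * x w)" for i
    define S where "S w = of_real c * (\<Sum>i<n. of_real (rad i w) * y i)" for w
    have "(\<Sum>i<n. (norm (y i))\<^sup>2) = (\<Sum>i<n. \<Sum>w<2 ^ n. x w \<bullet> (of_real (c * rad i w) * y i))"
    proof (intro sum.cong refl)
      fix i
      have "(norm (y i))\<^sup>2 = (\<Sum>w<2 ^ n. of_real (c * rad i w) * x w) \<bullet> y i"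
        by (simp add: power2_norm_eq_inner y_def)
      also have "\<dots> = (\<Sum>w<2 ^ n. x w \<bullet> (of_real (c * rad i w) * y i))"
        unfolding inner_sum_left scaleR_conv_of_real[symmetric] by simp
      finally show "(norm (y i))\<^sup>2 = \<dots>" .
    qed
    also have "\<dots> = (\<Sum>w<2 ^ n. x w \<bullet> S w)"
      by (subst sum.swap) (simp add: S_def inner_sum_right sum_distrib_left mult_ac)
    also have "\<dots> \<le> (\<Sum>w<2 ^ n. norm (x w) * norm (S w))"
      by (intro sum_mono norm_cauchy_schwarz)
    also have "\<dots> \<le> (\<Sum>w<2 ^ n. norm (x w) powr p) powr (1 / p) * (\<Sum>w<2 ^ n. norm (S w) powr p') powr (1 / p')"
      using p p' by (intro Holder_sum) auto
    also have "\<dots> = fin_norm p (2 ^ n) x * fin_norm p' (2 ^ n) S" by (simp add: fin_norm_def)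
    also have "fin_norm p' (2 ^ n) S = lp_norm p' (rad_vec p' n y)"
      unfolding rad_vec_def block_lp(2)[OF p0(1)] c(1)[symmetric] S_def[abs_def] ..
    also have "\<dots> \<le> C * fin_norm 2 n y" using C(2)[of n y] by (simp add: fin_norm_two)
    finally have sq: "(fin_norm 2 n y)\<^sup>2 \<le> fin_norm p (2 ^ n) x * (C * fin_norm 2 n y)"
      by (simp add: fin_norm_two sum_nonneg mult_left_mono)
    have "fin_norm 2 n y \<le> C * fin_norm p (2 ^ n) x"
    proof (cases "fin_norm 2 n y = 0")
      case True thus ?thesis using C by simp
    next
      case False
      hence "fin_norm 2 n y > 0" using fin_norm_nonneg[of 2 n y] by linarith
      thus ?thesis using sq by (simp add: power2_eq_square mult_ac)
    qed
    thus "fin_norm 2 n (\<lambda>i. \<Sum>w<2 ^ n. of_real ((2 ^ n) powr (1 / p - 1) * rad i w) * x w) \<le> C * fin_norm p (2 ^ n) x"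
      unfolding y_def[abs_def] c_def .
  qed (use C p in auto)
qed

lemma rad_vec_cong: "(\<And>i. i < n \<Longrightarrow> a i = b i) \<Longrightarrow> rad_vec p n a = rad_vec p n b"
  by (simp add: rad_vec_def)

definition rad_unit :: "real \<Rightarrow> nat \<Rightarrow> nat \<Rightarrow> 'k::real_normed_field sequence" where
  "rad_unit p n i = rad_vec p n (\<lambda>j. if j = i then 1 else 0)"

lemma sum_rad_unit: "(\<Sum>i<n. seq_scale (a i) (rad_unit p n i)) = rad_vec p n a"
proof -
  have "(\<Sum>i<n. seq_scale (a i) (rad_unit p n i)) = rad_vec p n (\<lambda>j. \<Sum>i<n. a i * (if j = i then 1 else 0))"
    unfolding rad_unit_def rad_vec_sum ..
  also have "\<dots> = rad_vec p n a" by (rule rad_vec_cong) (simp add: if_distrib cong: if_cong)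
  finally show ?thesis .
qed

lemma rad_coeff_rad_unit:
  assumes "0 < p" "i < n" shows "rad_coeff p (rad_unit p n i) = unit_seq (prod_encode (n, i))"
  unfolding rad_unit_def rad_coeff_rad_vec[OF assms(1)] unit_seq_block[OF assms(2)] ..

lemma dim_ge_range_rad_vec:
  assumes "0 < p"
  shows "dim_ge n (range (rad_vec p n :: _ \<Rightarrow> 'k::real_normed_field sequence))"
proof -
  define x where "x i = (rad_unit p n i :: 'k sequence)" for i
  have inj: "inj_on x {..<n}"
  proof (rule inj_onI)
    fix i j assume "i \<in> {..<n}" "j \<in> {..<n}" "x i = x j"
    hence "(unit_seq (prod_encode (n, i)) :: 'k sequence) = unit_seq (prod_encode (n, j))"
      using rad_coeff_rad_unit[OF assms, of i n, where 'a = 'k] rad_coeff_rad_unit[OF assms, of j n, where 'a = 'k]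
      by (simp add: x_def)
    from fun_cong[OF this, of "prod_encode (n, i)"] show "i = j"
      by (simp add: unit_seq_apply prod_encode_eq split: if_splits)
  qed
  have "seq.independent (x ` {..<n})"
  proof
    assume "seq.dependent (x ` {..<n})"
    then obtain u where u: "(\<Sum>v\<in>x ` {..<n}. seq_scale (u v) v) = 0" "\<exists>v\<in>x ` {..<n}. u v \<noteq> 0"
      using seq.dependent_finite[of "x ` {..<n}"] by auto
    have "rad_vec p n (\<lambda>i. u (x i)) = 0"
      using u(1) unfolding sum.reindex[OF inj] o_def by (simp add: x_def sum_rad_unit)
    hence eq: "block n n (\<lambda>i. u (x i)) = rad_coeff p 0"
      using rad_coeff_rad_vec[OF assms, of n "\<lambda>i. u (x i)"] by simp
    have "rad_coeff p (0 :: 'k sequence) = 0"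
      by (rule seq_eq_blockI) (simp add: rad_coeff_def block_op_def)
    hence eq0: "block n n (\<lambda>i. u (x i)) = 0" using eq by simp
    have "u (x i) = 0" if "i < n" for i
      using that fun_cong[OF eq0, of "prod_encode (n, i)"] by simp
    thus False using u(2) by auto
  qed
  moreover have "seq.subspace (range (rad_vec p n :: _ \<Rightarrow> 'k sequence))"
  proof -
    have "range (rad_vec p n :: _ \<Rightarrow> 'k sequence) = seq.span (x ` {..<n})"
    proof (intro equalityI subsetI)
      fix y :: "'k sequence" assume "y \<in> range (rad_vec p n)"
      then obtain a where "y = rad_vec p n a" by blast
      hence y: "y = (\<Sum>i<n. seq_scale (a i) (x i))" by (simp add: x_def sum_rad_unit)
      show "y \<in> seq.span (x ` {..<n})"
        unfolding y by (intro seq.span_sum seq.span_scale seq.span_base imageI)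
    next
      fix y :: "'k sequence" assume "y \<in> seq.span (x ` {..<n})"
      then obtain u where "y = (\<Sum>v\<in>x ` {..<n}. seq_scale (u v) v)"
        using seq.span_finite[of "x ` {..<n}"] by auto
      hence "y = rad_vec p n (\<lambda>i. u (x i))"
        unfolding sum.reindex[OF inj] o_def by (simp add: x_def sum_rad_unit)
      thus "y \<in> range (rad_vec p n)" by blast
    qed
    thus ?thesis by simp
  qed
  moreover have "x ` {..<n} \<subseteq> range (rad_vec p n)" by (auto simp: x_def rad_unit_def)
  ultimately show ?thesis unfolding dim_ge_def using card_image[OF inj] by (intro conjI exI[of _ "x ` {..<n}"]) auto
qed

text \<open>
  On the \<open>n\<close>-dimensional space spanned by the signs of block \<open>n\<close>, this composition only changes the
  normalisation from \<open>L\<^sub>p\<close> to \<open>L\<^sub>q\<close>, which decreases the norm by a factor of at most \<open>2\<close>.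
\<close>

lemma rad_projection_not_fss:
  fixes V :: "'k::{real_normed_field, euclidean_space} operator"
  assumes p: "1 < p" "p < 2" and q: "2 < q" and V: "V = rad_embed q \<circ> rad_coeff p"
  shows "V \<notin> fss_ops p q"
proof
  assume fss: "V \<in> fss_ops p q"
  have p0: "0 < p" using p by simp
  obtain n where n: "0 < n"
    "\<And>E. dim_ge n E \<Longrightarrow> E \<subseteq> lp p \<Longrightarrow> \<exists>x\<in>E. lp_norm p x = 1 \<and> lp_norm q (V x) < 1/2"
    using fss_opsE[OF p0 fss, of "1/2"] by auto
  have "range (rad_vec p n :: _ \<Rightarrow> 'k sequence) \<subseteq> lp p" using rad_vec_lp[OF p0] by auto
  then obtain a where a: "lp_norm p (rad_vec p n a) = 1" "lp_norm q (V (rad_vec p n a)) < 1/2"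
    using n(2)[OF dim_ge_range_rad_vec[OF p0]] by blast
  have "V (rad_vec p n a) = rad_vec q n a"
    by (simp add: V rad_coeff_rad_vec[OF p0] rad_embed_block)
  thus False using a rad_vec_norm_mono[of p q n a] p q by simp
qed

section \<open>Operators that are small on \<open>\<ell>\<^sub>2\<close>-bounded families\<close>

text \<open>
  An \<open>\<ell>\<^sub>2\<close>-bounded family is the image of an orthonormal family under an operator from \<open>\<ell>\<^sub>2\<close> to \<open>\<ell>\<^sub>p\<close> of norm at
  most \<open>C\<close>. An operator in the class below is large on boundedly many members of such a family only.
  The bound does not depend on the size of the family, and this is what makes the class a closed ideal. It
  contains the formal identity but not every operator that factors through \<open>\<ell>\<^sub>2\<close>.
\<close>

definition l2_bounded :: "real \<Rightarrow> real \<Rightarrow> nat set \<Rightarrow> (nat \<Rightarrow> 'k::real_normed_field sequence) \<Rightarrow> bool" where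
  "l2_bounded p C I x \<longleftrightarrow> finite I \<and> (\<forall>i\<in>I. x i \<in> lp p) \<and>
    (\<forall>a. lp_norm p (\<Sum>i\<in>I. seq_scale (a i) (x i)) \<le> C * sqrt (\<Sum>i\<in>I. (norm (a i))\<^sup>2))"

definition l2_null_ops :: "real \<Rightarrow> real \<Rightarrow> 'k::real_normed_field operator set" where
  "l2_null_ops p q = {T \<in> bounded_ops p q. \<forall>C. \<forall>e>0. \<exists>K. \<forall>I x.
     l2_bounded p C I x \<and> (\<forall>i\<in>I. e \<le> lp_norm q (T (x i))) \<longrightarrow> card I \<le> K}"

lemma l2_null_opsI:
  fixes T :: "'k::real_normed_field operator"
  assumes "T \<in> bounded_ops p q"
    "\<And>C e. 0 < e \<Longrightarrow> \<exists>K. \<forall>I x. l2_bounded p C I (x :: nat \<Rightarrow> 'k sequence) \<and>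
      (\<forall>i\<in>I. e \<le> lp_norm q (T (x i))) \<longrightarrow> card I \<le> K"
  shows "T \<in> l2_null_ops p q"
  unfolding l2_null_ops_def using assms by simp

lemma l2_null_opsE:
  fixes T :: "'k::real_normed_field operator"
  assumes "T \<in> l2_null_ops p q" "0 < e"
  obtains K where "\<And>I x. l2_bounded p C I (x :: nat \<Rightarrow> 'k sequence) \<Longrightarrow>
    (\<And>i. i \<in> I \<Longrightarrow> e \<le> lp_norm q (T (x i))) \<Longrightarrow> card I \<le> K"
proof -
  have "\<exists>K. \<forall>I x. l2_bounded p C I (x :: nat \<Rightarrow> 'k sequence) \<and>
      (\<forall>i\<in>I. e \<le> lp_norm q (T (x i))) \<longrightarrow> card I \<le> K"
    using assms by (simp add: l2_null_ops_def)
  then obtain K where K: "\<forall>I x. l2_bounded p C I (x :: nat \<Rightarrow> 'k sequence) \<and>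
      (\<forall>i\<in>I. e \<le> lp_norm q (T (x i))) \<longrightarrow> card I \<le> K" ..
  show ?thesis by (rule that[of K]) (use K in blast)
qed

lemma l2_boundedD:
  "l2_bounded p C I x \<Longrightarrow> lp_norm p (\<Sum>i\<in>I. seq_scale (a i) (x i)) \<le> C * sqrt (\<Sum>i\<in>I. (norm (a i))\<^sup>2)"
  by (simp add: l2_bounded_def)

lemma l2_bounded_subset:
  fixes x :: "nat \<Rightarrow> 'k::real_normed_field sequence"
  assumes "l2_bounded p C I x" "J \<subseteq> I"
  shows "l2_bounded p C J x"
  unfolding l2_bounded_def
proof (intro conjI allI)
  have fin: "finite I" using assms(1) by (simp add: l2_bounded_def)
  show "finite J" using fin assms(2) finite_subset by blast
  show "\<forall>i\<in>J. x i \<in> lp p" using assms by (auto simp: l2_bounded_def)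
  fix a :: "nat \<Rightarrow> 'k"
  define b where "b i = (if i \<in> J then a i else 0)" for i
  have "(\<Sum>i\<in>I. seq_scale (b i) (x i)) = (\<Sum>i\<in>J. seq_scale (b i) (x i))"
    using fin assms(2) by (intro sum.mono_neutral_right) (auto simp: b_def)
  hence 1: "(\<Sum>i\<in>I. seq_scale (b i) (x i)) = (\<Sum>i\<in>J. seq_scale (a i) (x i))"
    by (simp add: b_def)
  have "(\<Sum>i\<in>I. (norm (b i))\<^sup>2) = (\<Sum>i\<in>J. (norm (b i))\<^sup>2)"
    using fin assms(2) by (intro sum.mono_neutral_right) (auto simp: b_def)
  hence 2: "(\<Sum>i\<in>I. (norm (b i))\<^sup>2) = (\<Sum>i\<in>J. (norm (a i))\<^sup>2)" by (simp add: b_def)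
  show "lp_norm p (\<Sum>i\<in>J. seq_scale (a i) (x i)) \<le> C * sqrt (\<Sum>i\<in>J. (norm (a i))\<^sup>2)"
    using assms(1) unfolding l2_bounded_def 1[symmetric] 2[symmetric] by blast
qed

lemma l2_bounded_norm_le:
  fixes x :: "nat \<Rightarrow> 'k::real_normed_field sequence"
  assumes "l2_bounded p C I x" "i \<in> I"
  shows "lp_norm p (x i) \<le> C"
proof -
  have "l2_bounded p C {i} x" using l2_bounded_subset assms by blast
  hence "lp_norm p (\<Sum>j\<in>{i}. seq_scale 1 (x j)) \<le> C * sqrt (\<Sum>j\<in>{i}. (norm (1 :: 'k))\<^sup>2)"
    unfolding l2_bounded_def by (elim conjE) (erule allE[of _ "\<lambda>_. 1"])
  thus ?thesis by simp
qed

lemma closed_op_ideal_l2_null: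
  assumes pq: "1 \<le> p" "1 \<le> q"
  shows "closed_op_ideal p q (l2_null_ops p q :: 'k::real_normed_field operator set)"
proof (rule closed_op_idealI[OF pq])
  have pq0: "0 < p" "0 < q" using pq by auto
  show sub: "l2_null_ops p q \<subseteq> (bounded_ops p q :: 'k operator set)" by (auto simp: l2_null_ops_def)
  show "(0 :: 'k operator) \<in> l2_null_ops p q"
    by (rule l2_null_opsI[OF bounded_ops_zero_op]) (auto intro!: exI[of _ 0] simp: l2_bounded_def)
  fix S T :: "'k operator" assume S: "S \<in> l2_null_ops p q" and T: "T \<in> l2_null_ops p q"
  show "S + T \<in> l2_null_ops p q"
  proof (rule l2_null_opsI)
    show "S + T \<in> bounded_ops p q" using S T sub pq by (intro bounded_ops_add) auto
    fix C e :: real assume e: "0 < e"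
    have e2: "0 < e/2" using e by simp
    obtain K where K: "\<And>I x. l2_bounded p C I (x :: nat \<Rightarrow> 'k sequence) \<Longrightarrow>
        (\<And>i. i \<in> I \<Longrightarrow> e/2 \<le> lp_norm q (S (x i))) \<Longrightarrow> card I \<le> K"
      using l2_null_opsE[OF S e2] by blast
    obtain L where L: "\<And>I x. l2_bounded p C I (x :: nat \<Rightarrow> 'k sequence) \<Longrightarrow>
        (\<And>i. i \<in> I \<Longrightarrow> e/2 \<le> lp_norm q (T (x i))) \<Longrightarrow> card I \<le> L"
      using l2_null_opsE[OF T e2] by blast
    have "card I \<le> K + L"
      if x: "l2_bounded p C I x" "\<And>i. i \<in> I \<Longrightarrow> e \<le> lp_norm q ((S + T) (x i))" for I and x :: "nat \<Rightarrow> 'k sequence"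
    proof -
      define IS where "IS = {i \<in> I. e/2 \<le> lp_norm q (S (x i))}"
      define IT where "IT = {i \<in> I. e/2 \<le> lp_norm q (T (x i))}"
      have fin: "finite I" using x(1) by (simp add: l2_bounded_def)
      have "I \<subseteq> IS \<union> IT"
      proof
        fix i assume i: "i \<in> I"
        have "e \<le> lp_norm q (S (x i)) + lp_norm q (T (x i))"
          using x(2)[OF i] lp_add(2)[OF bounded_ops_in_lp[OF subsetD[OF sub S]] bounded_ops_in_lp[OF subsetD[OF sub T]] pq(2), of "x i" "x i"]
          by simp
        thus "i \<in> IS \<union> IT" using i by (auto simp: IS_def IT_def)
      qed
      hence "card I \<le> card (IS \<union> IT)" using fin by (intro card_mono) (auto simp: IS_def IT_def)
      also have "\<dots> \<le> card IS + card IT" by (rule card_Un_le)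
      also have "card IS \<le> K" using l2_bounded_subset[OF x(1), of IS] by (intro K[of IS x]) (auto simp: IS_def)
      also have "card IT \<le> L" using l2_bounded_subset[OF x(1), of IT] by (intro L[of IT x]) (auto simp: IT_def)
      finally show ?thesis by simp
    qed
    thus "\<exists>K. \<forall>I x. l2_bounded p C I (x :: nat \<Rightarrow> 'k sequence) \<and>
        (\<forall>i\<in>I. e \<le> lp_norm q ((S + T) (x i))) \<longrightarrow> card I \<le> K" by blast
  qed
next
  fix A T B :: "'k operator"
  assume A: "A \<in> bounded_ops q q" and T: "T \<in> l2_null_ops p q" and B: "B \<in> bounded_ops p p"
  have pq0: "0 < p" "0 < q" using pq by auto
  have Tb: "T \<in> bounded_ops p q" using T by (simp add: l2_null_ops_def)
  show "A \<circ> T \<circ> B \<in> l2_null_ops p q"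
  proof (rule l2_null_opsI)
    show "A \<circ> T \<circ> B \<in> bounded_ops p q"
      using A B Tb pq0 by (intro bounded_ops_comp[of B p p _ q] bounded_ops_comp[of T p q A q]) auto
    fix C e :: real assume e: "0 < e"
    obtain a where a: "0 < a" "\<And>y. y \<in> lp q \<Longrightarrow> lp_norm q (A y) \<le> a * lp_norm q y"
      using bounded_ops_boundE[OF A] by blast
    obtain b where b: "0 < b" "\<And>x. x \<in> lp p \<Longrightarrow> lp_norm p (B x) \<le> b * lp_norm p x"
      using bounded_ops_boundE[OF B] by blast
    note ab = a(1) b(1) and Aa = a(2)
    have "0 < e / a" using e ab by simp
    then obtain K where K: "\<And>I x. l2_bounded p (b * C) I (x :: nat \<Rightarrow> 'k sequence) \<Longrightarrow>
        (\<And>i. i \<in> I \<Longrightarrow> e / a \<le> lp_norm q (T (x i))) \<Longrightarrow> card I \<le> K"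
      using l2_null_opsE[OF T] by blast
    have "card I \<le> K"
      if x: "l2_bounded p C I x" "\<And>i. i \<in> I \<Longrightarrow> e \<le> lp_norm q ((A \<circ> T \<circ> B) (x i))" for I and x :: "nat \<Rightarrow> 'k sequence"
    proof (rule K[of I "\<lambda>i. B (x i)"])
      have xp: "\<And>i. i \<in> I \<Longrightarrow> x i \<in> lp p" and fin: "finite I" using x(1) by (auto simp: l2_bounded_def)
      show "l2_bounded p (b * C) I (\<lambda>i. B (x i))"
        unfolding l2_bounded_def
      proof (intro conjI allI ballI)
        fix c :: "nat \<Rightarrow> 'k"
        have m: "(\<Sum>i\<in>I. seq_scale (c i) (x i)) \<in> lp p" using xp pq0 pq by (intro lp_sum_closed lp_scale) auto
        have "lp_norm p (\<Sum>i\<in>I. seq_scale (c i) (B (x i))) = lp_norm p (B (\<Sum>i\<in>I. seq_scale (c i) (x i)))"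
          using bounded_ops_sum[OF B _ pq(1), of I x c] xp by simp
        also have "\<dots> \<le> b * lp_norm p (\<Sum>i\<in>I. seq_scale (c i) (x i))"
          by (rule b(2)[OF m])
        also have "\<dots> \<le> b * (C * sqrt (\<Sum>i\<in>I. (norm (c i))\<^sup>2))"
          using x(1) ab unfolding l2_bounded_def by (intro mult_left_mono) auto
        finally show "lp_norm p (\<Sum>i\<in>I. seq_scale (c i) (B (x i))) \<le> b * C * sqrt (\<Sum>i\<in>I. (norm (c i))\<^sup>2)"
          by (simp add: mult.assoc)
      qed (use fin bounded_ops_in_lp[OF B] in auto)
      fix i assume "i \<in> I"
      hence "e \<le> a * lp_norm q (T (B (x i)))"
        using x(2)[of i] Aa[OF bounded_ops_in_lp[OF Tb, of "B (x i)"]] by simp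
      thus "e / a \<le> lp_norm q (T (B (x i)))" using ab by (simp add: pos_divide_le_eq mult.commute)
    qed
    thus "\<exists>K. \<forall>I x. l2_bounded p C I (x :: nat \<Rightarrow> 'k sequence) \<and>
        (\<forall>i\<in>I. e \<le> lp_norm q ((A \<circ> T \<circ> B) (x i))) \<longrightarrow> card I \<le> K" by blast
  qed
next
  fix T :: "'k operator" assume T: "T \<in> bounded_ops p q"
    and approx: "\<And>e. 0 < e \<Longrightarrow> \<exists>S\<in>l2_null_ops p q. \<forall>x\<in>lp p. lp_norm q (T x - S x) \<le> e * lp_norm p x"
  show "T \<in> l2_null_ops p q"
  proof (rule l2_null_opsI[OF T])
    fix C e :: real assume e: "0 < e"
    define d where "d = e / (2 * (\<bar>C\<bar> + 1))"
    have d: "d > 0" "d * (\<bar>C\<bar> + 1) = e/2" using e by (auto simp: d_def field_simps)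
    obtain S where S: "S \<in> l2_null_ops p q" "\<And>x. x \<in> lp p \<Longrightarrow> lp_norm q (T x - S x) \<le> d * lp_norm p x"
      using approx[OF d(1)] by blast
    have Sb: "S \<in> bounded_ops p q" using S by (simp add: l2_null_ops_def)
    have e2: "0 < e/2" using e by simp
    obtain K where K: "\<And>I x. l2_bounded p C I (x :: nat \<Rightarrow> 'k sequence) \<Longrightarrow>
        (\<And>i. i \<in> I \<Longrightarrow> e/2 \<le> lp_norm q (S (x i))) \<Longrightarrow> card I \<le> K"
      using l2_null_opsE[OF S(1) e2] by blast
    have "card I \<le> K"
      if x: "l2_bounded p C I x" "\<And>i. i \<in> I \<Longrightarrow> e \<le> lp_norm q (T (x i))" for I and x :: "nat \<Rightarrow> 'k sequence"
    proof (rule K[OF x(1)])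
      fix i assume i: "i \<in> I"
      have xp: "x i \<in> lp p" using x(1) i by (simp add: l2_bounded_def)
      have "lp_norm q (T (x i)) \<le> lp_norm q (T (x i) - S (x i)) + lp_norm q (S (x i))"
        by (rule lp_norm_le_diff[OF bounded_ops_in_lp[OF T] bounded_ops_in_lp[OF Sb] pq(2)])
      also have "lp_norm q (T (x i) - S (x i)) \<le> d * lp_norm p (x i)" by (rule S(2)[OF xp])
      also have "d * lp_norm p (x i) \<le> d * (\<bar>C\<bar> + 1)"
        using l2_bounded_norm_le[OF x(1) i] d by (intro mult_left_mono) auto
      finally show "e/2 \<le> lp_norm q (S (x i))" using x(2)[OF i] d by simp
    qed
    thus "\<exists>K. \<forall>I x. l2_bounded p C I (x :: nat \<Rightarrow> 'k sequence) \<and>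
        (\<forall>i\<in>I. e \<le> lp_norm q (T (x i))) \<longrightarrow> card I \<le> K" by blast
  qed
qed

text \<open>
  The \<open>k\<close>-th coordinates of an \<open>\<ell>\<^sub>2\<close>-bounded family are square summable with a uniform bound, so a
  given coordinate is large for boundedly many members only.
\<close>

lemma l2_bounded_coord_large_card:
  fixes x :: "nat \<Rightarrow> 'k::real_normed_field sequence"
  assumes p: "1 \<le> p" and x: "l2_bounded p C J x" and d: "0 < d" and large: "\<And>i. i \<in> J \<Longrightarrow> d \<le> norm (x i k)"
  shows "real (card J) \<le> (C / d)\<^sup>2"
proof (cases "card J = 0")
  case False
  have lp: "\<And>i. i \<in> J \<Longrightarrow> x i \<in> lp p" using x by (simp add: l2_bounded_def)
  have nz: "x i k \<noteq> 0" if "i \<in> J" for i using large[OF that] d by auto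
  define a where "a i = inverse (x i k)" for i
  have "(\<Sum>i\<in>J. (norm (a i))\<^sup>2) \<le> (\<Sum>i\<in>J. (1 / d)\<^sup>2)"
  proof (intro sum_mono power_mono)
    fix i assume "i \<in> J"
    thus "norm (a i) \<le> 1 / d" using large[of i] d by (simp add: a_def norm_inverse divide_inverse le_imp_inverse_le)
  qed simp
  hence s: "sqrt (\<Sum>i\<in>J. (norm (a i))\<^sup>2) \<le> sqrt (card J) / d"
    using d by (simp add: real_sqrt_divide power_divide real_le_lsqrt)
  have C: "0 \<le> C" using False l2_bounded_norm_le[OF x] by (metis all_not_in_conv card.empty lp_norm_nonneg order_trans)
  have "real (card J) = norm ((\<Sum>i\<in>J. seq_scale (a i) (x i)) k)"
    using nz by (simp add: seq_sum_apply seq_scale_def a_def)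
  also have "\<dots> \<le> lp_norm p (\<Sum>i\<in>J. seq_scale (a i) (x i))"
    using p lp by (intro lp_coord_le lp_sum_closed lp_scale) auto
  also have "\<dots> \<le> C * sqrt (\<Sum>i\<in>J. (norm (a i))\<^sup>2)" using x by (simp add: l2_bounded_def)
  also have "\<dots> \<le> C * (sqrt (card J) / d)" using s C by (intro mult_left_mono)
  finally have "sqrt (card J) * sqrt (card J) \<le> (C / d) * sqrt (card J)" by (simp add: mult_ac)
  hence "sqrt (card J) \<le> C / d" by (rule mult_right_le_imp_le) (use False in simp)
  hence "(sqrt (card J))\<^sup>2 \<le> (C / d)\<^sup>2" by (intro power_mono) auto
  thus ?thesis by simp
qed simp

text \<open>
  A random signed sum of the family has norm at most \<open>C m\<^bsup>1/2\<^esup>\<close>, but on average it is of size at least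
  \<open>d/2\<close> at every coordinate where some member is of size \<open>d\<close>; there are at least of order \<open>m\<close> such
  coordinates, which forces norm of order \<open>m\<^bsup>1/p\<^esup>\<close>. As \<open>p < 2\<close>, this bounds \<open>m\<close>.
\<close>

lemma l2_bounded_sup_large_card:
  fixes C d :: real
  assumes p: "1 \<le> p" "p < 2" and d: "0 < d" and C: "0 < C"
  obtains K where "\<And>I (x :: nat \<Rightarrow> 'k::real_normed_field sequence) \<kappa>. l2_bounded p C I x \<Longrightarrow>
    (\<And>i. i \<in> I \<Longrightarrow> d \<le> norm (x i (\<kappa> i))) \<Longrightarrow> card I \<le> K"
proof -
  define R where "R = (C / d)\<^sup>2 * (2 * C / d) powr p"
  define K where "K = nat \<lceil>R powr (1 / (1 - p/2))\<rceil>"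
  have R: "0 \<le> R" by (simp add: R_def)
  show ?thesis
  proof (rule that[of K])
    fix I and x :: "nat \<Rightarrow> 'k sequence" and \<kappa> :: "nat \<Rightarrow> nat"
    assume x: "l2_bounded p C I x" and large: "\<And>i. i \<in> I \<Longrightarrow> d \<le> norm (x i (\<kappa> i))"
    have fin: "finite I" and lp: "\<And>i. i \<in> I \<Longrightarrow> x i \<in> lp p" using x by (auto simp: l2_bounded_def)
    define m where "m = card I"
    have card_I: "real m \<le> (C / d)\<^sup>2 * card (\<kappa> ` I)"
    proof -
      have "real m = (\<Sum>k\<in>\<kappa> ` I. real (card {i \<in> I. \<kappa> i = k}))"
        using sum.image_gen[OF fin, of "\<lambda>_. 1::real" \<kappa>] by (simp add: m_def)
      also have "\<dots> \<le> (\<Sum>k\<in>\<kappa> ` I. (C / d)\<^sup>2)"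
      proof (intro sum_mono)
        fix k
        have "l2_bounded p C {i \<in> I. \<kappa> i = k} x" by (rule l2_bounded_subset[OF x]) auto
        thus "real (card {i \<in> I. \<kappa> i = k}) \<le> (C / d)\<^sup>2"
          using large by (intro l2_bounded_coord_large_card[OF p(1) _ d, of C _ x k]) auto
      qed
      finally show ?thesis by (simp add: mult.commute)
    qed
    obtain f where f: "bij_betw f {..<m} I"
      using ex_bij_betw_nat_finite[OF fin] by (auto simp: m_def atLeast0LessThan)
    define S where "S w = (\<Sum>j<m. seq_scale (of_real (rad j w)) (x (f j)))" for w
    have fI: "f j \<in> I" if "j < m" for j using f that by (auto simp: bij_betw_def)
    have S: "S w \<in> lp p" "lp_norm p (S w) \<le> C * sqrt m" for w
    proof -
      show "S w \<in> lp p" unfolding S_def using lp fI p by (intro lp_sum_closed lp_scale) auto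
      define g where "g = the_inv_into {..<m} f"
      have g: "g (f j) = j" if "j < m" for j
        using f that by (auto simp: g_def bij_betw_def the_inv_into_f_f)
      have "S w = (\<Sum>i\<in>I. seq_scale (of_real (rad (g i) w)) (x i))"
        unfolding S_def sum.reindex_bij_betw[OF f, symmetric] by (intro sum.cong) (auto simp: g)
      moreover have "(\<Sum>i\<in>I. (norm (of_real (rad (g i) w) :: 'k))\<^sup>2) = m" by (simp add: m_def)
      ultimately show "lp_norm p (S w) \<le> C * sqrt m"
        using l2_boundedD[OF x, of "\<lambda>i. of_real (rad (g i) w)"] by simp
    qed
    have coord: "2 ^ m * (d / 2) powr p \<le> (\<Sum>w<2 ^ m. norm (S w k) powr p)" if k: "k \<in> \<kappa> ` I" for k
    proof -
      obtain i where i: "i \<in> I" "k = \<kappa> i" using k by blast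
      obtain j where j: "j < m" "i = f j" using i(1) f by (auto simp: bij_betw_def)
      have "(\<Sum>w<2 ^ m. of_real (rad j w) * S w k) = (\<Sum>w<2 ^ m. \<Sum>l<m. of_real (rad j w * rad l w) * x (f l) k)"
        by (simp add: S_def seq_sum_apply seq_scale_def sum_distrib_left mult_ac)
      also have "\<dots> = (\<Sum>l<m. of_real (\<Sum>w<2 ^ m. rad j w * rad l w) * x (f l) k)"
        by (subst sum.swap) (simp add: sum_distrib_right)
      also have "\<dots> = (\<Sum>l<m. if l = j then 2 ^ m * x (f l) k else 0)"
        using j(1) by (intro sum.cong refl) (auto simp: rad_orthogonal)
      also have "\<dots> = 2 ^ m * x i k" using j by simp
      finally have "norm (2 ^ m * x i k) = norm (\<Sum>w<2 ^ m. of_real (rad j w) * S w k)" by simp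
      hence "2 ^ m * norm (x i k) \<le> (\<Sum>w<2 ^ m. norm (S w k))"
        using norm_sum[of "\<lambda>w. of_real (rad j w) * S w k" "{..<2 ^ m}"] by (simp add: norm_mult norm_power)
      moreover have "2 ^ m * d \<le> 2 ^ m * norm (x i k)" using large[OF i(1)] i(2) by simp
      ultimately have lower: "2 ^ m * d \<le> (\<Sum>w<2 ^ m. norm (S w k))" by linarith
      have "t \<le> d / 2 + t powr p * (d / 2) powr (1 - p)" if t: "0 \<le> t" for t
      proof (cases "t \<le> d / 2")
        case False
        have "t = t powr p * t powr (1 - p)" using False d by (simp flip: powr_add)
        also have "\<dots> \<le> t powr p * (d / 2) powr (1 - p)"
          using False d p by (intro mult_left_mono powr_mono2') auto
        finally show ?thesis using d by simp
      qed (simp add: add_increasing2)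
      hence "(\<Sum>w<2 ^ m. norm (S w k)) \<le> (\<Sum>w<2 ^ m. d / 2 + norm (S w k) powr p * (d / 2) powr (1 - p))"
        by (intro sum_mono) auto
      also have "\<dots> = 2 ^ m * (d / 2) + (\<Sum>w<2 ^ m. norm (S w k) powr p) * (d / 2) powr (1 - p)"
        by (simp add: sum.distrib sum_distrib_right)
      finally have "2 ^ m * (d / 2) \<le> (\<Sum>w<2 ^ m. norm (S w k) powr p) * (d / 2) powr (1 - p)"
        using lower by simp
      hence "2 ^ m * (d / 2) * (d / 2) powr (p - 1) \<le>
          (\<Sum>w<2 ^ m. norm (S w k) powr p) * (d / 2) powr (1 - p) * (d / 2) powr (p - 1)"
        by (intro mult_right_mono) auto
      moreover have "(d / 2) powr (1 - p) * (d / 2) powr (p - 1) = 1" using d by (simp flip: powr_add)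
      moreover have "(d / 2) * (d / 2) powr (p - 1) = (d / 2) powr p" using d by (simp add: powr_diff)
      ultimately show ?thesis by (simp add: mult.assoc)
    qed
    have "real (card (\<kappa> ` I)) * (2 ^ m * (d / 2) powr p) \<le> (\<Sum>k\<in>\<kappa> ` I. \<Sum>w<2 ^ m. norm (S w k) powr p)"
      using coord by (intro sum_bounded_below) auto
    also have "\<dots> = (\<Sum>w<2 ^ m. \<Sum>k\<in>\<kappa> ` I. norm (S w k) powr p)" by (rule sum.swap)
    also have "\<dots> \<le> (\<Sum>w<(2::nat) ^ m. (C * sqrt m) powr p)"
    proof (intro sum_mono)
      fix w
      have "(\<Sum>k\<in>\<kappa> ` I. norm (S w k) powr p) \<le> lp_norm p (S w) powr p"
        using fin p by (intro lp_sum_le[OF S(1)]) auto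
      also have "\<dots> \<le> (C * sqrt m) powr p" using S(2) p by (intro powr_mono2) auto
      finally show "(\<Sum>k\<in>\<kappa> ` I. norm (S w k) powr p) \<le> (C * sqrt m) powr p" .
    qed
    also have "\<dots> = 2 ^ m * (C * sqrt m) powr p" by simp
    finally have "real (card (\<kappa> ` I)) * (d / 2) powr p \<le> (C * sqrt m) powr p" by (simp add: mult.left_commute)
    hence "real (card (\<kappa> ` I)) \<le> (C * sqrt m) powr p / (d / 2) powr p" using d by (simp add: pos_le_divide_eq)
    also have "\<dots> = (2 * C / d) powr p * real m powr (p / 2)"
      using d C by (simp add: powr_mult powr_divide powr_half_sqrt[symmetric] powr_powr mult_ac)
    finally have "(C / d)\<^sup>2 * real (card (\<kappa> ` I)) \<le> (C / d)\<^sup>2 * ((2 * C / d) powr p * real m powr (p / 2))"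
      by (intro mult_left_mono) auto
    hence mR: "real m \<le> R * real m powr (p / 2)" using card_I by (simp add: R_def mult.assoc)
    show "card I \<le> K"
    proof (cases "m = 0")
      case False
      have "real m powr (1 - p / 2) = real m / real m powr (p / 2)" using False by (simp add: powr_diff)
      also have "\<dots> \<le> R" using mR False by (simp add: pos_divide_le_eq)
      finally have "(real m powr (1 - p / 2)) powr (1 / (1 - p/2)) \<le> R powr (1 / (1 - p/2))"
        using p by (intro powr_mono2) auto
      hence "real m \<le> R powr (1 / (1 - p/2))" using p False by (simp add: powr_powr)
      thus ?thesis unfolding K_def m_def by linarith
    qed (simp add: m_def)
  qed
qed

text \<open>
  A vector of bounded \<open>\<ell>\<^sub>p\<close>-norm all of whose coordinates are small has a small \<open>\<ell>\<^sub>q\<close>-norm, so the previous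
  lemma applies to the members on which the formal identity is large.
\<close>

lemma formal_identity_l2_null:
  assumes p: "1 \<le> p" "p < 2" and pq: "p < q"
  shows "(formal_identity p :: 'k::real_normed_field operator) \<in> l2_null_ops p q"
proof (rule l2_null_opsI)
  show "(formal_identity p :: 'k operator) \<in> bounded_ops p q" using p pq by (intro formal_identity_bounded) auto
  fix C e :: real assume e: "0 < e"
  define c where "c = \<bar>C\<bar> + 1"
  have c: "c > 0" "C \<le> c" by (auto simp: c_def)
  have pq0: "0 < p" "0 < q" using p pq by auto
  \<comment> \<open>chosen so that \<open>d\<^bsup>q-p\<^esup> c\<^sup>p = e\<^sup>q / 2\<close>\<close>
  define d where "d = (e powr q / (2 * c powr p)) powr (1 / (q - p))"
  have d: "d > 0" "d powr (q - p) * c powr p = e powr q / 2"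
    using e c pq by (auto simp: d_def powr_powr)
  obtain K where K: "\<And>I (x :: nat \<Rightarrow> 'k sequence) \<kappa>. l2_bounded p c I x \<Longrightarrow>
    (\<And>i. i \<in> I \<Longrightarrow> d \<le> norm (x i (\<kappa> i))) \<Longrightarrow> card I \<le> K"
    using l2_bounded_sup_large_card[OF p d(1) c(1)] by blast
  have "card I \<le> K" if x: "l2_bounded p C I x" "\<And>i. i \<in> I \<Longrightarrow> e \<le> lp_norm q (formal_identity p (x i))"
    for I and x :: "nat \<Rightarrow> 'k sequence"
  proof -
    have xc: "l2_bounded p c I x"
      using x(1) c(2) unfolding l2_bounded_def by (meson mult_right_mono order_trans real_sqrt_ge_zero sum_nonneg zero_le_power2)
    have "\<exists>k. d \<le> norm (x i k)" if i: "i \<in> I" for i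
    proof (rule ccontr)
      assume "\<not> ?thesis"
      hence small: "norm (x i k) < d" for k by (simp add: not_le)
      have xp: "x i \<in> lp p" using x(1) i by (simp add: l2_bounded_def)
      have xq: "x i \<in> lp q" using lp_mono(1)[OF xp pq0(1)] pq by simp
      have "e powr q \<le> lp_norm q (x i) powr q"
        using x(2)[OF i] xp e pq0 by (intro powr_mono2) (auto simp: formal_identity_def)
      also have "\<dots> = (\<Sum>k. norm (x i k) powr q)" by (rule lp_norm_powr[OF xq pq0(2)])
      also have "\<dots> \<le> (\<Sum>k. d powr (q - p) * norm (x i k) powr p)"
      proof (rule suminf_le)
        fix k
        have "norm (x i k) powr q = norm (x i k) powr (q - p) * norm (x i k) powr p" by (simp flip: powr_add)
        also have "\<dots> \<le> d powr (q - p) * norm (x i k) powr p"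
          using small[of k] pq by (intro mult_right_mono powr_mono2) auto
        finally show "norm (x i k) powr q \<le> d powr (q - p) * norm (x i k) powr p" .
      qed (use xp xq in \<open>auto simp: lp_def intro: summable_mult\<close>)
      also have "\<dots> = d powr (q - p) * lp_norm p (x i) powr p"
        using xp suminf_mult[of "\<lambda>k. norm (x i k) powr p" "d powr (q - p)"] lp_norm_powr[OF xp pq0(1)] by (simp add: lp_def)
      also have "\<dots> \<le> d powr (q - p) * c powr p"
        using l2_bounded_norm_le[OF xc i] pq0 by (intro mult_left_mono powr_mono2) auto
      finally show False using d(2) e by simp
    qed
    then obtain \<kappa> where "\<And>i. i \<in> I \<Longrightarrow> d \<le> norm (x i (\<kappa> i))" by metis
    thus ?thesis using K[OF xc] by blast
  qed
  thus "\<exists>K. \<forall>I x. l2_bounded p C I (x :: nat \<Rightarrow> 'k sequence) \<and>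
      (\<forall>i\<in>I. e \<le> lp_norm q (formal_identity p (x i))) \<longrightarrow> card I \<le> K" by blast
qed

text \<open>The \<open>n\<close> signs of block \<open>n\<close> form an \<open>\<ell>\<^sub>2\<close>-bounded family that is mapped to unit vectors.\<close>

lemma rad_coeff_not_l2_null:
  fixes T :: "'k::{real_normed_field, euclidean_space} operator"
  assumes p: "0 < p" and q: "0 < q" and T: "T = formal_identity 2 \<circ> rad_coeff p"
  shows "T \<notin> l2_null_ops p q"
proof
  assume null: "T \<in> l2_null_ops p q"
  obtain C where C: "0 < C"
    "\<And>n (a :: nat \<Rightarrow> 'k). lp_norm p (rad_vec p n a) \<le> C * sqrt (\<Sum>i<n. (norm (a i))\<^sup>2)"
    using rad_vec_norm_le[OF p] by blast
  obtain K where K: "\<And>I x. l2_bounded p C I (x :: nat \<Rightarrow> 'k sequence) \<Longrightarrow>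
      (\<And>i. i \<in> I \<Longrightarrow> 1 \<le> lp_norm q (T (x i))) \<Longrightarrow> card I \<le> K"
    using l2_null_opsE[OF null zero_less_one] by blast
  have "card {..<Suc K} \<le> K"
  proof (rule K)
    show "l2_bounded p C {..<Suc K} (\<lambda>i. rad_unit p (Suc K) i :: 'k sequence)"
      unfolding l2_bounded_def sum_rad_unit using C(2)[of "Suc K"] rad_vec_lp[OF p] by (auto simp: rad_unit_def)
    fix i assume i: "i \<in> {..<Suc K}"
    have "T (rad_unit p (Suc K) i) = unit_seq (prod_encode (Suc K, i))"
      using i by (simp add: T rad_coeff_rad_unit[OF p] formal_identity_def unit_seq_lp(1))
    thus "1 \<le> lp_norm q (T (rad_unit p (Suc K) i))" by (simp add: unit_seq_lp(2)[OF q])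
  qed
  thus False by simp
qed

section \<open>Factorisation through \<open>\<ell>\<^sub>2\<close>\<close>

lemma closed_op_ideal_closure:
  fixes G :: "'k::real_normed_field operator set"
  assumes pq: "1 \<le> p" "1 \<le> q" and G: "G \<subseteq> bounded_ops p q"
    and zero: "0 \<in> G" and add: "\<And>S T. S \<in> G \<Longrightarrow> T \<in> G \<Longrightarrow> S + T \<in> G"
    and comp: "\<And>A T B. A \<in> bounded_ops q q \<Longrightarrow> T \<in> G \<Longrightarrow> B \<in> bounded_ops p p \<Longrightarrow> A \<circ> T \<circ> B \<in> G"
  shows "closed_op_ideal p q (op_topology p q closure_of G)"
proof (rule closed_op_idealI[OF pq])
  have pq0: "0 < p" "0 < q" using pq by auto
  note cl = op_closure_iff[OF pq G]
  have clI: "T \<in> op_topology p q closure_of G"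
    if "T \<in> bounded_ops p q" "\<And>e. 0 < e \<Longrightarrow> \<exists>S\<in>G. \<forall>x\<in>lp p. lp_norm q (T x - S x) \<le> e * lp_norm p x" for T
    unfolding cl using that by blast
  have clb: "T \<in> bounded_ops p q" if "T \<in> op_topology p q closure_of G" for T
    using that unfolding cl by blast
  have clE: "\<exists>S\<in>G. \<forall>x\<in>lp p. lp_norm q (T x - S x) \<le> e * lp_norm p x"
    if "T \<in> op_topology p q closure_of G" "0 < e" for T e
    using that unfolding cl by blast
  show sub: "op_topology p q closure_of G \<subseteq> bounded_ops p q" using clb by blast
  show "0 \<in> op_topology p q closure_of G"
    by (rule clI[OF bounded_ops_zero_op]) (use zero in \<open>auto intro!: bexI[of _ 0]\<close>)
  fix S T assume S: "S \<in> op_topology p q closure_of G" and T: "T \<in> op_topology p q closure_of G"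
  show "S + T \<in> op_topology p q closure_of G"
  proof (rule clI[OF bounded_ops_add[OF clb[OF S] clb[OF T] pq]])
    fix e :: real assume "0 < e"
    hence e2: "0 < e/2" by simp
    obtain S' where S': "S' \<in> G" "\<And>x. x \<in> lp p \<Longrightarrow> lp_norm q (S x - S' x) \<le> e/2 * lp_norm p x"
      using clE[OF S e2] by blast
    obtain T' where T': "T' \<in> G" "\<And>x. x \<in> lp p \<Longrightarrow> lp_norm q (T x - T' x) \<le> e/2 * lp_norm p x"
      using clE[OF T e2] by blast
    have "lp_norm q ((S + T) x - (S' + T') x) \<le> e * lp_norm p x" if x: "x \<in> lp p" for x
    proof -
      have "(S + T) x - (S' + T') x = (S x - S' x) + (T x - T' x)" by simp
      hence "lp_norm q ((S + T) x - (S' + T') x) \<le> lp_norm q (S x - S' x) + lp_norm q (T x - T' x)"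
        using bounded_ops_in_lp clb S T S'(1) T'(1) G pq by (metis lp_add(2) lp_diff(1) subsetD)
      thus ?thesis using S'(2)[OF x] T'(2)[OF x] by simp
    qed
    thus "\<exists>U\<in>G. \<forall>x\<in>lp p. lp_norm q ((S + T) x - U x) \<le> e * lp_norm p x"
      using add[OF S'(1) T'(1)] by blast
  qed
next
  note cl = op_closure_iff[OF pq G]
  have pq0: "0 < p" "0 < q" using pq by auto
  fix A T B :: "'k operator"
  assume A: "A \<in> bounded_ops q q" and T: "T \<in> op_topology p q closure_of G" and B: "B \<in> bounded_ops p p"
  have Tb: "T \<in> bounded_ops p q" using T unfolding cl by blast
  have "A \<circ> T \<circ> B \<in> bounded_ops p q"
    using A B Tb pq0 by (intro bounded_ops_comp[of B p p _ q] bounded_ops_comp[of T p q A q]) auto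
  moreover have "\<exists>S\<in>G. \<forall>x\<in>lp p. lp_norm q ((A \<circ> T \<circ> B) x - S x) \<le> e * lp_norm p x" if e: "0 < e" for e
  proof -
    obtain a where a: "0 < a" "\<And>y. y \<in> lp q \<Longrightarrow> lp_norm q (A y) \<le> a * lp_norm q y"
      using bounded_ops_boundE[OF A] by blast
    obtain b where b: "0 < b" "\<And>x. x \<in> lp p \<Longrightarrow> lp_norm p (B x) \<le> b * lp_norm p x"
      using bounded_ops_boundE[OF B] by blast
    note ab = a(1) b(1) and Aa = a(2) and Bb = b(2)
    have "0 < e / (a * b)" using e ab by simp
    then obtain S where S: "S \<in> G" "\<And>x. x \<in> lp p \<Longrightarrow> lp_norm q (T x - S x) \<le> e / (a * b) * lp_norm p x"
      using T unfolding cl by blast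
    have Sb: "S \<in> bounded_ops p q" using S(1) G by blast
    have "lp_norm q ((A \<circ> T \<circ> B) x - (A \<circ> S \<circ> B) x) \<le> e * lp_norm p x" if x: "x \<in> lp p" for x
    proof -
      have Bx: "B x \<in> lp p" using bounded_ops_in_lp[OF B] .
      have "(A \<circ> T \<circ> B) x - (A \<circ> S \<circ> B) x = A (T (B x) - S (B x))"
        using bounded_ops_diff[OF A bounded_ops_in_lp[OF Tb] bounded_ops_in_lp[OF Sb] pq(2)] by simp
      hence "lp_norm q ((A \<circ> T \<circ> B) x - (A \<circ> S \<circ> B) x) \<le> a * lp_norm q (T (B x) - S (B x))"
        using Aa[OF lp_diff(1)[OF bounded_ops_in_lp[OF Tb] bounded_ops_in_lp[OF Sb] pq(2)]] by simp
      also have "\<dots> \<le> a * (e / (a * b) * (b * lp_norm p x))"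
      proof (intro mult_left_mono)
        have "e / (a * b) * lp_norm p (B x) \<le> e / (a * b) * (b * lp_norm p x)"
          using Bb[OF x] e ab by (intro mult_left_mono) auto
        thus "lp_norm q (T (B x) - S (B x)) \<le> e / (a * b) * (b * lp_norm p x)" using S(2)[OF Bx] by linarith
      qed (use ab in simp)
      also have "\<dots> = e * lp_norm p x" using ab by simp
      finally show ?thesis .
    qed
    thus ?thesis using comp[OF A S(1) B] by blast
  qed
  ultimately show "A \<circ> T \<circ> B \<in> op_topology p q closure_of G" unfolding cl by blast
next
  note cl = op_closure_iff[OF pq G]
  fix T :: "'k operator" assume T: "T \<in> bounded_ops p q"
    and approx: "\<And>e. 0 < e \<Longrightarrow> \<exists>S\<in>op_topology p q closure_of G. \<forall>x\<in>lp p. lp_norm q (T x - S x) \<le> e * lp_norm p x"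
  have "op_topology p q closure_of G \<subseteq> bounded_ops p q" unfolding subset_iff cl by blast
  hence "T \<in> op_topology p q closure_of (op_topology p q closure_of G)"
    using op_closure_iff[OF pq, of "op_topology p q closure_of G" T] T approx by blast
  thus "T \<in> op_topology p q closure_of G" by simp
qed

definition reindex :: "real \<Rightarrow> (nat \<Rightarrow> nat option) \<Rightarrow> 'k::real_normed_field operator" where
  "reindex p g x = (if x \<in> lp p then (\<lambda>k. case g k of None \<Rightarrow> 0 | Some j \<Rightarrow> x j) else 0)"

lemma reindex_bounded:
  assumes p: "1 \<le> p" and g: "inj_on g {k. g k \<noteq> None}"
  shows "(reindex p g :: 'k::real_normed_field operator) \<in> bounded_ops p p"
proof -
  have p0: "0 < p" using p by simp
  have main: "reindex p g x \<in> lp p" "lp_norm p (reindex p g x) \<le> lp_norm p x" if x: "x \<in> lp p" for x :: "'k sequence"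
  proof -
    have "(\<Sum>k\<in>F. norm (reindex p g x k) powr p) \<le> lp_norm p x powr p" if F: "finite F" for F
    proof -
      define F' where "F' = {k \<in> F. g k \<noteq> None}"
      have inj: "inj_on (\<lambda>k. the (g k)) F'"
        using g by (auto simp: inj_on_def F'_def)
      have "(\<Sum>k\<in>F. norm (reindex p g x k) powr p) = (\<Sum>k\<in>F'. norm (reindex p g x k) powr p)"
        using F x by (intro sum.mono_neutral_right) (auto simp: F'_def reindex_def)
      also have "\<dots> = (\<Sum>k\<in>F'. norm (x (the (g k))) powr p)"
        using x by (intro sum.cong) (auto simp: F'_def reindex_def)
      also have "\<dots> = (\<Sum>j\<in>(\<lambda>k. the (g k)) ` F'. norm (x j) powr p)"
        by (simp add: sum.reindex[OF inj])
      also have "\<dots> \<le> lp_norm p x powr p" using F by (intro lp_sum_le[OF x p0]) (simp add: F'_def)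
      finally show ?thesis .
    qed
    from lp_boundI[OF p0 lp_norm_nonneg this]
    show "reindex p g x \<in> lp p" "lp_norm p (reindex p g x) \<le> lp_norm p x" by auto
  qed
  show ?thesis
  proof (rule bounded_opsI[where C = 1])
    fix x :: "'k sequence" and c assume x: "x \<in> lp p"
    show "reindex p g (seq_scale c x) = seq_scale c (reindex p g x)"
      using x lp_scale(1)[OF x p0, of c] by (auto simp: reindex_def seq_scale_def fun_eq_iff split: option.split)
    fix y :: "'k sequence" assume y: "y \<in> lp p"
    show "reindex p g (x + y) = reindex p g x + reindex p g y"
      using x y lp_add(1)[OF x y p] by (auto simp: reindex_def fun_eq_iff split: option.split)
  qed (use main in \<open>auto simp: reindex_def\<close>)
qed

text \<open>Sums are factored through \<open>\<ell>\<^sub>2 \<oplus> \<ell>\<^sub>2\<close>, which is \<open>\<ell>\<^sub>2\<close> split into even and odd coordinates.\<close>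

lemma factor_l2_add:
  fixes A\<^sub>1 A\<^sub>2 B\<^sub>1 B\<^sub>2 :: "'k::real_normed_field operator"
  assumes pq: "1 \<le> p" "1 \<le> q"
    and B: "B\<^sub>1 \<in> bounded_ops p 2" "B\<^sub>2 \<in> bounded_ops p 2"
    and A: "A\<^sub>1 \<in> bounded_ops 2 q" "A\<^sub>2 \<in> bounded_ops 2 q"
  obtains A B where "B \<in> bounded_ops p 2" "A \<in> bounded_ops 2 q" "(A\<^sub>1 \<circ> B\<^sub>1) + (A\<^sub>2 \<circ> B\<^sub>2) = A \<circ> B"
proof -
  define ev :: "'k operator" where "ev = reindex 2 (\<lambda>k. Some (2 * k))"
  define od :: "'k operator" where "od = reindex 2 (\<lambda>k. Some (Suc (2 * k)))"
  define iev :: "'k operator" where "iev = reindex 2 (\<lambda>k. if even k then Some (k div 2) else None)"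
  define iod :: "'k operator" where "iod = reindex 2 (\<lambda>k. if odd k then Some (k div 2) else None)"
  have bd: "ev \<in> bounded_ops 2 2" "od \<in> bounded_ops 2 2" "iev \<in> bounded_ops 2 2" "iod \<in> bounded_ops 2 2"
    unfolding ev_def od_def iev_def iod_def
    by (intro reindex_bounded; auto simp: inj_on_def elim!: evenE oddE)+
  define B where "B = (iev \<circ> B\<^sub>1) + (iod \<circ> B\<^sub>2)"
  define A where "A = (A\<^sub>1 \<circ> ev) + (A\<^sub>2 \<circ> od)"
  have Bb: "B \<in> bounded_ops p 2" unfolding B_def
    using bounded_ops_comp[OF B(1) bd(3)] bounded_ops_comp[OF B(2) bd(4)] pq by (intro bounded_ops_add) auto
  have Ab: "A \<in> bounded_ops 2 q" unfolding A_def
    using bounded_ops_comp[OF bd(1) A(1)] bounded_ops_comp[OF bd(2) A(2)] pq by (intro bounded_ops_add) auto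
  have "A (B x) = A\<^sub>1 (B\<^sub>1 x) + A\<^sub>2 (B\<^sub>2 x)" for x
  proof -
    have lp: "B\<^sub>1 x \<in> lp 2" "B\<^sub>2 x \<in> lp 2" "B x \<in> lp 2"
      using bounded_ops_in_lp B Bb by blast+
    have "ev (B x) = B\<^sub>1 x" "od (B x) = B\<^sub>2 x"
      using lp by (simp_all add: ev_def od_def reindex_def) (simp_all add: B_def iev_def iod_def reindex_def)
    thus ?thesis by (simp add: A_def)
  qed
  hence "(A\<^sub>1 \<circ> B\<^sub>1) + (A\<^sub>2 \<circ> B\<^sub>2) = A \<circ> B" by (intro ext) simp
  thus ?thesis using that Ab Bb by blast
qed

lemma closed_op_ideal_factor_l2:
  assumes pq: "1 \<le> p" "1 \<le> q"
  shows "closed_op_ideal p q (factor_l2_closure p q :: 'k::real_normed_field operator set)"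
proof -
  define G :: "'k operator set" where "G = {A \<circ> B | A B. B \<in> bounded_ops p 2 \<and> A \<in> bounded_ops 2 q}"
  have pq0: "0 < p" "0 < q" using pq by auto
  have "closed_op_ideal p q (op_topology p q closure_of G)"
  proof (rule closed_op_ideal_closure[OF pq])
    show "G \<subseteq> bounded_ops p q" using bounded_ops_comp[of _ p 2 _ q] pq0 by (auto simp: G_def)
    have "(0 :: 'k operator) = 0 \<circ> 0" by (simp add: fun_eq_iff)
    thus "0 \<in> G" unfolding G_def using bounded_ops_zero_op by blast
    show "S + T \<in> G" if ST: "S \<in> G" "T \<in> G" for S T
    proof -
      obtain A B A' B' where S: "S = A \<circ> B" "B \<in> bounded_ops p 2" "A \<in> bounded_ops 2 q"
          and T: "T = A' \<circ> B'" "B' \<in> bounded_ops p 2" "A' \<in> bounded_ops 2 q"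
        using ST unfolding G_def by blast
      obtain A'' B'' where "B'' \<in> bounded_ops p 2" "A'' \<in> bounded_ops 2 q" "(A \<circ> B) + (A' \<circ> B') = A'' \<circ> B''"
        using factor_l2_add[OF pq S(2) T(2) S(3) T(3)] by metis
      thus ?thesis unfolding G_def S(1) T(1) by blast
    qed
    show "A \<circ> T \<circ> B \<in> G" if ATB: "A \<in> bounded_ops q q" "T \<in> G" "B \<in> bounded_ops p p" for A T B
    proof -
      obtain A' B' where T: "T = A' \<circ> B'" "B' \<in> bounded_ops p 2" "A' \<in> bounded_ops 2 q"
        using ATB unfolding G_def by blast
      have "A \<circ> A' \<in> bounded_ops 2 q" "B' \<circ> B \<in> bounded_ops p 2"
        using bounded_ops_comp[OF T(3) ATB(1)] bounded_ops_comp[OF ATB(3) T(2)] pq0 by simp_all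
      moreover have "A \<circ> T \<circ> B = (A \<circ> A') \<circ> (B' \<circ> B)" by (simp add: T comp_assoc)
      ultimately show ?thesis unfolding G_def by blast
    qed
  qed
  thus ?thesis by (simp add: factor_l2_closure_def G_def)
qed

lemma factor_l2I:
  fixes A B :: "'k::real_normed_field operator"
  assumes pq: "1 \<le> p" "1 \<le> q" and "B \<in> bounded_ops p 2" "A \<in> bounded_ops 2 q"
  shows "A \<circ> B \<in> factor_l2_closure p q"
proof -
  let ?G = "{A \<circ> B | A B. B \<in> bounded_ops p 2 \<and> A \<in> bounded_ops 2 q} :: 'k operator set"
  have G: "?G \<subseteq> bounded_ops p q" using bounded_ops_comp[of _ p 2 _ q] pq by auto
  have "A \<circ> B \<in> ?G" using assms by blast
  thus ?thesis unfolding factor_l2_closure_def op_closure_iff[OF pq G] using G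
    by (intro conjI allI impI bexI[of _ "A \<circ> B"]) auto
qed

section \<open>An operator far from every operator that factors through \<open>\<ell>\<^sub>2\<close>\<close>

text \<open>Sylvester's Hadamard matrices, indexed by \<open>i, j < 2\<^sup>n\<close>: the row and column index are paired bit by bit.\<close>

fun walsh :: "nat \<Rightarrow> nat \<Rightarrow> nat \<Rightarrow> real" where
  "walsh 0 i j = 1"
| "walsh (Suc n) i j = (if odd i \<and> odd j then - 1 else 1) * walsh n (i div 2) (j div 2)"

lemma walsh_abs [simp]: "\<bar>walsh n i j\<bar> = 1"
  by (induction n arbitrary: i j) (auto simp: abs_mult)

lemma walsh_square [simp]: "walsh n i j * walsh n i j = 1"
  using walsh_abs[of n i j] by (metis abs_mult_self_eq mult_1)

lemma walsh_orthogonal: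
  assumes "j < 2 ^ n" "k < 2 ^ n"
  shows "(\<Sum>i<2 ^ n. walsh n i j * walsh n i k) = (if j = k then 2 ^ n else 0)"
  using assms
proof (induction n arbitrary: j k)
  case (Suc n)
  define s where "s j = (if odd j then - 1 else 1 :: real)" for j :: nat
  have "(\<Sum>i<2 ^ Suc n. walsh (Suc n) i j * walsh (Suc n) i k) =
      (\<Sum>i<2 ^ n. (1 + s j * s k) * (walsh n i (j div 2) * walsh n i (k div 2)))"
    unfolding power_Suc sum_pairs by (intro sum.cong refl) (simp add: s_def)
  also have "\<dots> = (1 + s j * s k) * (if j div 2 = k div 2 then 2 ^ n else 0)"
    unfolding sum_distrib_left[symmetric] using Suc.prems by (subst Suc.IH) auto
  also have "\<dots> = (if j = k then 2 ^ Suc n else 0)"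
  proof (cases "j = k")
    case False
    have "s j * s k = - 1" if "j div 2 = k div 2"
    proof -
      have "odd j \<noteq> odd k" using that False by (metis div_mult_mod_eq parity_cases odd_iff_mod_2_eq_one)
      thus ?thesis by (auto simp: s_def)
    qed
    thus ?thesis using False by auto
  qed (simp add: s_def)
  finally show ?case .
qed simp

lemma walsh_sum_square:
  fixes a :: "nat \<Rightarrow> 'k::{real_normed_field, euclidean_space}"
  shows "(\<Sum>i<2 ^ n. (norm (\<Sum>j<2 ^ n. of_real (walsh n i j) * a j))\<^sup>2) = 2 ^ n * (\<Sum>j<2 ^ n. (norm (a j))\<^sup>2)"
proof -
  have "(norm (\<Sum>j<2 ^ n. of_real (walsh n i j) * a j))\<^sup>2 =
      (\<Sum>j<2 ^ n. \<Sum>k<2 ^ n. (walsh n i j * walsh n i k) * (a j \<bullet> a k))" for i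
    unfolding power2_norm_eq_inner inner_sum_left inner_sum_right scaleR_conv_of_real[symmetric]
    by (simp add: mult.assoc mult.left_commute inner_commute)
  hence "(\<Sum>i<2 ^ n. (norm (\<Sum>j<2 ^ n. of_real (walsh n i j) * a j))\<^sup>2) =
      (\<Sum>i<2 ^ n. \<Sum>j<2 ^ n. \<Sum>k<2 ^ n. (walsh n i j * walsh n i k) * (a j \<bullet> a k))" by simp
  also have "\<dots> = (\<Sum>j<2 ^ n. \<Sum>i<2 ^ n. \<Sum>k<2 ^ n. (walsh n i j * walsh n i k) * (a j \<bullet> a k))"
    by (rule sum.swap)
  also have "\<dots> = (\<Sum>j<2 ^ n. \<Sum>k<2 ^ n. (\<Sum>i<2 ^ n. walsh n i j * walsh n i k) * (a j \<bullet> a k))"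
    by (rule sum.cong[OF refl], subst sum.swap, simp add: sum_distrib_right)
  also have "\<dots> = (\<Sum>j<2 ^ n. \<Sum>k<2 ^ n. if k = j then 2 ^ n * (a j \<bullet> a j) else 0)"
    by (intro sum.cong refl) (auto simp: walsh_orthogonal)
  also have "\<dots> = 2 ^ n * (\<Sum>j<2 ^ n. (norm (a j))\<^sup>2)"
    by (simp add: power2_norm_eq_inner sum_distrib_left)
  finally show ?thesis .
qed

text \<open>
  The linear functional \<open>M \<mapsto> tr (W\<^sup>T M)\<close>, for the Walsh matrix \<open>W\<close>: it is large on some matrices of
  norm \<open>1\<close> from \<open>\<ell>\<^sub>p\<close> to \<open>\<ell>\<^sub>q\<close>, but not on those that factor through \<open>\<ell>\<^sub>2\<close> with small norms.
\<close>

definition walsh_pairing :: "nat \<Rightarrow> (nat \<Rightarrow> nat \<Rightarrow> 'k::real_normed_field) \<Rightarrow> 'k" where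
  "walsh_pairing n M = (\<Sum>i<2 ^ n. \<Sum>j<2 ^ n. of_real (walsh n i j) * M i j)"

definition mat_unit_ball :: "real \<Rightarrow> real \<Rightarrow> nat \<Rightarrow> (nat \<Rightarrow> nat \<Rightarrow> 'k::real_normed_field) set" where
  "mat_unit_ball p q n = {M. \<forall>a. fin_norm q (2 ^ n) (\<lambda>i. \<Sum>j<2 ^ n. M i j * a j) \<le> fin_norm p (2 ^ n) a}"

lemma walsh_pairing_scale: "walsh_pairing n (\<lambda>i j. c * M i j) = c * walsh_pairing n M"
  by (simp add: walsh_pairing_def sum_distrib_left mult.left_commute)

lemma walsh_pairing_add: "walsh_pairing n (\<lambda>i j. M i j + L i j) = walsh_pairing n M + walsh_pairing n L"
  by (simp add: walsh_pairing_def distrib_left sum.distrib)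

lemma norm_le_fin_norm:
  assumes "0 < q" "i < m" shows "norm (x i) \<le> fin_norm q m x"
proof -
  have "norm (x i) powr q \<le> (\<Sum>j<m. norm (x j) powr q)" using assms(2) by (intro member_le_sum) auto
  hence "norm (x i) powr q \<le> fin_norm q m x powr q" using assms(1) by (simp add: fin_norm_powr)
  thus ?thesis using assms(1) powr_less_mono2[of q "fin_norm q m x" "norm (x i)"] by (force simp: not_le)
qed

lemma mat_unit_ball_pairing_le:
  fixes M :: "nat \<Rightarrow> nat \<Rightarrow> 'k::real_normed_field"
  assumes pq: "0 < p" "0 < q" and M: "M \<in> mat_unit_ball p q n"
  shows "norm (walsh_pairing n M) \<le> 2 ^ n * 2 ^ n"
proof -
  have entry: "norm (M i j) \<le> 1" if "i < 2 ^ n" "j < 2 ^ n" for i j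
  proof -
    define e where "e l = (if l = j then 1 else 0 :: 'k)" for l
    have "(\<Sum>l<2 ^ n. norm (e l) powr p) = (\<Sum>l<2 ^ n. if l = j then 1 else 0)"
      by (intro sum.cong) (auto simp: e_def)
    hence e1: "fin_norm p (2 ^ n) e = 1" using that by (simp add: fin_norm_def)
    have Me: "(\<Sum>l<2 ^ n. M i l * e l) = M i j" for i using that by (simp add: e_def if_distrib cong: if_cong)
    have "norm (M i j) \<le> fin_norm q (2 ^ n) (\<lambda>i. \<Sum>l<2 ^ n. M i l * e l)"
      unfolding Me using pq that by (intro norm_le_fin_norm)
    also have "\<dots> \<le> 1" using M e1 by (simp add: mat_unit_ball_def) (metis e1)
    finally show ?thesis .
  qed
  have "norm (walsh_pairing n M) \<le> (\<Sum>i<2 ^ n. norm (\<Sum>j<2 ^ n. of_real (walsh n i j) * M i j))"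
    unfolding walsh_pairing_def by (rule norm_sum)
  also have "\<dots> \<le> (\<Sum>i<2 ^ n. \<Sum>j<2 ^ n. norm (of_real (walsh n i j) * M i j))"
    by (intro sum_mono norm_sum)
  also have "\<dots> \<le> (\<Sum>i<(2::nat) ^ n. \<Sum>j<(2::nat) ^ n. 1)"
    using entry by (intro sum_mono) (simp add: norm_mult)
  finally show ?thesis by simp
qed

lemma mat_unit_ball_maximiser:
  assumes pq: "0 < p" "0 < q"
  obtains M :: "nat \<Rightarrow> nat \<Rightarrow> 'k::real_normed_field" where "M \<in> mat_unit_ball p q n"
    "\<And>L :: nat \<Rightarrow> nat \<Rightarrow> 'k. L \<in> mat_unit_ball p q n \<Longrightarrow> norm (walsh_pairing n L) \<le> 2 * norm (walsh_pairing n M)"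
proof -
  define V where "V = (\<lambda>M :: nat \<Rightarrow> nat \<Rightarrow> 'k. norm (walsh_pairing n M)) ` mat_unit_ball p q n"
  have zero: "(\<lambda>i j. 0) \<in> (mat_unit_ball p q n :: (nat \<Rightarrow> nat \<Rightarrow> 'k) set)"
    unfolding mat_unit_ball_def using pq by (simp add: fin_norm_def[of q])
  hence ne: "V \<noteq> {}" by (auto simp: V_def)
  have bdd: "bdd_above V"
    unfolding V_def using mat_unit_ball_pairing_le[OF pq] by (intro bdd_aboveI2) blast
  have "\<exists>v\<in>V. Sup V \<le> 2 * v"
  proof (cases "Sup V \<le> 0")
    case True
    obtain v where "v \<in> V" using ne by blast
    moreover have "0 \<le> v" using \<open>v \<in> V\<close> by (auto simp: V_def)
    ultimately show ?thesis using True by (intro bexI[of _ v]) auto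
  next
    case False
    hence "Sup V / 2 < Sup V" by simp
    then obtain v where "v \<in> V" "Sup V / 2 < v" using less_cSup_iff[OF ne bdd] by blast
    thus ?thesis by (intro bexI[of _ v]) auto
  qed
  then obtain v where v: "v \<in> V" "Sup V \<le> 2 * v" by blast
  obtain M :: "nat \<Rightarrow> nat \<Rightarrow> 'k" where "M \<in> mat_unit_ball p q n" "v = norm (walsh_pairing n M)"
    using v(1) unfolding V_def by blast
  hence M: "M \<in> mat_unit_ball p q n" "Sup V \<le> 2 * norm (walsh_pairing n M)" using v(2) by simp_all
  show ?thesis
  proof (rule that[OF M(1)])
    fix L :: "nat \<Rightarrow> nat \<Rightarrow> 'k" assume "L \<in> mat_unit_ball p q n"
    hence "norm (walsh_pairing n L) \<le> Sup V" using bdd by (intro cSup_upper) (auto simp: V_def)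
    thus "norm (walsh_pairing n L) \<le> 2 * norm (walsh_pairing n M)" using M(2) by simp
  qed
qed

text \<open>
  Interpolation between \<open>\<ell>\<^sub>1 \<rightarrow> \<ell>\<^sub>\<infinity>\<close> and \<open>\<ell>\<^sub>2 \<rightarrow> \<ell>\<^sub>2\<close> in its crudest form. The exponent is not optimal; all
  that matters is that it is less than \<open>1/2\<close> when \<open>p < 2 < q\<close>.
\<close>

lemma walsh_fin_norm_le:
  fixes a :: "nat \<Rightarrow> 'k::{real_normed_field, euclidean_space}"
  assumes p: "1 < p" "p \<le> 2" and q: "2 \<le> q"
  shows "fin_norm q (2 ^ n) (\<lambda>i. \<Sum>j<2 ^ n. of_real (walsh n i j) * a j) \<le>
    (2 ^ n) powr (1/q + (1 - 1/p) * (1 - 2/q)) * fin_norm p (2 ^ n) a"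
proof -
  have pq0: "0 < p" "0 < q" using p q by auto
  define b where "b i = (\<Sum>j<2 ^ n. of_real (walsh n i j) * a j)" for i
  define P where "P = fin_norm p (2 ^ n) a"
  define p' where "p' = p / (p - 1)"
  have p': "1 < p'" "1 / p + 1 / p' = 1" using p by (auto simp: p'_def field_simps)
  have P: "0 \<le> P" by (simp add: P_def)
  have l1: "(\<Sum>j<2 ^ n. norm (a j)) \<le> (2 ^ n) powr (1 - 1/p) * P"
  proof -
    have "(\<Sum>j<2 ^ n. norm (a j) * 1) \<le> P * (\<Sum>j<(2::nat) ^ n. 1 powr p') powr (1 / p')"
      unfolding P_def fin_norm_def using p p' by (intro Holder_sum) auto
    also have "1 / p' = 1 - 1 / p" using p'(2) by simp
    finally show ?thesis by (simp add: mult.commute)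
  qed
  have b_le: "norm (b i) \<le> (2 ^ n) powr (1 - 1/p) * P" for i
  proof -
    have "norm (b i) \<le> (\<Sum>j<2 ^ n. norm (of_real (walsh n i j) * a j))" unfolding b_def by (rule norm_sum)
    thus ?thesis using l1 by (simp add: norm_mult)
  qed
  have l2: "(\<Sum>j<2 ^ n. (norm (a j))\<^sup>2) \<le> P powr 2"
  proof -
    have "(\<Sum>j<2 ^ n. (norm (a j))\<^sup>2) = (\<Sum>j<2 ^ n. (norm (a j) powr p) powr (2 / p))"
      using p by (simp add: powr_powr)
    also have "\<dots> \<le> (\<Sum>j<2 ^ n. norm (a j) powr p) powr (2 / p)"
      using p by (intro sum_powr_le) auto
    also have "\<dots> = P powr 2"
      unfolding P_def fin_norm_powr[OF pq0(1), symmetric] using p by (simp add: powr_powr)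
    finally show ?thesis .
  qed
  define X where "X = (2 ^ n) powr (1 - 1/p) * P"
  have X: "0 \<le> X" using P by (simp add: X_def)
  have "(\<Sum>i<2 ^ n. norm (b i) powr q) \<le> (\<Sum>i<2 ^ n. X powr (q - 2) * (norm (b i))\<^sup>2)"
  proof (intro sum_mono)
    fix i
    have "norm (b i) powr q = norm (b i) powr (q - 2) * norm (b i) powr 2" by (simp only: powr_add[symmetric]) simp
    also have "\<dots> \<le> X powr (q - 2) * norm (b i) powr 2"
      using b_le[of i] q by (intro mult_right_mono powr_mono2) (auto simp: X_def)
    finally show "norm (b i) powr q \<le> X powr (q - 2) * (norm (b i))\<^sup>2" by simp
  qed
  also have "\<dots> = X powr (q - 2) * (2 ^ n * (\<Sum>j<2 ^ n. (norm (a j))\<^sup>2))"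
    unfolding sum_distrib_left[symmetric] b_def walsh_sum_square ..
  also have "\<dots> \<le> X powr (q - 2) * (2 ^ n * P powr 2)" using l2 by (intro mult_left_mono) auto
  finally have main: "(\<Sum>i<2 ^ n. norm (b i) powr q) \<le> X powr (q - 2) * (2 ^ n * P powr 2)" .
  have "fin_norm q (2 ^ n) b \<le> (X powr (q - 2) * (2 ^ n * P powr 2)) powr (1 / q)"
    unfolding fin_norm_def using main pq0 by (intro powr_mono2 sum_nonneg) auto
  also have "\<dots> = (2 ^ n) powr ((1 - 1/p) * ((q - 2) / q)) * (2 ^ n) powr (1/q) * (P powr ((q - 2) / q) * P powr (2 / q))"
  proof -
    have e: "(q - 2) * (1 / q) = (q - 2) / q" "2 * (1 / q) = 2 / q" by simp_all
    have "(X powr (q - 2) * (2 ^ n * P powr 2)) powr (1 / q) = X powr ((q - 2) / q) * ((2 ^ n) powr (1/q) * P powr (2 / q))"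
      by (simp only: powr_mult powr_powr e)
    moreover have "X powr ((q - 2) / q) = (2 ^ n) powr ((1 - 1/p) * ((q - 2) / q)) * P powr ((q - 2) / q)"
      by (simp only: X_def powr_mult powr_powr)
    ultimately show ?thesis by (simp only: mult_ac)
  qed
  also have "P powr ((q - 2) / q) * P powr (2 / q) = P"
    using P pq0 by (cases "P = 0") (auto simp: powr_add[symmetric] diff_divide_distrib)
  also have "(2 ^ n) powr ((1 - 1/p) * ((q - 2) / q)) * (2 ^ n) powr (1/q) =
      (2 ^ n :: real) powr (1/q + (1 - 1/p) * (1 - 2/q))"
    using pq0 by (simp add: powr_add[symmetric] diff_divide_distrib add.commute)
  finally show ?thesis unfolding b_def[abs_def] P_def .
qed

lemma walsh_maximum_ge:
  assumes p: "1 < p" "p \<le> 2" and q: "2 \<le> q"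
  obtains M :: "nat \<Rightarrow> nat \<Rightarrow> 'k::{real_normed_field, euclidean_space}" where "M \<in> mat_unit_ball p q n"
    "norm (walsh_pairing n M) = (2 ^ n) powr (2 - (1/q + (1 - 1/p) * (1 - 2/q)))"
proof
  define \<theta> where "\<theta> = 1/q + (1 - 1/p) * (1 - 2/q)"
  define c where "c = (2 ^ n :: real) powr (- \<theta>)"
  define M :: "nat \<Rightarrow> nat \<Rightarrow> 'k" where "M i j = of_real c * of_real (walsh n i j)" for i j
  have q0: "0 < q" using q by simp
  show "M \<in> mat_unit_ball p q n"
    unfolding mat_unit_ball_def
  proof (intro CollectI allI)
    fix a :: "nat \<Rightarrow> 'k"
    have "fin_norm q (2 ^ n) (\<lambda>i. \<Sum>j<2 ^ n. M i j * a j) =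
        fin_norm q (2 ^ n) (\<lambda>i. of_real c * (\<Sum>j<2 ^ n. of_real (walsh n i j) * a j))"
      by (simp add: M_def sum_distrib_left mult.assoc)
    also have "\<dots> = c * fin_norm q (2 ^ n) (\<lambda>i. \<Sum>j<2 ^ n. of_real (walsh n i j) * a j)"
      unfolding fin_norm_scale[OF q0] by (simp add: c_def)
    also have "\<dots> \<le> c * ((2 ^ n) powr \<theta> * fin_norm p (2 ^ n) a)"
      unfolding \<theta>_def using walsh_fin_norm_le[OF p q] by (intro mult_left_mono) (auto simp: c_def)
    also have "\<dots> = fin_norm p (2 ^ n) a" by (simp add: c_def powr_minus field_simps)
    finally show "fin_norm q (2 ^ n) (\<lambda>i. \<Sum>j<2 ^ n. M i j * a j) \<le> fin_norm p (2 ^ n) a" .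
  qed
  have "walsh_pairing n (\<lambda>i j. of_real (walsh n i j)) = (of_real (\<Sum>i<2 ^ n. \<Sum>j<2 ^ n. walsh n i j * walsh n i j) :: 'k)"
    by (simp only: walsh_pairing_def of_real_sum of_real_mult)
  hence "walsh_pairing n M = of_real (c * (2 ^ n * 2 ^ n))"
    unfolding M_def walsh_pairing_scale by simp
  hence "norm (walsh_pairing n M) = c * (2 ^ n * 2 ^ n)"
    by (simp only: norm_of_real) (simp add: c_def abs_mult)
  also have "\<dots> = (2 ^ n) powr (2 - \<theta>)"
    by (simp add: c_def powr_diff powr_minus divide_inverse power2_eq_square)
  finally show "norm (walsh_pairing n M) = (2 ^ n) powr (2 - (1/q + (1 - 1/p) * (1 - 2/q)))"
    by (simp add: \<theta>_def)
qed

definition block_matrix :: "'k::real_normed_field operator \<Rightarrow> nat \<Rightarrow> nat \<Rightarrow> nat \<Rightarrow> 'k" where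
  "block_matrix T n i j = T (unit_seq (prod_encode (n, j))) (prod_encode (n, i))"

lemma block_matrix_block_op:
  assumes "0 < p" "i < t n" "j < s n"
  shows "block_matrix (block_op p s t M) n i j = M n i j"
  unfolding block_matrix_def unit_seq_block[OF assms(3)] block_op_block[OF assms(1)]
  using assms(2,3) by (simp add: if_distrib cong: if_cong)

lemma sum_unit_seq_block: "(\<Sum>j<m. seq_scale (a j) (unit_seq (prod_encode (n, j)))) = block n m a"
  by (rule seq_eq_blockI)
    (auto simp: seq_sum_apply seq_scale_def unit_seq_apply prod_encode_eq if_distrib cong: if_cong)

lemma block_matrix_bound:
  fixes T :: "'k::real_normed_field operator"
  assumes pq: "1 \<le> p" "1 \<le> q" and T: "T \<in> bounded_ops p q"
    and e: "\<And>x. x \<in> lp p \<Longrightarrow> lp_norm q (T x) \<le> e * lp_norm p x"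
  shows "fin_norm q l (\<lambda>i. \<Sum>j<m. block_matrix T n i j * a j) \<le> e * fin_norm p m a"
proof -
  have pq0: "0 < p" "0 < q" using pq by auto
  define y where "y = T (block n m a)"
  have y: "y \<in> lp q" unfolding y_def by (rule bounded_ops_in_lp[OF T])
  have "y = (\<Sum>j<m. seq_scale (a j) (T (unit_seq (prod_encode (n, j)))))"
    unfolding y_def sum_unit_seq_block[symmetric]
    by (rule bounded_ops_sum[OF T _ pq(1)]) (simp add: unit_seq_lp(1)[OF pq0(1)])
  hence yi: "(\<Sum>j<m. block_matrix T n i j * a j) = y (prod_encode (n, i))" for i
    by (simp add: block_matrix_def seq_sum_apply seq_scale_def mult.commute)
  have inj: "inj_on (\<lambda>i. prod_encode (n, i)) {..<l}" by (rule inj_onI) (simp add: prod_encode_eq)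
  have "fin_norm q l (\<lambda>i. y (prod_encode (n, i))) powr q = (\<Sum>k\<in>(\<lambda>i. prod_encode (n, i)) ` {..<l}. norm (y k) powr q)"
    by (simp add: fin_norm_powr[OF pq0(2)] sum.reindex[OF inj])
  also have "\<dots> \<le> lp_norm q y powr q" by (intro lp_sum_le[OF y pq0(2)]) simp
  finally have "fin_norm q l (\<lambda>i. y (prod_encode (n, i))) \<le> lp_norm q y"
    using pq0 powr_less_mono2[of q "lp_norm q y" "fin_norm q l (\<lambda>i. y (prod_encode (n, i)))"] by (force simp: not_le)
  also have "\<dots> \<le> e * fin_norm p m a"
    unfolding y_def using e[OF block_lp(1)[OF pq0(1)], of n m a] block_lp(2)[OF pq0(1), of n m a] by simp
  finally show ?thesis unfolding yi .
qed

text \<open>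
  With \<open>N = 2\<^sup>n\<close>: the Walsh matrix acts with norm \<open>N\<^bsup>1/2\<^esup>\<close> on the \<open>N\<close>-tuples of vectors of \<open>\<ell>\<^sub>2\<close>. The tuple of the
  images of the unit vectors under \<open>B\<close> has norm at most \<open>N\<^bsup>1/2\<^esup> \<parallel>B\<parallel>\<close>, and passing from the norm of a tuple
  to the sum of the norms of its entries costs another factor \<open>N\<^bsup>1/2\<^esup>\<close>.
\<close>

lemma walsh_pairing_factor_l2_le:
  fixes A B :: "'k::{real_normed_field, euclidean_space} operator"
  assumes pq: "1 \<le> p" "1 \<le> q" and A: "A \<in> bounded_ops 2 q" and B: "B \<in> bounded_ops p 2"
  shows "norm (walsh_pairing n (block_matrix (A \<circ> B) n)) \<le> op_norm 2 q A * op_norm p 2 B * (2 ^ n) powr (3/2)"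
proof -
  have pq0: "0 < p" "0 < q" using pq by auto
  define N where "N = (2::nat) ^ n"
  define a where "a = op_norm 2 q A"
  define b where "b = op_norm p 2 B"
  have ab: "0 \<le> a" "0 \<le> b" unfolding a_def b_def using pq0 by (auto intro: op_norm_nonneg)
  define u where "u j = B (unit_seq (prod_encode (n, j)))" for j
  have u: "u j \<in> lp 2" "(lp_norm 2 (u j))\<^sup>2 \<le> b\<^sup>2" for j
  proof -
    show "u j \<in> lp 2" unfolding u_def by (rule bounded_ops_in_lp[OF B])
    have "lp_norm 2 (u j) \<le> b"
      using op_norm_bound[OF B unit_seq_lp(1)[OF pq0(1)] pq0(1), of "prod_encode (n, j)"] unit_seq_lp(2)[OF pq0(1), where 'k = 'k]
      by (simp add: u_def b_def)
    thus "(lp_norm 2 (u j))\<^sup>2 \<le> b\<^sup>2" by (intro power_mono) auto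
  qed
  define g where "g i = (\<Sum>j<N. seq_scale (of_real (walsh n i j)) (u j))" for i
  have g: "g i \<in> lp 2" for i unfolding g_def using u(1) by (intro lp_sum_closed lp_scale) auto
  have "walsh_pairing n (block_matrix (A \<circ> B) n) = (\<Sum>i<N. A (g i) (prod_encode (n, i)))"
    unfolding walsh_pairing_def N_def[symmetric]
  proof (intro sum.cong refl)
    fix i
    have "A (g i) = (\<Sum>j<N. seq_scale (of_real (walsh n i j)) (A (u j)))"
      unfolding g_def by (rule bounded_ops_sum[OF A]) (use u(1) in auto)
    thus "(\<Sum>j<N. of_real (walsh n i j) * block_matrix (A \<circ> B) n i j) = A (g i) (prod_encode (n, i))"
      by (simp add: seq_sum_apply seq_scale_def block_matrix_def u_def)
  qed
  hence "norm (walsh_pairing n (block_matrix (A \<circ> B) n)) \<le> (\<Sum>i<N. norm (A (g i) (prod_encode (n, i))))"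
    by (simp add: norm_sum)
  also have "\<dots> \<le> (\<Sum>i<N. a * lp_norm 2 (g i))"
  proof (intro sum_mono)
    fix i
    have "norm (A (g i) (prod_encode (n, i))) \<le> lp_norm q (A (g i))"
      by (rule lp_coord_le[OF bounded_ops_in_lp[OF A] pq0(2)])
    also have "\<dots> \<le> a * lp_norm 2 (g i)" unfolding a_def by (rule op_norm_bound[OF A g _ pq0(2)]) simp
    finally show "norm (A (g i) (prod_encode (n, i))) \<le> a * lp_norm 2 (g i)" .
  qed
  also have "\<dots> = a * (\<Sum>i<N. lp_norm 2 (g i))" by (simp add: sum_distrib_left)
  also have "\<dots> \<le> a * (b * real N powr (3/2))"
  proof (intro mult_left_mono)
    have su: "summable (\<lambda>k. (norm (g i k))\<^sup>2)" "summable (\<lambda>k. (norm (u i k))\<^sup>2)" for i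
      using lp_two_summable g u by auto
    have "(\<Sum>i<N. (lp_norm 2 (g i))\<^sup>2) = (\<Sum>i<N. \<Sum>k. (norm (g i k))\<^sup>2)"
      using lp_norm_two_square[OF g] by simp
    also have "\<dots> = (\<Sum>k. \<Sum>i<N. (norm (g i k))\<^sup>2)" by (rule suminf_sum[symmetric, OF su(1)])
    also have "\<dots> = (\<Sum>k. real N * (\<Sum>j<N. (norm (u j k))\<^sup>2))"
      using walsh_sum_square[of n "\<lambda>j. u j _"] by (simp add: g_def seq_sum_apply seq_scale_def N_def)
    also have "\<dots> = real N * (\<Sum>k. \<Sum>j<N. (norm (u j k))\<^sup>2)"
      by (rule suminf_mult, rule summable_sum, rule su(2))
    also have "(\<Sum>k. \<Sum>j<N. (norm (u j k))\<^sup>2) = (\<Sum>j<N. \<Sum>k. (norm (u j k))\<^sup>2)" by (rule suminf_sum[OF su(2)])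
    also have "\<dots> = (\<Sum>j<N. (lp_norm 2 (u j))\<^sup>2)" using lp_norm_two_square[OF u(1)] by simp
    also have "real N * \<dots> \<le> real N * (\<Sum>j<N. b\<^sup>2)" using u(2) by (intro mult_left_mono sum_mono) auto
    finally have g2: "(\<Sum>i<N. (lp_norm 2 (g i))\<^sup>2) \<le> (real N * b)\<^sup>2"
      by (simp add: power2_eq_square mult_ac)
    have "(\<Sum>i<N. lp_norm 2 (g i) * 1)\<^sup>2 \<le> (\<Sum>i<N. (lp_norm 2 (g i))\<^sup>2) * (\<Sum>i<N. 1\<^sup>2)"
      by (rule Cauchy_Schwarz_ineq_sum)
    also have "\<dots> \<le> (real N * b)\<^sup>2 * real N" using mult_right_mono[OF g2, of "real N"] by simp
    also have "\<dots> = (b * real N powr (3/2))\<^sup>2"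
    proof -
      have "(real N powr (3/2))\<^sup>2 = real N powr 3" by (simp add: power2_eq_square flip: powr_add)
      thus ?thesis by (simp add: power_mult_distrib power2_eq_square power3_eq_cube mult_ac)
    qed
    finally have "(\<Sum>i<N. lp_norm 2 (g i))\<^sup>2 \<le> (b * real N powr (3/2))\<^sup>2" by simp
    thus "(\<Sum>i<N. lp_norm 2 (g i)) \<le> b * real N powr (3/2)"
      by (rule power2_le_imp_le) (use ab in auto)
  qed (use ab in auto)
  finally show ?thesis by (simp add: a_def b_def N_def mult.assoc)
qed

text \<open>
  The blocks are chosen to almost maximise the pairing over the unit ball of matrices, so an error of
  small operator norm changes the pairing by at most half of it, without any estimate of the dual
  norm. The Walsh matrices then show that the maximum exceeds the bound for factorisations by a
  factor that tends to infinity.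
\<close>

lemma exists_not_factor_l2:
  assumes p: "1 < p" "p < 2" and q: "2 < q"
  shows "\<exists>U :: 'k::{real_normed_field, euclidean_space} operator. U \<in> bounded_ops p q \<and> U \<notin> factor_l2_closure p q"
proof -
  have pq: "1 \<le> p" "1 \<le> q" "p \<le> q" "0 < p" "0 < q" using p q by auto
  define good where "good n M \<longleftrightarrow> M \<in> mat_unit_ball p q n \<and>
      (\<forall>L\<in>mat_unit_ball p q n. norm (walsh_pairing n (L :: nat \<Rightarrow> nat \<Rightarrow> 'k)) \<le> 2 * norm (walsh_pairing n M))"
    for n and M :: "nat \<Rightarrow> nat \<Rightarrow> 'k"
  have "\<exists>M. good n M" for n
    using mat_unit_ball_maximiser[OF pq(4,5), where 'k = 'k and n = n] unfolding good_def by metis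
  then obtain M where "good n (M n)" for n by metis
  hence M: "\<And>n. M n \<in> mat_unit_ball p q n"
    "\<And>n (L :: nat \<Rightarrow> nat \<Rightarrow> 'k). L \<in> mat_unit_ball p q n \<Longrightarrow> norm (walsh_pairing n L) \<le> 2 * norm (walsh_pairing n (M n))"
    unfolding good_def by blast+
  define U where "U = block_op p (\<lambda>n. 2 ^ n) (\<lambda>n. 2 ^ n) M"
  have U: "U \<in> bounded_ops p q"
    unfolding U_def by (rule block_op_bounded[where C = 1]) (use M(1) pq in \<open>auto simp: mat_unit_ball_def\<close>)
  moreover have "U \<notin> factor_l2_closure p q"
  proof
    assume close: "U \<in> factor_l2_closure p q"
    have G: "{A \<circ> B | A B. B \<in> bounded_ops p 2 \<and> A \<in> bounded_ops 2 q} \<subseteq> (bounded_ops p q :: 'k operator set)"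
      using bounded_ops_comp[of _ p 2 _ q] pq by auto
    \<comment> \<open>an error of norm \<open>1/4\<close> changes the pairing by at most half of the value for \<open>M n\<close>\<close>
    have "\<exists>S\<in>{A \<circ> B | A B. B \<in> bounded_ops p 2 \<and> A \<in> bounded_ops 2 q}.
        \<forall>x\<in>lp p. lp_norm q (U x - S x) \<le> 1/4 * lp_norm p x"
      using close unfolding factor_l2_closure_def op_closure_iff[OF pq(1,2) G]
      by (elim conjE allE[of _ "1/4"] impE) simp_all
    then obtain A B where AB: "B \<in> bounded_ops p 2" "A \<in> bounded_ops 2 q"
      "\<And>x. x \<in> lp p \<Longrightarrow> lp_norm q (U x - A (B x)) \<le> 1/4 * lp_norm p x"
      by auto
    define R where "R = U - (A \<circ> B)"
    have R: "R \<in> bounded_ops p q"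
      unfolding R_def using U bounded_ops_comp[OF AB(1,2)] pq by (intro bounded_ops_minus) auto
    define c where "c = 4 * op_norm 2 q A * op_norm p 2 B"
    define \<theta> where "\<theta> = (1 - 2/q) * (1/p - 1/2)"
    have \<theta>: "\<theta> > 0" unfolding \<theta>_def using p q by (intro mult_pos_pos) (auto simp: field_simps)
    have "(2 powr \<theta>) ^ n \<le> c" for n
    proof -
      define m where "m = norm (walsh_pairing n (M n))"
      have "(\<lambda>i j. 4 * block_matrix R n i j) \<in> mat_unit_ball p q n"
        unfolding mat_unit_ball_def
      proof (intro CollectI allI)
        fix a :: "nat \<Rightarrow> 'k"
        have "fin_norm q (2 ^ n) (\<lambda>i. \<Sum>j<2 ^ n. 4 * block_matrix R n i j * a j) =
            fin_norm q (2 ^ n) (\<lambda>i. 4 * (\<Sum>j<2 ^ n. block_matrix R n i j * a j))"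
          by (simp add: sum_distrib_left mult.assoc)
        also have "\<dots> = 4 * fin_norm q (2 ^ n) (\<lambda>i. \<Sum>j<2 ^ n. block_matrix R n i j * a j)"
          unfolding fin_norm_scale[OF pq(5)] by simp
        also have "\<dots> \<le> 4 * (1/4 * fin_norm p (2 ^ n) a)"
          using AB(3) by (intro mult_left_mono block_matrix_bound[OF pq(1,2) R]) (auto simp: R_def)
        finally show "fin_norm q (2 ^ n) (\<lambda>i. \<Sum>j<2 ^ n. 4 * block_matrix R n i j * a j) \<le> fin_norm p (2 ^ n) a" by simp
      qed
      from M(2)[OF this] have Rm: "2 * norm (walsh_pairing n (block_matrix R n)) \<le> m"
        unfolding walsh_pairing_scale by (simp add: norm_mult m_def)
      have "walsh_pairing n (M n) = walsh_pairing n (\<lambda>i j. block_matrix (A \<circ> B) n i j + block_matrix R n i j)"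
        unfolding walsh_pairing_def
      proof (intro sum.cong refl)
        fix i j :: nat assume "i \<in> {..<2 ^ n}" "j \<in> {..<2 ^ n}"
        hence "M n i j = block_matrix U n i j"
          unfolding U_def by (intro block_matrix_block_op[symmetric] pq) auto
        thus "of_real (walsh n i j) * M n i j =
            of_real (walsh n i j) * (block_matrix (A \<circ> B) n i j + block_matrix R n i j)"
          by (simp add: block_matrix_def R_def)
      qed
      hence "m \<le> norm (walsh_pairing n (block_matrix (A \<circ> B) n)) + norm (walsh_pairing n (block_matrix R n))"
        unfolding walsh_pairing_add m_def by (simp add: norm_triangle_ineq)
      moreover have "c * (2 ^ n) powr (3/2) = 4 * (op_norm 2 q A * op_norm p 2 B * (2 ^ n) powr (3/2))"
        by (simp add: c_def)
      ultimately have "2 * m \<le> c * (2 ^ n) powr (3/2)"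
        using walsh_pairing_factor_l2_le[OF pq(1,2) AB(2,1), of n] Rm by linarith
      moreover obtain L :: "nat \<Rightarrow> nat \<Rightarrow> 'k" where "L \<in> mat_unit_ball p q n"
          "norm (walsh_pairing n L) = (2 ^ n) powr (2 - (1/q + (1 - 1/p) * (1 - 2/q)))"
        using walsh_maximum_ge[of p q n, where 'k = 'k] p q by auto
      with M(2)[of L n] have "(2 ^ n) powr (2 - (1/q + (1 - 1/p) * (1 - 2/q))) \<le> 2 * m" by (simp add: m_def)
      moreover have "2 - (1/q + (1 - 1/p) * (1 - 2/q)) = \<theta> + 3/2"
        using pq by (simp add: \<theta>_def field_simps)
      ultimately have "(2 ^ n) powr \<theta> * (2 ^ n) powr (3/2) \<le> c * (2 ^ n) powr (3/2)"
        by (simp only: powr_add)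
      hence "(2 ^ n) powr \<theta> \<le> c" by (rule mult_right_le_imp_le) simp
      thus ?thesis by (simp add: powr_power powr_powr mult.commute flip: powr_realpow)
    qed
    moreover have "1 < 2 powr \<theta>" using \<theta> by simp
    ultimately show False using real_arch_pow[of "2 powr \<theta>" c] by (meson not_le)
  qed
  ultimately show ?thesis by blast
qed

section \<open>The four ideals\<close>

theorem mainTheorem1:
  fixes p q :: real
    and K J_id J_fss J_l2 :: "'k::{real_normed_field, euclidean_space} operator set"
  assumes "1 < p" "p < 2" "2 < q"
    and "K = compact_ops p q"
    and "J_id = generated_ideal p q (formal_identity p)"
    and "J_fss = fss_ops p q"
    and "J_l2 = factor_l2_closure p q"
  shows "distinct [K, J_id, J_fss, J_l2] \<and>
    (\<forall>J\<in>{K, J_id, J_fss, J_l2}. closed_op_ideal p q J \<and> J \<noteq> bounded_ops p q)"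
proof -
  have pq: "1 \<le> p" "1 \<le> q" "0 < p" "0 < q" using assms(1-3) by auto
  define I :: "'k operator" where "I = formal_identity p"
  define T :: "'k operator" where "T = formal_identity 2 \<circ> rad_coeff p"
  define V :: "'k operator" where "V = rad_embed q \<circ> rad_coeff p"
  have I: "I \<in> bounded_ops p q" unfolding I_def using assms(1-3) by (intro formal_identity_bounded) auto
  have id2: "(formal_identity 2 :: 'k operator) \<in> bounded_ops 2 q" using assms(3) by (intro formal_identity_bounded) auto
  have rc: "(rad_coeff p :: 'k operator) \<in> bounded_ops p 2" using assms(1,2) by (intro rad_coeff_bounded) auto
  have re: "(rad_embed q :: 'k operator) \<in> bounded_ops 2 q" using assms(3) by (intro rad_embed_bounded) auto
  have ideals: "closed_op_ideal p q K" "closed_op_ideal p q J_id" "closed_op_ideal p q J_fss" "closed_op_ideal p q J_l2"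
    unfolding assms(4-7) using closed_op_ideal_compact[OF pq(1,2)] closed_op_ideal_generated[OF pq(1,2)] I
      closed_op_ideal_fss[OF assms(1) pq(2)] closed_op_ideal_factor_l2[OF pq(1,2)] by (simp_all add: I_def)

  have I_id: "I \<in> J_id" unfolding assms(5) generated_ideal_def I_def by blast
  have "I \<in> l2_null_ops p q" unfolding I_def using assms(1-3) by (intro formal_identity_l2_null) auto
  hence id_null: "J_id \<subseteq> l2_null_ops p q"
    unfolding assms(5) generated_ideal_def I_def using closed_op_ideal_l2_null[OF pq(1,2)] by blast
  have I_K: "I \<notin> K"
    unfolding assms(4)
  proof (rule not_compact_if_hits_unit_seqs[OF pq(1,2), where x = unit_seq and g = "\<lambda>n. n"])
    show "I (unit_seq n) = unit_seq n" for n by (simp add: I_def formal_identity_def unit_seq_lp(1)[OF pq(3)])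
  qed (simp_all add: unit_seq_lp[OF pq(3)])

  have T_l2: "T \<in> J_l2" unfolding assms(7) T_def by (rule factor_l2I[OF pq(1,2) rc id2])
  have T_fss: "T \<in> J_fss"
  proof -
    have "(formal_identity q :: 'k operator) \<in> bounded_ops q q" using pq by (intro formal_identity_bounded) auto
    hence "formal_identity q \<circ> formal_identity 2 \<circ> rad_coeff p \<in> (fss_ops p q :: 'k operator set)"
      using pq by (intro fss_ops_comp[OF _ _ _ _ rc formal_identity_two_fss[OF assms(3)]]) auto
    moreover have "formal_identity q \<circ> formal_identity 2 \<circ> rad_coeff p = T"
      using bounded_ops_in_lp[OF id2] by (auto simp: T_def fun_eq_iff formal_identity_def)
    ultimately show ?thesis by (simp add: assms(6))
  qed
  have T_id: "T \<notin> J_id" using rad_coeff_not_l2_null[OF pq(3,4) T_def] id_null by blast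
  have T_K: "T \<notin> K"
    unfolding assms(4)
  proof (rule not_compact_if_hits_unit_seqs[OF pq(1,2),
        where x = "\<lambda>n. rad_unit p (Suc n) 0" and g = "\<lambda>n. prod_encode (Suc n, 0)"])
    show "T (rad_unit p (Suc n) 0) = unit_seq (prod_encode (Suc n, 0))" for n
      by (simp add: T_def rad_coeff_rad_unit[OF pq(3)] formal_identity_def unit_seq_lp(1))
  qed (simp_all add: rad_unit_def rad_vec_lp[OF pq(3)] rad_vec_norm_unit[OF pq(3)] inj_def prod_encode_eq)

  have V_l2: "V \<in> J_l2" unfolding assms(7) V_def by (rule factor_l2I[OF pq(1,2) rc re])
  have V_fss: "V \<notin> J_fss" unfolding assms(6) by (rule rad_projection_not_fss[OF assms(1-3) V_def])
  obtain U where U: "U \<in> bounded_ops p q" "U \<notin> J_l2"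
    using exists_not_factor_l2[OF assms(1-3)] unfolding assms(7) by blast
  have TV: "T \<in> bounded_ops p q" "V \<in> bounded_ops p q"
    using T_l2 V_l2 closed_op_idealD(1)[OF ideals(4)] by auto

  have "distinct [K, J_id, J_fss, J_l2]" using I_id I_K T_l2 T_fss T_id T_K V_l2 V_fss by auto
  moreover have "K \<noteq> bounded_ops p q" "J_id \<noteq> bounded_ops p q" "J_fss \<noteq> bounded_ops p q" "J_l2 \<noteq> bounded_ops p q"
    using TV U T_K T_id V_fss by auto
  ultimately show ?thesis using ideals by auto
qed

end
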